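(* Let $\mathbb{K}$ be a field and let $p,q\in\mathbb{K}^{\ast}$ be such that neither $p$ nor $q$ is a root of unity. Then each $\mathbb{K}$-algebra endomorphism of the localization $(\mathcal{A}_p(1,1,\mathbb{K}_q[s,t]))_{\mathbb{S}}$ is an algebra automorphism.
   Context: $\mathcal{A}_p(1,1,\mathbb{K}_q[s,t])$ denotes the associative unital $\mathbb{K}$-algebra generated by $x,y,s,t$ subject to the relations $$xy-pyx=1,\quad st=qts,\quad sx=xs,\quad sy=ys,\quad tx=xt,\quad ty=yt.$$ Put $z:=xy-yx$; then $xz=pzx$, $yz=p^{-1}zy$, $sz=zs$, $tz=zt$. The subscript $\mathbb{S}$ denotes the Ore localization at $\mathbb{S}=\{z^is^jt^k\mid i,j,k\in\mathbb{Z}_{\ge0}\}$ (up to nonzero scalars), i.e. $z,s,t$ are inverted. Endomorphisms are unital. The number $1$ counts as a root of unity. *)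

theory Defs
  imports "HOL-Algebra.QuotRing" "HOL-Algebra.Module"
begin

section \<open>Associative unital algebras over a field\<close>

abbreviation scalar_ring :: "'k::field ring" where
  "scalar_ring \<equiv> \<lparr>carrier = UNIV, mult = (*), one = 1, zero = 0, add = (+)\<rparr>"

text \<open>The library locale \<^locale>\<open>algebra\<close> is restricted to commutative algebras.\<close>

locale assoc_algebra = module "scalar_ring :: 'k::field ring" A + ring A
  for A :: "('k::field, 'a, 'm) module_scheme" (structure) +
  assumes smult_mult_left:
      "\<lbrakk>a \<in> carrier A; b \<in> carrier A\<rbrakk> \<Longrightarrow> (c \<odot> a) \<otimes> b = c \<odot> (a \<otimes> b)"
    and smult_mult_right:
      "\<lbrakk>a \<in> carrier A; b \<in> carrier A\<rbrakk> \<Longrightarrow> a \<otimes> (c \<odot> b) = c \<odot> (a \<otimes> b)"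

definition alg_hom ::
    "('k, 'a, 'm) module_scheme \<Rightarrow> ('k, 'b, 'n) module_scheme \<Rightarrow> ('a \<Rightarrow> 'b) set" where
  "alg_hom A B = {h \<in> ring_hom A B.
     \<forall>c. \<forall>a \<in> carrier A. h (c \<odot>\<^bsub>A\<^esub> a) = c \<odot>\<^bsub>B\<^esub> h a}"

definition alg_iso ::
    "('k, 'a, 'm) module_scheme \<Rightarrow> ('k, 'b, 'n) module_scheme \<Rightarrow> ('a \<Rightarrow> 'b) set" where
  "alg_iso A B = {h \<in> alg_hom A B. bij_betw h (carrier A) (carrier B)}"


section \<open>Algebras given by generators and relations\<close>

text \<open>Elements of the free algebra are finitely supported functions from words in the
  generators to the field; the product is convolution along concatenation of words.\<close>

definition free_algebra :: "('k::field, 'g list \<Rightarrow> 'k) module" where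
  "free_algebra =
    \<lparr>carrier = {f. finite {w. f w \<noteq> 0}},
     mult = (\<lambda>f g w. \<Sum>i\<le>length w. f (take i w) * g (drop i w)),
     one = (\<lambda>w. if w = [] then 1 else 0),
     zero = (\<lambda>w. 0),
     add = (\<lambda>f g w. f w + g w),
     smult = (\<lambda>c f w. c * f w)\<rparr>"

definition free_gen :: "'g \<Rightarrow> 'g list \<Rightarrow> 'k::field" where
  "free_gen g = (\<lambda>w. if w = [g] then 1 else 0)"

definition quot_algebra :: "('k, 'a, 'm) module_scheme \<Rightarrow> 'a set \<Rightarrow> ('k, 'a set) module" where
  "quot_algebra A I =
    \<lparr>carrier = carrier (A Quot I), mult = mult (A Quot I), one = one (A Quot I),
     zero = zero (A Quot I), add = add (A Quot I),
     smult = (\<lambda>c C. \<Union>a\<in>C. I +>\<^bsub>A\<^esub> (c \<odot>\<^bsub>A\<^esub> a))\<rparr>"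

lemma finite_support_convolution:
  fixes f g :: "'g list \<Rightarrow> 'k::field"
  assumes "finite {w. f w \<noteq> 0}" "finite {w. g w \<noteq> 0}"
  shows "finite {w. (\<Sum>i\<le>length w. f (take i w) * g (drop i w)) \<noteq> 0}"
proof (rule finite_subset)
  let ?P = "(\<lambda>(u, v). u @ v) ` ({w. f w \<noteq> 0} \<times> {w. g w \<noteq> 0})"
  show "{w. (\<Sum>i\<le>length w. f (take i w) * g (drop i w)) \<noteq> 0} \<subseteq> ?P"
  proof
    fix w assume "w \<in> {w. (\<Sum>i\<le>length w. f (take i w) * g (drop i w)) \<noteq> 0}"
    then obtain i where "f (take i w) * g (drop i w) \<noteq> 0"
      by (auto elim: sum.not_neutral_contains_not_neutral)
    then show "w \<in> ?P"
      by (intro image_eqI[where x = "(take i w, drop i w)"]) auto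
  qed
  show "finite ?P" using assms by simp
qed

lemma convolution_assoc:
  fixes f g h :: "'g list \<Rightarrow> 'k::field"
  shows "(\<Sum>i\<le>length w. (\<Sum>j\<le>length (take i w). f (take j (take i w)) * g (drop j (take i w)))
            * h (drop i w))
       = (\<Sum>i\<le>length w. f (take i w) *
            (\<Sum>j\<le>length (drop i w). g (take j (drop i w)) * h (drop j (drop i w))))"
    (is "?L = ?R")
proof -
  let ?t = "\<lambda>j i. f (take j w) * g (drop j (take i w)) * h (drop i w)"
  have "?L = (\<Sum>i\<le>length w. \<Sum>j\<le>i. ?t j i)"
    by (rule sum.cong) (auto simp: sum_distrib_right min_def intro!: sum.cong)
  also have "\<dots> = (\<Sum>(i, j)\<in>(SIGMA i:{..length w}. {..i}). ?t j i)"
    by (simp add: sum.Sigma)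
  also have "\<dots> = (\<Sum>(j, k)\<in>(SIGMA j:{..length w}. {..length w - j}). ?t j (j + k))"
    by (rule sum.reindex_bij_witness
        [where i = "\<lambda>(j, k). (j + k, j)" and j = "\<lambda>(i, j). (j, i - j)"]) auto
  also have "\<dots> = (\<Sum>j\<le>length w. \<Sum>k\<le>length w - j. ?t j (j + k))"
    by (simp add: sum.Sigma)
  also have "\<dots> = ?R"
    by (rule sum.cong)
      (auto simp: sum_distrib_left mult.assoc drop_take add.commute intro!: sum.cong)
  finally show ?thesis .
qed

lemma free_algebra_assoc_algebra: "assoc_algebra (free_algebra :: ('k::field, 'g list \<Rightarrow> 'k) module)"
proof -
  let ?F = "free_algebra :: ('k, 'g list \<Rightarrow> 'k) module"
  have add_fin: "finite {w. f w + g w \<noteq> 0}"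
    if "finite {w. f w \<noteq> 0}" "finite {w. g w \<noteq> 0}" for f g :: "'g list \<Rightarrow> 'k"
    by (rule finite_subset[OF _ finite_UnI[OF that]]) auto
  have smult_fin: "finite {w. c * f w \<noteq> 0}" if "finite {w. f w \<noteq> 0}"
    for c and f :: "'g list \<Rightarrow> 'k"
    by (rule finite_subset[OF _ that]) auto
  have neg: "\<exists>g. finite {w. g w \<noteq> 0} \<and> (\<lambda>w. f w + g w) = (\<lambda>w. 0)"
    if "finite {w. f w \<noteq> 0}" for f :: "'g list \<Rightarrow> 'k"
    using that by (intro exI[of _ "\<lambda>w. - f w"]) auto
  have ab: "abelian_group ?F"
    by (rule abelian_groupI)
      (auto simp: free_algebra_def add_fin neg algebra_simps)
  have one_left: "(\<Sum>i\<le>length w. (if take i w = [] then 1 else 0) * f (drop i w)) = f w"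
    for f :: "'g list \<Rightarrow> 'k" and w
  proof -
    have "(\<Sum>i\<le>length w. (if take i w = [] then 1 else 0) * f (drop i w))
        = (\<Sum>i\<in>{0}. f (drop i w))"
      by (rule sum.mono_neutral_cong_right) auto
    then show ?thesis by simp
  qed
  have one_right: "(\<Sum>i\<le>length w. f (take i w) * (if drop i w = [] then 1 else 0)) = f w"
    for f :: "'g list \<Rightarrow> 'k" and w
  proof -
    have "(\<Sum>i\<le>length w. f (take i w) * (if drop i w = [] then 1 else 0))
        = (\<Sum>i\<in>{length w}. f (take i w))"
      by (rule sum.mono_neutral_cong_right) auto
    then show ?thesis by simp
  qed
  have mon: "monoid ?F"
    by (rule monoidI)
      (use one_left one_right in
        \<open>auto simp: free_algebra_def finite_support_convolution convolution_assoc
          simp del: length_take length_drop take_take drop_drop\<close>)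
  have ring: "ring ?F"
    by (rule ringI[OF ab mon])
      (auto simp: free_algebra_def distrib_left distrib_right sum.distrib)
  have cring: "cring (scalar_ring :: 'k ring)"
  proof (rule cringI)
    show "abelian_group (scalar_ring :: 'k ring)"
      by (rule abelian_groupI) (auto simp: algebra_simps intro: exI[of _ "- _"])
    show "comm_monoid (scalar_ring :: 'k ring)"
      by (rule comm_monoidI) (auto simp: algebra_simps)
  qed (auto simp: algebra_simps)
  have "module (scalar_ring :: 'k ring) ?F"
    by (rule moduleI[OF cring ab])
      (auto simp: free_algebra_def smult_fin algebra_simps)
  then show ?thesis
    using ring by (auto intro!: assoc_algebra.intro assoc_algebra_axioms.intro
      simp: free_algebra_def sum_distrib_left mult_ac)
qed


section \<open>Ore localization\<close>

text \<open>The (left) Ore localization of an algebra at a multiplicative set \<open>S\<close>, determined up to a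
  unique isomorphism under the algebra: a map \<open>\<iota>\<close> into an algebra \<open>L\<close> that inverts \<open>S\<close>, for which
  every element of \<open>L\<close> is a left fraction, and whose kernel is the \<open>S\<close>-torsion. When \<open>S\<close>
  satisfies the Ore condition on both sides, left and right localization coincide.\<close>

definition ore_localization ::
    "('k::field, 'a) module \<Rightarrow> 'a set \<Rightarrow> ('k, 'b) module \<Rightarrow> ('a \<Rightarrow> 'b) \<Rightarrow> bool" where
  "ore_localization A S L \<iota> \<longleftrightarrow>
     assoc_algebra L \<and> \<iota> \<in> alg_hom A L \<and>
     (\<forall>u\<in>S. \<iota> u \<in> Units L) \<and>
     (\<forall>l\<in>carrier L. \<exists>u\<in>S. \<exists>a\<in>carrier A. l = inv\<^bsub>L\<^esub> (\<iota> u) \<otimes>\<^bsub>L\<^esub> \<iota> a) \<and>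
     (\<forall>a\<in>carrier A. \<iota> a = \<zero>\<^bsub>L\<^esub> \<longleftrightarrow> (\<exists>u\<in>S. u \<otimes>\<^bsub>A\<^esub> a = \<zero>\<^bsub>A\<^esub>))"


section \<open>The algebra \<open>A\<^sub>p(1,1,K\<^sub>q[s,t])\<close>\<close>

datatype gen = X | Y | S | T

definition weyl_relators :: "'k::field \<Rightarrow> 'k \<Rightarrow> (gen list \<Rightarrow> 'k) set" where
  "weyl_relators p q =
    (let F = free_algebra; x = free_gen X; y = free_gen Y; s = free_gen S; t = free_gen T in
     {(x \<otimes>\<^bsub>F\<^esub> y \<ominus>\<^bsub>F\<^esub> p \<odot>\<^bsub>F\<^esub> (y \<otimes>\<^bsub>F\<^esub> x)) \<ominus>\<^bsub>F\<^esub> \<one>\<^bsub>F\<^esub>,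
      s \<otimes>\<^bsub>F\<^esub> t \<ominus>\<^bsub>F\<^esub> q \<odot>\<^bsub>F\<^esub> (t \<otimes>\<^bsub>F\<^esub> s),
      s \<otimes>\<^bsub>F\<^esub> x \<ominus>\<^bsub>F\<^esub> x \<otimes>\<^bsub>F\<^esub> s,
      s \<otimes>\<^bsub>F\<^esub> y \<ominus>\<^bsub>F\<^esub> y \<otimes>\<^bsub>F\<^esub> s,
      t \<otimes>\<^bsub>F\<^esub> x \<ominus>\<^bsub>F\<^esub> x \<otimes>\<^bsub>F\<^esub> t,
      t \<otimes>\<^bsub>F\<^esub> y \<ominus>\<^bsub>F\<^esub> y \<otimes>\<^bsub>F\<^esub> t})"

definition weyl_algebra :: "'k::field \<Rightarrow> 'k \<Rightarrow> ('k, (gen list \<Rightarrow> 'k) set) module" where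
  "weyl_algebra p q = quot_algebra free_algebra (Idl\<^bsub>free_algebra\<^esub> (weyl_relators p q))"

definition weyl_gen :: "'k::field \<Rightarrow> 'k \<Rightarrow> gen \<Rightarrow> (gen list \<Rightarrow> 'k) set" where
  "weyl_gen p q g = (Idl\<^bsub>free_algebra\<^esub> (weyl_relators p q)) +>\<^bsub>free_algebra\<^esub> free_gen g"

definition weyl_z :: "'k::field \<Rightarrow> 'k \<Rightarrow> (gen list \<Rightarrow> 'k) set" where
  "weyl_z p q =
    weyl_gen p q X \<otimes>\<^bsub>weyl_algebra p q\<^esub> weyl_gen p q Y \<ominus>\<^bsub>weyl_algebra p q\<^esub>
    weyl_gen p q Y \<otimes>\<^bsub>weyl_algebra p q\<^esub> weyl_gen p q X"

text \<open>The monomials in \<open>z, s, t\<close> are closed under multiplication only up to nonzero scalars,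
  so these are included.\<close>

definition weyl_ore_set :: "'k::field \<Rightarrow> 'k \<Rightarrow> (gen list \<Rightarrow> 'k) set set" where
  "weyl_ore_set p q =
    (let A = weyl_algebra p q in
     {c \<odot>\<^bsub>A\<^esub> (weyl_z p q [^]\<^bsub>A\<^esub> i \<otimes>\<^bsub>A\<^esub> weyl_gen p q S [^]\<^bsub>A\<^esub> j \<otimes>\<^bsub>A\<^esub> weyl_gen p q T [^]\<^bsub>A\<^esub> k)
      | c (i::nat) (j::nat) (k::nat). c \<noteq> 0})"

definition root_of_unity :: "'k::field \<Rightarrow> bool" where
  "root_of_unity c \<longleftrightarrow> (\<exists>n::nat. n \<ge> 1 \<and> c ^ n = 1)"

end

theory Submission
  imports Defs "HOL-Library.Product_Lexorder" "HOL-Library.Product_Plus"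
begin

text \<open>
In the localization \<open>L\<close> one has \<open>xy - pyx = 1\<close> and \<open>z = xy - yx\<close>, hence \<open>yx = (z - 1) / (p - 1)\<close>.
Once \<open>x\<close> is inverted, \<open>y\<close> is therefore expressible by the other generators, and \<open>L\<close> embeds
(map \<open>\<Psi>\<close>) into the quantum torus with basis \<open>z\<^sup>i s\<^sup>j t\<^sup>k x\<^sup>a\<close>, a twisted group algebra of
\<open>\<int>\<^sup>4\<close>. Order the exponents lexicographically, with \<open>z\<close> least significant. Highest and lowest
exponents of products add (\<open>mult_deg\<close>), so the torus is a domain and its units are monomials. A
monomial of negative degree in \<open>x\<close> is never in the image of \<open>L\<close>, because the coefficient of
\<open>x\<^bsup>-m\<^esup>\<close> in an element of \<open>L\<close> is divisible by \<open>z - 1\<close> (\<open>vanishing_\<Psi>\<close>); so the units of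
\<open>L\<close> are exactly the scalar multiples of the \<open>z\<^sup>i s\<^sup>j t\<^sup>k\<close>.

Let \<open>\<phi>\<close> be an endomorphism of \<open>L\<close>. It maps \<open>z\<close>, \<open>s\<close>, \<open>t\<close> to units, that is, to
monomials. As \<open>q\<close> is not a root of unity, \<open>st = qts\<close> forces the exponents of \<open>\<phi>(s)\<close> and
\<open>\<phi>(t)\<close> in \<open>s\<close> and \<open>t\<close> to have determinant one, and commutation with both makes \<open>\<phi>(z)\<close> a
multiple of a power \<open>z\<^sup>e\<close> (\<open>unit_degrees\<close>). As \<open>p\<close> is not a root of unity, \<open>xz = pzx\<close> and
\<open>zy = pyz\<close> force \<open>e = 1\<close> or \<open>e = -1\<close>, with \<open>\<phi>(x)\<close> and \<open>\<phi>(y)\<close> homogeneous of degrees \<open>e\<close>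
and \<open>-e\<close> in \<open>x\<close> (\<open>xy_degrees\<close>).

Injectivity: the images of the monomials \<open>z\<^sup>i s\<^sup>j t\<^sup>k x\<^sup>a\<close> and \<open>z\<^sup>i s\<^sup>j t\<^sup>k y\<^sup>a\<close>, which span \<open>L\<close>,
have pairwise distinct leading exponents (\<open>deg_basis_inj\<close>) and are thus linearly independent. For
\<open>\<phi> = id\<close> this also shows that \<open>\<Psi>\<close> is injective.

Surjectivity: by the determinant condition the image contains all units of \<open>L\<close>. Moreover
\<open>\<phi>(y) \<phi>(x)\<close> is a multiple of \<open>\<phi>(z) - 1\<close>, a binomial whose two exponents are adjacent in the order, so
one of the factors is a monomial and the other a binomial with adjacent exponents (\<open>width\<close>). The
factor of degree \<open>-1\<close> in \<open>x\<close> must be the binomial, and it is divisible by \<open>z - 1\<close>; so up to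
units the two factors are \<open>x\<close> and \<open>y\<close> (\<open>x_y_from_pair\<close>), and the image contains both.
\<close>

section \<open>Algebras over a field\<close>

lemma cring_scalar_ring: "cring (scalar_ring :: 'k::field ring)"
proof (rule cringI)
  show "abelian_group (scalar_ring :: 'k ring)"
    by (rule abelian_groupI) (auto simp: algebra_simps intro: exI[of _ "- _"])
  show "comm_monoid (scalar_ring :: 'k ring)"
    by (rule comm_monoidI) (auto simp: algebra_simps)
qed (auto simp: algebra_simps)

context assoc_algebra
begin

lemma scale_closed [simp, intro]: "a \<in> carrier A \<Longrightarrow> c \<odot> a \<in> carrier A"
  using smult_closed by simp

lemma scale_scale [simp]: "a \<in> carrier A \<Longrightarrow> c \<odot> (d \<odot> a) = (c * d) \<odot> a"
  using smult_assoc1 by simp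

lemma scale_one [simp]: "a \<in> carrier A \<Longrightarrow> (1::'k) \<odot> a = a"
  using smult_one by simp

lemma scale_zero_left [simp]: "a \<in> carrier A \<Longrightarrow> (0::'k) \<odot> a = \<zero>"
  using smult_l_null by simp

lemma scale_zero_right [simp]: "c \<odot> \<zero> = \<zero>"
  using smult_r_null[of c] by simp

lemma scale_add_left: "a \<in> carrier A \<Longrightarrow> (c + d) \<odot> a = c \<odot> a \<oplus> d \<odot> a"
  using smult_l_distr[of c d a] by simp

lemma scale_add_right:
  "a \<in> carrier A \<Longrightarrow> b \<in> carrier A \<Longrightarrow> c \<odot> (a \<oplus> b) = c \<odot> a \<oplus> c \<odot> b"
  using smult_r_distr[of c a b] by simp

lemma scale_minus_one: "a \<in> carrier A \<Longrightarrow> (-1::'k) \<odot> a = \<ominus> a"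
proof -
  assume a: "a \<in> carrier A"
  have "(-1::'k) \<odot> a \<oplus> a = (-1 + 1 :: 'k) \<odot> a"
    using a scale_add_left[of a "-1" 1] by simp
  then show ?thesis using a by (simp add: minus_equality)
qed

lemma scale_minus_left: "a \<in> carrier A \<Longrightarrow> (- c) \<odot> a = \<ominus> (c \<odot> a)"
  using scale_minus_one[of "c \<odot> a"] by simp

lemma scale_diff_left: "a \<in> carrier A \<Longrightarrow> (c - d) \<odot> a = c \<odot> a \<ominus> d \<odot> a"
  using scale_add_left[of a c "- d"] by (simp add: scale_minus_left minus_eq)

lemma scale_cancel:
  assumes "c \<noteq> 0" "a \<in> carrier A" "b \<in> carrier A" "c \<odot> a = c \<odot> b"
  shows "a = b"
proof -
  have "inverse c \<odot> (c \<odot> a) = inverse c \<odot> (c \<odot> b)" using assms by simp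
  then show ?thesis using assms(1-3) by simp
qed

lemma scale_Units:
  assumes "c \<noteq> 0" "u \<in> Units A"
  shows "c \<odot> u \<in> Units A"
proof -
  have "u \<in> carrier A" "inv u \<in> carrier A" using assms by auto
  then show ?thesis
    using assms Units_l_inv[OF assms(2)] Units_r_inv[OF assms(2)] unfolding Units_def[of A]
    by (auto simp: smult_mult_left smult_mult_right intro!: bexI[of _ "inverse c \<odot> inv u"])
qed

end

section \<open>Twisted group algebras of ordered groups\<close>

text \<open>Functions of finite support on an abelian group stand for finite sums of basis elements
\<open>e\<^sub>m\<close>, multiplied by \<open>e\<^sub>m e\<^sub>n = \<beta> m n e\<^bsub>m + n\<^esub>\<close>. Quantum tori are the case
of \<open>\<int>\<^sup>n\<close> with a bicharacter \<open>\<beta>\<close>.\<close>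

definition twisted_group_algebra ::
    "('g::ab_group_add \<Rightarrow> 'g \<Rightarrow> 'k::field) \<Rightarrow> ('k, 'g \<Rightarrow> 'k) module" where
  "twisted_group_algebra \<beta> =
    \<lparr>carrier = {f. finite {n. f n \<noteq> 0}},
     mult = (\<lambda>f g n. \<Sum>m | f m \<noteq> 0. f m * g (n - m) * \<beta> m (n - m)),
     one = (\<lambda>n. if n = 0 then 1 else 0),
     zero = (\<lambda>n. 0),
     add = (\<lambda>f g n. f n + g n),
     smult = (\<lambda>c f n. c * f n)\<rparr>"

locale twisting =
  fixes \<beta> :: "'g::linordered_ab_group_add \<Rightarrow> 'g \<Rightarrow> 'k::field"
  assumes cocycle: "\<beta> a b * \<beta> (a + b) c = \<beta> b c * \<beta> a (b + c)"
    and nonzero [simp]: "\<beta> a b \<noteq> 0"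
    and normal_left [simp]: "\<beta> 0 a = 1"
    and normal_right [simp]: "\<beta> a 0 = 1"
begin

abbreviation P :: "('k, 'g \<Rightarrow> 'k) module" where "P \<equiv> twisted_group_algebra \<beta>"

lemma P_simps:
  "f \<in> carrier P \<longleftrightarrow> finite {n. f n \<noteq> 0}"
  "\<one>\<^bsub>P\<^esub> = (\<lambda>n. if n = 0 then 1 else 0)"
  "\<zero>\<^bsub>P\<^esub> = (\<lambda>n. 0)"
  "f \<oplus>\<^bsub>P\<^esub> g = (\<lambda>n. f n + g n)"
  "c \<odot>\<^bsub>P\<^esub> f = (\<lambda>n. c * f n)"
  by (simp_all add: twisted_group_algebra_def)

lemma mult_eq:
  assumes "finite A" "{m. f m \<noteq> 0} \<subseteq> A"
  shows "(f \<otimes>\<^bsub>P\<^esub> g) n = (\<Sum>m\<in>A. f m * g (n - m) * \<beta> m (n - m))"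
  unfolding twisted_group_algebra_def
  using assms by (auto intro!: sum.mono_neutral_left)

lemma mult_support:
  assumes "(f \<otimes>\<^bsub>P\<^esub> g) n \<noteq> 0"
  obtains a b where "f a \<noteq> 0" "g b \<noteq> 0" "n = a + b"
proof -
  from assms obtain m where "f m * g (n - m) * \<beta> m (n - m) \<noteq> 0"
    unfolding twisted_group_algebra_def by (auto elim: sum.not_neutral_contains_not_neutral)
  then show ?thesis by (intro that[of m "n - m"]) auto
qed

lemma mult_closed:
  assumes "f \<in> carrier P" "g \<in> carrier P"
  shows "f \<otimes>\<^bsub>P\<^esub> g \<in> carrier P"
proof -
  have "{n. (f \<otimes>\<^bsub>P\<^esub> g) n \<noteq> 0} \<subseteq> (\<lambda>(a, b). a + b) ` ({n. f n \<noteq> 0} \<times> {n. g n \<noteq> 0})"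
    by (auto elim!: mult_support)
  then show ?thesis
    using assms by (auto simp: P_simps intro: finite_subset)
qed

lemma mult_assoc:
  assumes f: "f \<in> carrier P" and g: "g \<in> carrier P" and h: "h \<in> carrier P"
  shows "(f \<otimes>\<^bsub>P\<^esub> g) \<otimes>\<^bsub>P\<^esub> h = f \<otimes>\<^bsub>P\<^esub> (g \<otimes>\<^bsub>P\<^esub> h)"
proof
  fix n
  define A B where "A = {n. f n \<noteq> 0}" and "B = {n. g n \<noteq> 0}"
  \<comment> \<open>a finite set of exponents that contains the support of \<open>f g\<close>\<close>
  define C where "C = (\<lambda>(a, b). a + b) ` (A \<times> B)"
  have fin: "finite A" "finite B" "finite C"
    using f g by (auto simp: A_def B_def C_def P_simps)
  have C: "{n. (f \<otimes>\<^bsub>P\<^esub> g) n \<noteq> 0} \<subseteq> C"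
    by (auto simp: A_def B_def C_def elim!: mult_support)
  have shift: "(\<Sum>c\<in>C. f a * g (c - a) * \<beta> a (c - a) * h (n - c) * \<beta> c (n - c))
      = (\<Sum>b\<in>B. f a * g b * \<beta> a b * h (n - (a + b)) * \<beta> (a + b) (n - (a + b)))"
    if "a \<in> A" for a
  proof -
    have "(\<Sum>c\<in>C. f a * g (c - a) * \<beta> a (c - a) * h (n - c) * \<beta> c (n - c))
      = (\<Sum>c\<in>(\<lambda>b. a + b) ` B. f a * g (c - a) * \<beta> a (c - a) * h (n - c) * \<beta> c (n - c))"
    proof (rule sum.mono_neutral_right)
      show "\<forall>c\<in>C - (+) a ` B. f a * g (c - a) * \<beta> a (c - a) * h (n - c) * \<beta> c (n - c) = 0"
      proof
        fix c assume "c \<in> C - (+) a ` B"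
        then have "c - a \<notin> B" by (metis DiffD2 image_eqI add_diff_cancel_left' add.commute diff_add_cancel)
        then show "f a * g (c - a) * \<beta> a (c - a) * h (n - c) * \<beta> c (n - c) = 0"
          by (simp add: B_def)
      qed
    qed (use fin that in \<open>auto simp: C_def\<close>)
    then show ?thesis by (simp add: sum.reindex)
  qed
  have "((f \<otimes>\<^bsub>P\<^esub> g) \<otimes>\<^bsub>P\<^esub> h) n = (\<Sum>c\<in>C. (f \<otimes>\<^bsub>P\<^esub> g) c * h (n - c) * \<beta> c (n - c))"
    by (rule mult_eq) (use fin C in auto)
  also have "\<dots> = (\<Sum>c\<in>C. \<Sum>a\<in>A. f a * g (c - a) * \<beta> a (c - a) * h (n - c) * \<beta> c (n - c))"
    by (simp add: mult_eq[OF fin(1)] A_def sum_distrib_right)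
  also have "\<dots> = (\<Sum>a\<in>A. \<Sum>b\<in>B. f a * g b * \<beta> a b * h (n - (a + b)) * \<beta> (a + b) (n - (a + b)))"
    by (subst sum.swap) (simp add: shift)
  also have "\<dots> = (\<Sum>a\<in>A. \<Sum>b\<in>B. f a * (g b * h (n - a - b) * \<beta> b (n - a - b)) * \<beta> a (n - a))"
  proof (intro sum.cong refl)
    fix a b
    have "\<beta> a b * \<beta> (a + b) (n - a - b) = \<beta> b (n - a - b) * \<beta> a (n - a)"
      using cocycle[of a b "n - a - b"] by simp
    then show "f a * g b * \<beta> a b * h (n - (a + b)) * \<beta> (a + b) (n - (a + b))
        = f a * (g b * h (n - a - b) * \<beta> b (n - a - b)) * \<beta> a (n - a)"
      by (simp add: diff_diff_eq[symmetric])
  qed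
  also have "\<dots> = (\<Sum>a\<in>A. f a * (g \<otimes>\<^bsub>P\<^esub> h) (n - a) * \<beta> a (n - a))"
    by (simp add: mult_eq[OF fin(2)] B_def sum_distrib_right sum_distrib_left)
  also have "\<dots> = (f \<otimes>\<^bsub>P\<^esub> (g \<otimes>\<^bsub>P\<^esub> h)) n"
    by (rule mult_eq[symmetric]) (use fin in \<open>auto simp: A_def\<close>)
  finally show "((f \<otimes>\<^bsub>P\<^esub> g) \<otimes>\<^bsub>P\<^esub> h) n = (f \<otimes>\<^bsub>P\<^esub> (g \<otimes>\<^bsub>P\<^esub> h)) n" .
qed

definition monomial :: "'k \<Rightarrow> 'g \<Rightarrow> 'g \<Rightarrow> 'k" where
  "monomial c m = (\<lambda>n. if n = m then c else 0)"

lemma mono_apply: "monomial c m n = (if n = m then c else 0)"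
  by (simp add: monomial_def)

lemma mono_closed [simp, intro]: "monomial c m \<in> carrier P"
  by (auto simp: monomial_def P_simps intro: finite_subset[of _ "{m}"])

lemma mono_mult_apply: "(monomial c m \<otimes>\<^bsub>P\<^esub> g) n = c * g (n - m) * \<beta> m (n - m)"
  by (subst mult_eq[of "{m}"]) (auto simp: monomial_def)

lemma mult_mono_apply:
  assumes "f \<in> carrier P"
  shows "(f \<otimes>\<^bsub>P\<^esub> monomial c m) n = f (n - m) * c * \<beta> (n - m) m"
proof -
  have "(f \<otimes>\<^bsub>P\<^esub> monomial c m) n
      = (\<Sum>a\<in>insert (n - m) {a. f a \<noteq> 0}. f a * monomial c m (n - a) * \<beta> a (n - a))"
    by (rule mult_eq) (use assms in \<open>auto simp: P_simps\<close>)
  also have "\<dots> = (\<Sum>a\<in>{n - m}. f a * monomial c m (n - a) * \<beta> a (n - a))"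
    by (rule sum.mono_neutral_right) (use assms in \<open>auto simp: P_simps monomial_def\<close>)
  finally show ?thesis by (simp add: monomial_def)
qed

lemma mono_mult_mono: "monomial c m \<otimes>\<^bsub>P\<^esub> monomial d n = monomial (c * d * \<beta> m n) (m + n)"
  by (rule ext) (auto simp: mono_mult_apply mono_apply diff_eq_eq add.commute)

lemma one_eq_mono: "\<one>\<^bsub>P\<^esub> = monomial 1 0"
  by (simp add: P_simps monomial_def)

lemma scale_mono: "c \<odot>\<^bsub>P\<^esub> monomial d m = monomial (c * d) m"
  by (auto simp: P_simps monomial_def)

lemma add_closed: "f \<in> carrier P \<Longrightarrow> g \<in> carrier P \<Longrightarrow> f \<oplus>\<^bsub>P\<^esub> g \<in> carrier P"
  by (auto simp: P_simps intro: finite_subset[of _ "{n. f n \<noteq> 0} \<union> {n. g n \<noteq> 0}"])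

lemma mult_add_right:
  "f \<otimes>\<^bsub>P\<^esub> (g \<oplus>\<^bsub>P\<^esub> h) = (f \<otimes>\<^bsub>P\<^esub> g) \<oplus>\<^bsub>P\<^esub> (f \<otimes>\<^bsub>P\<^esub> h)"
  by (simp add: twisted_group_algebra_def algebra_simps sum.distrib)

lemma mult_add_left:
  assumes "f \<in> carrier P" "g \<in> carrier P"
  shows "(f \<oplus>\<^bsub>P\<^esub> g) \<otimes>\<^bsub>P\<^esub> h = (f \<otimes>\<^bsub>P\<^esub> h) \<oplus>\<^bsub>P\<^esub> (g \<otimes>\<^bsub>P\<^esub> h)"
proof -
  let ?A = "{n. f n \<noteq> 0} \<union> {n. g n \<noteq> 0}"
  have fin: "finite ?A" using assms by (simp add: P_simps)
  have "((f \<oplus>\<^bsub>P\<^esub> g) \<otimes>\<^bsub>P\<^esub> h) n = (f \<otimes>\<^bsub>P\<^esub> h) n + (g \<otimes>\<^bsub>P\<^esub> h) n" for n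
    by (subst (1 2 3) mult_eq[OF fin]) (auto simp: P_simps algebra_simps sum.distrib)
  then show ?thesis by (auto simp: P_simps)
qed

lemma scale_closed: "f \<in> carrier P \<Longrightarrow> c \<odot>\<^bsub>P\<^esub> f \<in> carrier P"
  by (auto simp: P_simps intro: finite_subset[of _ "{n. f n \<noteq> 0}"])

lemma scale_mult_left: "f \<in> carrier P \<Longrightarrow> (c \<odot>\<^bsub>P\<^esub> f) \<otimes>\<^bsub>P\<^esub> g = c \<odot>\<^bsub>P\<^esub> (f \<otimes>\<^bsub>P\<^esub> g)"
  by (rule ext, subst mult_eq[of "{n. f n \<noteq> 0}"])
    (auto simp: P_simps mult_eq[of "{n. f n \<noteq> 0}"] sum_distrib_left algebra_simps)

lemma scale_mult_right: "f \<in> carrier P \<Longrightarrow> f \<otimes>\<^bsub>P\<^esub> (c \<odot>\<^bsub>P\<^esub> g) = c \<odot>\<^bsub>P\<^esub> (f \<otimes>\<^bsub>P\<^esub> g)"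
  by (rule ext, subst mult_eq[of "{n. f n \<noteq> 0}"])
    (auto simp: P_simps mult_eq[of "{n. f n \<noteq> 0}"] sum_distrib_left algebra_simps)

lemma assoc_algebra_P: "assoc_algebra P"
proof -
  have ab: "abelian_group P"
  proof (rule abelian_groupI)
    fix f assume "f \<in> carrier P"
    then show "\<exists>g\<in>carrier P. g \<oplus>\<^bsub>P\<^esub> f = \<zero>\<^bsub>P\<^esub>"
      by (intro bexI[of _ "\<lambda>n. - f n"]) (auto simp: P_simps)
  qed (simp_all add: add_closed, simp_all add: P_simps algebra_simps)
  have one_left: "\<one>\<^bsub>P\<^esub> \<otimes>\<^bsub>P\<^esub> f = f" for f
    by (auto simp: one_eq_mono mono_mult_apply)
  have one_right: "f \<otimes>\<^bsub>P\<^esub> \<one>\<^bsub>P\<^esub> = f" if "f \<in> carrier P" for f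
    using that by (auto simp: one_eq_mono mult_mono_apply)
  have mon: "monoid P"
    by (rule monoidI)
      (auto simp: mult_closed mult_assoc one_left one_right, simp add: one_eq_mono)
  have ring: "ring P"
    by (rule ringI[OF ab mon]) (simp_all add: mult_add_left mult_add_right)
  have "module (scalar_ring :: 'k ring) P"
    by (rule moduleI[OF cring_scalar_ring ab])
      (simp_all add: scale_closed, simp_all add: P_simps algebra_simps)
  then show ?thesis
    using ring
    by (auto intro!: assoc_algebra.intro assoc_algebra_axioms.intro scale_mult_left scale_mult_right)
qed

end

sublocale twisting \<subseteq> P: assoc_algebra "twisted_group_algebra \<beta>"
  by (rule assoc_algebra_P)

context twisting
begin

definition deg :: "('g \<Rightarrow> 'k) \<Rightarrow> 'g" where "deg f = Max {n. f n \<noteq> 0}"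
definition ldeg :: "('g \<Rightarrow> 'k) \<Rightarrow> 'g" where "ldeg f = Min {n. f n \<noteq> 0}"

lemma nonzero_support: "f \<noteq> \<zero>\<^bsub>P\<^esub> \<Longrightarrow> {n. f n \<noteq> 0} \<noteq> {}"
  by (auto simp: P_simps)

lemma deg_works:
  assumes "f \<in> carrier P" "f \<noteq> \<zero>\<^bsub>P\<^esub>"
  shows "f (deg f) \<noteq> 0" and "f n \<noteq> 0 \<Longrightarrow> n \<le> deg f"
    and "f (ldeg f) \<noteq> 0" and "f n \<noteq> 0 \<Longrightarrow> ldeg f \<le> n"
proof -
  have fin: "finite {n. f n \<noteq> 0}" and ne: "{n. f n \<noteq> 0} \<noteq> {}"
    using assms nonzero_support by (auto simp: P_simps)
  show "f (deg f) \<noteq> 0" using Max_in[OF fin ne] by (simp add: deg_def)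
  show "f (ldeg f) \<noteq> 0" using Min_in[OF fin ne] by (simp add: ldeg_def)
  show "n \<le> deg f" if "f n \<noteq> 0" using Max_ge[OF fin, of n] that by (simp add: deg_def)
  show "ldeg f \<le> n" if "f n \<noteq> 0" using Min_le[OF fin, of n] that by (simp add: ldeg_def)
qed

lemma deg_eqI: "f \<in> carrier P \<Longrightarrow> f n \<noteq> 0 \<Longrightarrow> (\<And>m. f m \<noteq> 0 \<Longrightarrow> m \<le> n) \<Longrightarrow> deg f = n"
  unfolding deg_def by (rule Max_eqI) (auto simp: P_simps)

lemma ldeg_eqI: "f \<in> carrier P \<Longrightarrow> f n \<noteq> 0 \<Longrightarrow> (\<And>m. f m \<noteq> 0 \<Longrightarrow> n \<le> m) \<Longrightarrow> ldeg f = n"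
  unfolding ldeg_def by (rule Min_eqI) (auto simp: P_simps)

text \<open>Cancellation in a product can only happen at exponents that are sums of support elements in
several ways; this is why extreme exponents survive below.\<close>

lemma mult_apply_unique:
  assumes "f \<in> carrier P" and uniq: "\<And>a b. f a \<noteq> 0 \<Longrightarrow> g b \<noteq> 0 \<Longrightarrow> a + b = m + n \<Longrightarrow> a = m"
  shows "(f \<otimes>\<^bsub>P\<^esub> g) (m + n) = f m * g n * \<beta> m n"
proof -
  have "(f \<otimes>\<^bsub>P\<^esub> g) (m + n)
      = (\<Sum>a\<in>insert m {a. f a \<noteq> 0}. f a * g (m + n - a) * \<beta> a (m + n - a))"
    by (rule mult_eq) (use assms in \<open>auto simp: P_simps\<close>)
  also have "\<dots> = (\<Sum>a\<in>{m}. f a * g (m + n - a) * \<beta> a (m + n - a))"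
  proof (rule sum.mono_neutral_right)
    show "\<forall>a\<in>insert m {a. f a \<noteq> 0} - {m}. f a * g (m + n - a) * \<beta> a (m + n - a) = 0"
    proof
      fix a assume "a \<in> insert m {a. f a \<noteq> 0} - {m}"
      then show "f a * g (m + n - a) * \<beta> a (m + n - a) = 0"
        using uniq[of a "m + n - a"] by auto
    qed
  qed (use assms in \<open>auto simp: P_simps\<close>)
  finally show ?thesis by simp
qed

lemma add_eq_extreme:
  fixes a b m n :: 'g
  assumes "a \<le> m" "b \<le> n" "a + b = m + n"
  shows "a = m"
  using assms add_less_le_mono[of a m b n] by fastforce

text \<open>The largest exponent of a product is reached only by the pair of largest exponents, and likewise
for the smallest. Hence degrees add at both ends, and there are no zero divisors.\<close>

lemma mult_deg:
  assumes f: "f \<in> carrier P" "f \<noteq> \<zero>\<^bsub>P\<^esub>" and g: "g \<in> carrier P" "g \<noteq> \<zero>\<^bsub>P\<^esub>"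
  shows mult_nonzero: "f \<otimes>\<^bsub>P\<^esub> g \<noteq> \<zero>\<^bsub>P\<^esub>"
    and deg_mult: "deg (f \<otimes>\<^bsub>P\<^esub> g) = deg f + deg g"
    and ldeg_mult: "ldeg (f \<otimes>\<^bsub>P\<^esub> g) = ldeg f + ldeg g"
proof -
  note F = deg_works[OF f] and G = deg_works[OF g]
  have "(f \<otimes>\<^bsub>P\<^esub> g) (deg f + deg g) = f (deg f) * g (deg g) * \<beta> (deg f) (deg g)"
    by (rule mult_apply_unique[OF f(1)]) (use F(2) G(2) add_eq_extreme in blast)
  then have top: "(f \<otimes>\<^bsub>P\<^esub> g) (deg f + deg g) \<noteq> 0" using F G by simp
  have "(f \<otimes>\<^bsub>P\<^esub> g) (ldeg f + ldeg g) = f (ldeg f) * g (ldeg g) * \<beta> (ldeg f) (ldeg g)"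
    by (rule mult_apply_unique[OF f(1)]) (use F(4) G(4) add_eq_extreme in metis)
  then have bot: "(f \<otimes>\<^bsub>P\<^esub> g) (ldeg f + ldeg g) \<noteq> 0" using F G by simp
  show "f \<otimes>\<^bsub>P\<^esub> g \<noteq> \<zero>\<^bsub>P\<^esub>" using top by (auto simp: P_simps)
  show "deg (f \<otimes>\<^bsub>P\<^esub> g) = deg f + deg g"
    by (rule deg_eqI[OF mult_closed[OF f(1) g(1)] top])
      (auto elim!: mult_support intro!: add_mono F G)
  show "ldeg (f \<otimes>\<^bsub>P\<^esub> g) = ldeg f + ldeg g"
    by (rule ldeg_eqI[OF mult_closed[OF f(1) g(1)] bot])
      (auto elim!: mult_support intro!: add_mono F G)
qed

lemma deg_mono [simp]: "c \<noteq> 0 \<Longrightarrow> deg (monomial c m) = m"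
  by (rule deg_eqI) (auto simp: mono_apply split: if_splits)

lemma ldeg_mono [simp]: "c \<noteq> 0 \<Longrightarrow> ldeg (monomial c m) = m"
  by (rule ldeg_eqI) (auto simp: mono_apply split: if_splits)

lemma mono_eq_zero_iff [simp]: "monomial c m = \<zero>\<^bsub>P\<^esub> \<longleftrightarrow> c = 0"
  by (auto simp: P_simps monomial_def fun_eq_iff)

lemma ldeg_le_deg: "f \<in> carrier P \<Longrightarrow> f \<noteq> \<zero>\<^bsub>P\<^esub> \<Longrightarrow> ldeg f \<le> deg f"
  using deg_works by blast

lemma eq_mono_if_deg_eq:
  assumes "f \<in> carrier P" "f \<noteq> \<zero>\<^bsub>P\<^esub>" "deg f = ldeg f"
  shows "f = monomial (f (deg f)) (deg f)"
proof
  fix n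
  have "n = deg f" if "f n \<noteq> 0"
    using deg_works(2,4)[OF assms(1,2) that] assms(3) by simp
  then show "f n = monomial (f (deg f)) (deg f) n" by (auto simp: monomial_def)
qed

lemma one_nonzero: "\<one>\<^bsub>P\<^esub> \<noteq> \<zero>\<^bsub>P\<^esub>"
  by (simp add: one_eq_mono)

text \<open>The degree of \<open>u v = 1\<close> and its lowest degree are both zero, so the two nonnegative widths
\<open>deg - ldeg\<close> of \<open>u\<close> and \<open>v\<close> add up to zero.\<close>

lemma unit_is_mono:
  assumes u: "u \<in> Units P"
  obtains c where "c \<noteq> 0" "u = monomial c (deg u)"
proof -
  obtain v where v: "v \<in> carrier P" "u \<otimes>\<^bsub>P\<^esub> v = \<one>\<^bsub>P\<^esub>" and uc: "u \<in> carrier P"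
    using u by (auto simp: Units_def)
  have ne: "u \<noteq> \<zero>\<^bsub>P\<^esub>" "v \<noteq> \<zero>\<^bsub>P\<^esub>" using v uc one_nonzero by auto
  have "deg u + deg v = 0" "ldeg u + ldeg v = 0"
    using deg_mult[OF uc ne(1) v(1) ne(2)] ldeg_mult[OF uc ne(1) v(1) ne(2)] v
    by (simp_all add: one_eq_mono)
  moreover have "ldeg u \<le> deg u" "ldeg v \<le> deg v" using ldeg_le_deg uc v ne by auto
  ultimately have "deg u = ldeg u"
    by (metis add_eq_extreme)
  from eq_mono_if_deg_eq[OF uc ne(1) this] deg_works(1)[OF uc ne(1)] that show ?thesis by blast
qed

text \<open>Among the terms with nonzero coefficient one has the largest degree, and nothing else can cancel
its leading coefficient.\<close>

lemma independent_if_deg_inj: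
  assumes fin: "finite F" and car: "\<And>n. n \<in> F \<Longrightarrow> g n \<in> carrier P"
    and ne: "\<And>n. n \<in> F \<Longrightarrow> g n \<noteq> \<zero>\<^bsub>P\<^esub>" and inj: "inj_on (\<lambda>n. deg (g n)) F"
    and sum: "(\<lambda>k. \<Sum>n\<in>F. c n * g n k) = \<zero>\<^bsub>P\<^esub>" and n: "n \<in> F"
  shows "c n = 0"
proof (rule ccontr)
  assume "c n \<noteq> 0"
  define F' where "F' = {n \<in> F. c n \<noteq> 0}"
  have "finite F'" "F' \<noteq> {}" using fin n \<open>c n \<noteq> 0\<close> by (auto simp: F'_def)
  then have "Max ((\<lambda>n. deg (g n)) ` F') \<in> (\<lambda>n. deg (g n)) ` F'" by simp
  then obtain m where m: "m \<in> F'" and "Max ((\<lambda>n. deg (g n)) ` F') = deg (g m)" by auto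
  then have max: "deg (g n) \<le> deg (g m)" if "n \<in> F'" for n
    using that \<open>finite F'\<close> by (metis Max_ge finite_imageI imageI)
  have "(\<Sum>n\<in>F. c n * g n (deg (g m))) = (\<Sum>n\<in>{m}. c n * g n (deg (g m)))"
  proof (rule sum.mono_neutral_right)
    show "\<forall>i\<in>F - {m}. c i * g i (deg (g m)) = 0"
    proof
      fix i assume i: "i \<in> F - {m}"
      show "c i * g i (deg (g m)) = 0"
      proof (rule ccontr)
        assume *: "c i * g i (deg (g m)) \<noteq> 0"
        then have "deg (g m) \<le> deg (g i)" "deg (g i) \<le> deg (g m)"
          using deg_works(2)[OF car ne] i max[of i] by (auto simp: F'_def)
        then show False using inj i m by (auto simp: F'_def inj_on_def)
      qed
    qed
  qed (use fin m in \<open>auto simp: F'_def\<close>)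
  also have "\<dots> \<noteq> 0" using m deg_works(1)[OF car ne, of m] by (auto simp: F'_def)
  finally show False using fun_cong[OF sum] by (simp add: P_simps)
qed

end

section \<open>Linear combinations and homomorphisms\<close>

lemma finite_support_induct [consumes 1, case_names zero add]:
  fixes c :: "'i \<Rightarrow> 'k::field"
  assumes "finite {i. c i \<noteq> 0}"
    and zero: "Q (\<lambda>i. 0)"
    and add: "\<And>d a c. finite {i. c i \<noteq> 0} \<Longrightarrow> Q c \<Longrightarrow> Q (\<lambda>i. (if i = a then d else 0) + c i)"
  shows "Q c"
proof -
  have "\<forall>c. {i. c i \<noteq> 0} \<subseteq> A \<longrightarrow> Q c" if "finite A" for A
    using that
  proof induction
    case empty
    then show ?case using zero by (auto simp: fun_eq_iff)
  next
    case (insert a A)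
    show ?case
    proof (intro allI impI)
      fix c :: "'i \<Rightarrow> 'k" assume c: "{i. c i \<noteq> 0} \<subseteq> insert a A"
      let ?c = "c(a := 0)"
      have sub: "{i. ?c i \<noteq> 0} \<subseteq> A" using c by auto
      then have "Q (\<lambda>i. (if i = a then c a else 0) + ?c i)"
        using insert finite_subset[OF sub] by (intro add) blast+
      also have "(\<lambda>i. (if i = a then c a else 0) + ?c i) = c" by auto
      finally show "Q c" .
    qed
  qed
  then show ?thesis using assms(1) by blast
qed

context assoc_algebra
begin

definition lincomb :: "('i \<Rightarrow> 'a) \<Rightarrow> ('i \<Rightarrow> 'k) \<Rightarrow> 'a" where
  "lincomb b c = (\<Oplus>i\<in>{i. c i \<noteq> 0}. c i \<odot> b i)"

lemma lincomb_superset: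
  assumes "finite F" "{i. c i \<noteq> 0} \<subseteq> F" "\<And>i. b i \<in> carrier A"
  shows "lincomb b c = (\<Oplus>i\<in>F. c i \<odot> b i)"
  unfolding lincomb_def
  by (rule add.finprod_mono_neutral_cong_left) (use assms in auto)

lemma lincomb_closed [simp, intro]: "(\<And>i. b i \<in> carrier A) \<Longrightarrow> lincomb b c \<in> carrier A"
  unfolding lincomb_def by (rule finsum_closed) auto

lemma lincomb_zero [simp]: "lincomb b (\<lambda>i. 0) = \<zero>"
  by (simp add: lincomb_def)

lemma lincomb_add:
  assumes "\<And>i. b i \<in> carrier A" "finite {i. c i \<noteq> 0}" "finite {i. d i \<noteq> 0}"
  shows "lincomb b (\<lambda>i. c i + d i) = lincomb b c \<oplus> lincomb b d"
proof -
  let ?F = "{i. c i \<noteq> 0} \<union> {i. d i \<noteq> 0}"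
  have "lincomb b (\<lambda>i. c i + d i) = (\<Oplus>i\<in>?F. (c i + d i) \<odot> b i)"
    by (rule lincomb_superset) (use assms in auto)
  also have "\<dots> = (\<Oplus>i\<in>?F. c i \<odot> b i \<oplus> d i \<odot> b i)"
    by (rule finsum_cong') (use assms in \<open>auto simp: scale_add_left\<close>)
  also have "\<dots> = (\<Oplus>i\<in>?F. c i \<odot> b i) \<oplus> (\<Oplus>i\<in>?F. d i \<odot> b i)"
    by (rule finsum_addf) (use assms in auto)
  also have "(\<Oplus>i\<in>?F. c i \<odot> b i) = lincomb b c"
    by (rule lincomb_superset[symmetric]) (use assms in auto)
  also have "(\<Oplus>i\<in>?F. d i \<odot> b i) = lincomb b d"
    by (rule lincomb_superset[symmetric]) (use assms in auto)
  finally show ?thesis .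
qed

lemma lincomb_single:
  assumes "\<And>i. b i \<in> carrier A"
  shows "lincomb b (\<lambda>i. if i = j then d else 0) = d \<odot> b j"
  by (subst lincomb_superset[of "{j}"]) (use assms in auto)

lemma lincomb_scale:
  assumes b: "\<And>i. b i \<in> carrier A" and c: "finite {i. c i \<noteq> 0}"
  shows "lincomb b (\<lambda>i. e * c i) = e \<odot> lincomb b c"
  using c
proof (induction rule: finite_support_induct)
  case (add d a c)
  have fin: "finite {i. e * c i \<noteq> 0}" using add by (auto intro: finite_subset[OF _ add(1)])
  have eq: "(\<lambda>i. e * ((if i = a then d else 0) + c i)) = (\<lambda>i. (if i = a then e * d else 0) + e * c i)"
    by (auto simp: algebra_simps)
  show ?case
    unfolding eq
    by (subst lincomb_add[OF b], simp, rule fin, subst lincomb_add[OF b], simp, rule add)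
      (simp add: lincomb_single[OF b] add b scale_add_right)
qed (use b in auto)

end

locale algebra_hom = A: assoc_algebra A + B: assoc_algebra B
  for A :: "('k::field, 'a, 'm) module_scheme" and B :: "('k, 'b, 'n) module_scheme" +
  fixes h
  assumes alg_hom: "h \<in> alg_hom A B"
begin

sublocale ring_hom_ring A B h
  by unfold_locales (use alg_hom in \<open>auto simp: alg_hom_def\<close>)

lemma hom_scale [simp]: "a \<in> carrier A \<Longrightarrow> h (c \<odot>\<^bsub>A\<^esub> a) = c \<odot>\<^bsub>B\<^esub> h a"
  using alg_hom by (auto simp: alg_hom_def)

lemma hom_diff [simp]:
  "a \<in> carrier A \<Longrightarrow> b \<in> carrier A \<Longrightarrow> h (a \<ominus>\<^bsub>A\<^esub> b) = h a \<ominus>\<^bsub>B\<^esub> h b"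
  by (simp add: A.minus_eq B.minus_eq)

lemma hom_Units: "u \<in> Units A \<Longrightarrow> h u \<in> Units B"
proof -
  assume u: "u \<in> Units A"
  then have c: "u \<in> carrier A" "inv\<^bsub>A\<^esub> u \<in> carrier A" by auto
  have "h u \<otimes>\<^bsub>B\<^esub> h (inv\<^bsub>A\<^esub> u) = \<one>\<^bsub>B\<^esub>" "h (inv\<^bsub>A\<^esub> u) \<otimes>\<^bsub>B\<^esub> h u = \<one>\<^bsub>B\<^esub>"
    using u c by (simp_all flip: hom_mult)
  then show ?thesis using c by (auto simp: Units_def)
qed

lemma hom_lincomb:
  assumes b: "\<And>i. b i \<in> carrier A" and c: "finite {i. c i \<noteq> 0}"
  shows "h (A.lincomb b c) = B.lincomb (\<lambda>i. h (b i)) c"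
  using c
proof (induction rule: finite_support_induct)
  case (add d a c)
  have hb: "\<And>i. h (b i) \<in> carrier B" using b by simp
  show ?case
    by (subst A.lincomb_add[OF b], simp, rule add, subst B.lincomb_add[OF hb], simp, rule add)
      (simp add: A.lincomb_single[OF b] B.lincomb_single[OF hb] add b)
qed simp

end

lemma algebra_hom_comp:
  assumes "algebra_hom A B h" "algebra_hom B C k"
  shows "algebra_hom A C (\<lambda>a. k (h a))"
proof -
  interpret h: algebra_hom A B h by fact
  interpret k: algebra_hom B C k by fact
  show ?thesis
    by unfold_locales (auto simp: alg_hom_def ring_hom_def)
qed

lemma algebra_hom_eq_inj:
  assumes "algebra_hom A B h" and ker: "\<And>a. a \<in> carrier A \<Longrightarrow> h a = \<zero>\<^bsub>B\<^esub> \<Longrightarrow> a = \<zero>\<^bsub>A\<^esub>"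
  shows "inj_on h (carrier A)"
proof (rule inj_onI)
  interpret h: algebra_hom A B h by fact
  fix a b assume ab: "a \<in> carrier A" "b \<in> carrier A" "h a = h b"
  then have "h (a \<ominus>\<^bsub>A\<^esub> b) = \<zero>\<^bsub>B\<^esub>" by (simp add: h.B.minus_eq h.B.r_neg)
  then have "a \<ominus>\<^bsub>A\<^esub> b = \<zero>\<^bsub>A\<^esub>" using ker ab by simp
  then have "a \<ominus>\<^bsub>A\<^esub> b \<oplus>\<^bsub>A\<^esub> b = b" using ab by simp
  then show "a = b" using ab by (simp add: h.A.minus_eq h.A.a_assoc h.A.l_neg)
qed

section \<open>The free algebra and quotients\<close>

abbreviation (input) free_word :: "'g list \<Rightarrow> 'g list \<Rightarrow> 'k::field" where
  "free_word w \<equiv> (\<lambda>v. if v = w then 1 else 0)"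

interpretation free: assoc_algebra "free_algebra :: ('k::field, 'g list \<Rightarrow> 'k) module"
  by (rule free_algebra_assoc_algebra)

lemma free_algebra_simps:
  "f \<in> carrier free_algebra \<longleftrightarrow> finite {w. f w \<noteq> 0}"
  "\<one>\<^bsub>free_algebra\<^esub> = (\<lambda>w. if w = [] then 1 else 0)"
  "\<zero>\<^bsub>free_algebra\<^esub> = (\<lambda>w. 0)"
  "f \<oplus>\<^bsub>free_algebra\<^esub> g = (\<lambda>w. f w + g w)"
  "c \<odot>\<^bsub>free_algebra\<^esub> f = (\<lambda>w. c * f w)"
  by (simp_all add: free_algebra_def)

lemma free_word_closed [simp, intro]: "(\<lambda>v. if v = w then c else 0) \<in> carrier free_algebra"
  by (auto simp: free_algebra_simps intro: finite_subset[of _ "{w}"])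

lemma free_gen_closed [simp, intro]: "free_gen x \<in> carrier free_algebra"
  by (simp add: free_gen_def)

lemma free_gen_mult_word:
  "free_gen x \<otimes>\<^bsub>free_algebra\<^esub> (\<lambda>v. if v = w then 1 else 0) = (\<lambda>v. if v = x # w then 1 else (0::'k::field))"
proof
  fix v
  have *: "take i v = [x] \<and> drop i v = w \<longleftrightarrow> i = 1 \<and> v = x # w" if "i \<le> length v" for i
    using that by (cases v; cases i) auto
  have "(free_gen x \<otimes>\<^bsub>free_algebra\<^esub> (\<lambda>v. if v = w then 1 else 0)) v
      = (\<Sum>i\<le>length v. if i = 1 \<and> v = x # w then 1 else (0::'k))"
    unfolding free_algebra_def free_gen_def partial_object.select_convs monoid.select_convs
    by (rule sum.cong) (use * in auto)
  also have "\<dots> = (if v = x # w then 1 else 0)" by (cases "v = x # w") (auto simp: Suc_le_eq)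
  finally show "(free_gen x \<otimes>\<^bsub>free_algebra\<^esub> (\<lambda>v. if v = w then 1 else 0)) v
      = (if v = x # w then 1 else (0::'k))" .
qed

lemma free_algebra_induct [consumes 1, case_names one gen add scale]:
  assumes f: "f \<in> carrier (free_algebra :: ('k::field, 'g list \<Rightarrow> 'k) module)"
    and one: "Q \<one>\<^bsub>free_algebra\<^esub>"
    and gen: "\<And>x f. f \<in> carrier free_algebra \<Longrightarrow> Q f \<Longrightarrow> Q (free_gen x \<otimes>\<^bsub>free_algebra\<^esub> f)"
    and add: "\<And>f g. f \<in> carrier free_algebra \<Longrightarrow> g \<in> carrier free_algebra \<Longrightarrow> Q f \<Longrightarrow> Q g \<Longrightarrow>
      Q (f \<oplus>\<^bsub>free_algebra\<^esub> g)"
    and scale: "\<And>c f. f \<in> carrier free_algebra \<Longrightarrow> Q f \<Longrightarrow> Q (c \<odot>\<^bsub>free_algebra\<^esub> f)"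
  shows "Q f"
proof -
  have word: "Q (free_word w)" for w
  proof (induction w)
    case Nil then show ?case using one by (simp add: free_algebra_simps)
  next
    case (Cons x w) then show ?case using gen[of "free_word w" x] by (simp add: free_gen_mult_word)
  qed
  have fin: "finite {w. f w \<noteq> 0}" using f by (simp add: free_algebra_simps)
  then show ?thesis
  proof (induction rule: finite_support_induct)
    case zero
    have "Q ((0::'k) \<odot>\<^bsub>free_algebra\<^esub> \<one>\<^bsub>free_algebra\<^esub>)" using one by (intro scale) auto
    then show ?case by (simp add: free_algebra_simps)
  next
    case (add d a c)
    have "Q ((d \<odot>\<^bsub>free_algebra\<^esub> free_word a) \<oplus>\<^bsub>free_algebra\<^esub> c)"
      using add by (intro assms(4) scale word free.scale_closed free_word_closed)
        (simp_all add: free_algebra_simps(1))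
    then show ?case by (simp add: free_algebra_simps if_distrib cong: if_cong)
  qed
qed

text \<open>The universal property of the free algebra. The homomorphism is the linear extension of the
evaluation of words; multiplicativity is checked by induction over the left factor, letter by
letter.\<close>

lemma (in assoc_algebra) free_algebra_hom:
  fixes g :: "'g \<Rightarrow> 'a"
  assumes g: "\<And>x. g x \<in> carrier A"
  obtains h where "h \<in> alg_hom free_algebra A" "\<And>x. h (free_gen x) = g x"
proof -
  let ?F = "free_algebra :: ('k, 'g list \<Rightarrow> 'k) module"
  define b where "b = (\<lambda>w. foldr (\<lambda>x a. g x \<otimes> a) w \<one>)"
  have b_Nil: "b [] = \<one>" and b_Cons: "b (x # w) = g x \<otimes> b w" for x w by (simp_all add: b_def)
  have b: "b w \<in> carrier A" for w by (induction w) (auto simp: b_Nil b_Cons g)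
  define h where "h = lincomb b"
  have closed: "h f \<in> carrier A" for f using b by (auto simp: h_def)
  have h_add: "h (e \<oplus>\<^bsub>?F\<^esub> f) = h e \<oplus> h f" if "e \<in> carrier ?F" "f \<in> carrier ?F" for e f
    using that by (simp add: h_def free_algebra_simps lincomb_add b)
  have h_scale: "h (c \<odot>\<^bsub>?F\<^esub> f) = c \<odot> h f" if "f \<in> carrier ?F" for c f
    using that by (simp add: h_def free_algebra_simps lincomb_scale b)
  have word: "h (free_word w) = b w" for w
    using lincomb_single[of b w 1] b by (simp add: h_def)
  have gen: "h (free_gen x) = g x" for x
    using word[of "[x]"] g by (simp add: free_gen_def b_Cons b_Nil)
  have h_one: "h \<one>\<^bsub>?F\<^esub> = \<one>" using word[of "[]"] by (simp add: free_algebra_simps b_Nil)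
  have gen_mult: "h (free_gen x \<otimes>\<^bsub>?F\<^esub> f) = g x \<otimes> h f" if "f \<in> carrier ?F" for x f
  proof -
    have "finite {w. f w \<noteq> 0}" using that by (simp add: free_algebra_simps)
    then show ?thesis
    proof (induction rule: finite_support_induct)
      case zero
      have "free_gen x \<otimes>\<^bsub>?F\<^esub> (\<lambda>w. 0) = (\<lambda>w. 0)"
        using free.r_null[of "free_gen x"] by (simp add: free_algebra_simps(3))
      then show ?case using g unfolding h_def by simp
    next
      case (add d a c)
      have c: "c \<in> carrier ?F" using add by (simp add: free_algebra_simps)
      have eq: "(\<lambda>i. (if i = a then d else 0) + c i) = (d \<odot>\<^bsub>?F\<^esub> free_word a) \<oplus>\<^bsub>?F\<^esub> c"
        by (auto simp: free_algebra_simps)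
      have "h (free_gen x \<otimes>\<^bsub>?F\<^esub> ((d \<odot>\<^bsub>?F\<^esub> free_word a) \<oplus>\<^bsub>?F\<^esub> c))
          = h (d \<odot>\<^bsub>?F\<^esub> free_word (x # a) \<oplus>\<^bsub>?F\<^esub> free_gen x \<otimes>\<^bsub>?F\<^esub> c)"
        using c by (simp add: free.r_distr free.smult_mult_right free_gen_mult_word)
      also have "\<dots> = d \<odot> (g x \<otimes> b a) \<oplus> g x \<otimes> h c"
        using c add by (simp add: h_add
            h_scale word b_Cons)
      also have "\<dots> = g x \<otimes> h ((d \<odot>\<^bsub>?F\<^esub> free_word a) \<oplus>\<^bsub>?F\<^esub> c)"
        using c by (simp add: h_add
            h_scale word closed g b r_distr smult_mult_right)
      finally show ?case unfolding eq .
    qed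
  qed
  have mult: "h (e \<otimes>\<^bsub>?F\<^esub> f) = h e \<otimes> h f" if "e \<in> carrier ?F" and f: "f \<in> carrier ?F" for e f
    using that(1)
  proof (induction rule: free_algebra_induct)
    case one then show ?case using f closed h_one by simp
  next
    case (gen x e)
    then show ?case using f closed g by (simp add: free.m_assoc gen_mult m_assoc)
  next
    case (add e e')
    then show ?case using f closed
      by (simp add: free.l_distr l_distr h_add)
  next
    case (scale c e)
    then show ?case using f closed
      by (simp add: free.smult_mult_left smult_mult_left h_scale)
  qed
  have "h \<in> alg_hom ?F A"
    by (auto simp: alg_hom_def ring_hom_def closed h_add h_scale h_one mult)
  then show ?thesis using gen that by blast
qed

context assoc_algebra
begin

text \<open>The scalar action on cosets is well defined because \<open>c i = (c 1) i\<close> lies in the ideal when \<open>i\<close> does.\<close>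

lemma quot_algebra_hom:
  assumes I: "ideal I A"
  shows "(+>) I \<in> alg_hom A (quot_algebra A I)" and "ring (quot_algebra A I)"
proof -
  interpret I: ideal I A by fact
  interpret Q: ring "A Quot I" by (rule I.quotient_is_ring)
  have eqs: "carrier (quot_algebra A I) = carrier (A Quot I)"
    "mult (quot_algebra A I) = mult (A Quot I)" "one (quot_algebra A I) = one (A Quot I)"
    "zero (quot_algebra A I) = zero (A Quot I)" "add (quot_algebra A I) = add (A Quot I)"
    by (simp_all add: quot_algebra_def)
  have "I +> (c \<odot> b) = I +> (c \<odot> a)" if a: "a \<in> carrier A" and b: "b \<in> I +> a" for a b c
  proof -
    obtain i where i: "i \<in> I" "b = i \<oplus> a" using b by (auto simp: a_r_coset_def')
    then have ic: "i \<in> carrier A" by auto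
    have "c \<odot> i = (c \<odot> \<one>) \<otimes> i" using ic by (simp add: smult_mult_left)
    then have "c \<odot> i \<in> I" using i by (auto intro: I.I_l_closed)
    then have "c \<odot> b \<in> I +> (c \<odot> a)"
      using i ic a by (auto simp: a_r_coset_def' scale_add_right)
    then show ?thesis using I.a_repr_independence'[OF _ scale_closed[OF a]] by simp
  qed
  then have scale: "(\<Union>b\<in>I +> a. I +> (c \<odot> b)) = I +> (c \<odot> a)" if "a \<in> carrier A" for a c
    using that I.a_rcos_self[OF that] by blast
  show "(+>) I \<in> alg_hom A (quot_algebra A I)"
    using I.rcos_ring_hom scale unfolding alg_hom_def ring_hom_def
    by (simp add: eqs) (simp add: quot_algebra_def)
  show "ring (quot_algebra A I)"
  proof (rule ringI)
    show "abelian_group (quot_algebra A I)"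
    proof (rule abelian_groupI)
      fix a assume "a \<in> carrier (quot_algebra A I)"
      then show "\<exists>b\<in>carrier (quot_algebra A I).
          b \<oplus>\<^bsub>quot_algebra A I\<^esub> a = \<zero>\<^bsub>quot_algebra A I\<^esub>"
        by (intro bexI[of _ "\<ominus>\<^bsub>A Quot I\<^esub> a"]) (simp_all add: eqs Q.l_neg)
    qed (simp_all add: eqs Q.a_ac)
    show "Group.monoid (quot_algebra A I)"
      by (rule monoidI) (auto simp: eqs Q.m_assoc)
  qed (auto simp: eqs Q.l_distr Q.r_distr)
qed

end

section \<open>Integer powers of units\<close>

context assoc_algebra
begin

lemma diff_eq_iff:
  assumes "a \<in> carrier A" "b \<in> carrier A" "c \<in> carrier A"
  shows "a \<ominus> b = c \<longleftrightarrow> a = b \<oplus> c"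
proof
  assume "a \<ominus> b = c"
  moreover have "a \<ominus> b \<oplus> b = a" using assms by (simp add: minus_eq a_assoc l_neg)
  ultimately show "a = b \<oplus> c" using assms by (simp add: a_comm)
next
  assume "a = b \<oplus> c"
  then show "a \<ominus> b = c" using assms by (simp add: minus_eq a_comm[of b] a_assoc r_neg)
qed

lemma diff_eq_zero: "a \<in> carrier A \<Longrightarrow> b \<in> carrier A \<Longrightarrow> a \<ominus> b = \<zero> \<longleftrightarrow> a = b"
  by (simp add: diff_eq_iff)

text \<open>Powers are taken in the group of units, where integer exponents obey the power laws.\<close>

definition upow :: "'a \<Rightarrow> int \<Rightarrow> 'a" where "upow u i = u [^]\<^bsub>units_of A\<^esub> i"

lemma upow_Units [simp, intro]: "u \<in> Units A \<Longrightarrow> upow u i \<in> Units A"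
  using group.int_pow_closed[OF units_group, of u i] by (simp add: upow_def units_of_carrier)

lemma upow_closed [simp, intro]: "u \<in> Units A \<Longrightarrow> upow u i \<in> carrier A"
  using upow_Units by blast

lemma upow_0 [simp]: "upow u 0 = \<one>"
  by (simp add: upow_def units_of_one)

lemma upow_1 [simp]: "u \<in> Units A \<Longrightarrow> upow u 1 = u"
  unfolding upow_def by (rule group.int_pow_1[OF units_group]) (simp add: units_of_carrier)

lemma upow_add: "u \<in> Units A \<Longrightarrow> upow u (i + j) = upow u i \<otimes> upow u j"
  using group.int_pow_mult[OF units_group, of u i j]
  by (simp add: upow_def units_of_carrier units_of_mult)

lemma upow_minus_1: "u \<in> Units A \<Longrightarrow> upow u (-1) = inv u"
  using group.int_pow_neg[OF units_group, of u 1] upow_1[of u]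
  by (simp add: upow_def units_of_carrier units_of_inv)

lemma upow_Suc: "u \<in> Units A \<Longrightarrow> upow u (i + 1) = u \<otimes> upow u i"
  using upow_add[of u 1 i] by (simp add: add.commute)

lemma upow_pred: "u \<in> Units A \<Longrightarrow> upow u (i - 1) = inv u \<otimes> upow u i"
  using upow_add[of u "-1" i] by (simp add: upow_minus_1 add.commute)

text \<open>Commutation up to a scalar passes from a unit to its inverse, and by induction to all of its
integer powers. Every reordering of monomials below reduces to this.\<close>

lemma commute_inv:
  assumes u: "u \<in> Units A" and a: "a \<in> carrier A" and c: "c \<noteq> 0" "a \<otimes> u = c \<odot> (u \<otimes> a)"
  shows "a \<otimes> inv u = inverse c \<odot> (inv u \<otimes> a)"
proof -
  have uc: "u \<in> carrier A" "inv u \<in> carrier A" using u by auto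
  have "inv u \<otimes> (a \<otimes> u) \<otimes> inv u = inv u \<otimes> a"
    using u uc a by (simp add: m_assoc)
  moreover have "inv u \<otimes> (a \<otimes> u) \<otimes> inv u = c \<odot> (a \<otimes> inv u)"
    using u uc a by (simp add: c(2) smult_mult_left smult_mult_right m_assoc[symmetric])
  ultimately have "inverse c \<odot> (c \<odot> (a \<otimes> inv u)) = inverse c \<odot> (inv u \<otimes> a)" by simp
  then show ?thesis using c uc a by simp
qed

lemma commute_upow:
  assumes u: "u \<in> Units A" and a: "a \<in> carrier A" and c: "c \<noteq> 0" "a \<otimes> u = c \<odot> (u \<otimes> a)"
  shows "a \<otimes> upow u i = (c powi i) \<odot> (upow u i \<otimes> a)"
proof (induction i rule: int_induct[where k = 0])
  case base then show ?case using a by simp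
next
  case (step1 i)
  have uc: "u \<in> carrier A" using u by auto
  have "a \<otimes> upow u (i + 1) = c \<odot> (u \<otimes> (a \<otimes> upow u i))"
    using u uc a by (simp add: upow_Suc m_assoc[symmetric] c(2) smult_mult_left)
  also have "\<dots> = (c powi (i + 1)) \<odot> (upow u (i + 1) \<otimes> a)"
    using u uc a c step1 by (simp add: upow_Suc m_assoc smult_mult_right power_int_add mult.commute)
  finally show ?case .
next
  case (step2 i)
  have uc: "u \<in> carrier A" "inv u \<in> carrier A" using u by auto
  have "a \<otimes> upow u (i - 1) = inverse c \<odot> (inv u \<otimes> (a \<otimes> upow u i))"
    using u uc a commute_inv[OF u a c] by (simp add: upow_pred m_assoc[symmetric] smult_mult_left)
  also have "\<dots> = (c powi (i - 1)) \<odot> (upow u (i - 1) \<otimes> a)"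
    using u uc a c step2
    by (simp add: upow_pred m_assoc smult_mult_right power_int_diff field_simps)
  finally show ?case .
qed

end

lemma (in algebra_hom) hom_upow: "u \<in> Units A \<Longrightarrow> h (A.upow u i) = B.upow (h u) i"
proof -
  assume u: "u \<in> Units A"
  have "h \<in> hom (units_of A) (units_of B)"
    by (rule homI) (auto simp: units_of_carrier units_of_mult hom_Units A.Units_closed)
  then show ?thesis
    unfolding A.upow_def B.upow_def
    by (rule hom_int_pow) (simp_all add: A.units_group B.units_group u units_of_carrier)
qed

section \<open>Representations of the defining relations\<close>

text \<open>The letters \<open>x, y, z\<^sup>\<plusminus>, s\<^sup>\<plusminus>, t\<^sup>\<plusminus>\<close> generate the localization under left
multiplication, addition and scaling. Naming them independently of the target algebra allows the
localization and the quantum torus to be compared letter by letter.\<close>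

datatype letter = LX | LY | LZ | LZi | LS | LSi | LT | LTi

abbreviation free_z :: "gen list \<Rightarrow> 'k::field" where
  "free_z \<equiv> free_gen X \<otimes>\<^bsub>free_algebra\<^esub> free_gen Y \<ominus>\<^bsub>free_algebra\<^esub> free_gen Y \<otimes>\<^bsub>free_algebra\<^esub> free_gen X"

text \<open>A representation of the localized algebra in \<open>B\<close>, given as a homomorphism of the free algebra
that kills the relators and makes \<open>z\<close>, \<open>s\<close>, \<open>t\<close> invertible. The same consequences are
needed for three instances: the localization itself, its model in the quantum torus, and the
composite of the model with an endomorphism.\<close>

locale weyl_rep = algebra_hom "free_algebra :: ('k::field, gen list \<Rightarrow> 'k) module" B h
  for B :: "('k::field, 'b, 'n) module_scheme" (structure) and h +
  fixes p q :: 'k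
  assumes p0: "p \<noteq> 0" and q0: "q \<noteq> 0" and p1: "p \<noteq> 1"
    and relators: "r \<in> weyl_relators p q \<Longrightarrow> h r = \<zero>"
    and z_Units: "h free_z \<in> Units B"
    and s_Units: "h (free_gen S) \<in> Units B"
    and t_Units: "h (free_gen T) \<in> Units B"
begin

definition "x = h (free_gen X)"
definition "y = h (free_gen Y)"
definition "s = h (free_gen S)"
definition "t = h (free_gen T)"
definition "z = h free_z"

lemma gens_closed [simp, intro]:
  "x \<in> carrier B" "y \<in> carrier B" "s \<in> carrier B" "t \<in> carrier B" "z \<in> carrier B"
  by (simp_all add: x_def y_def s_def t_def z_def)

lemma Units [simp, intro]: "z \<in> Units B" "s \<in> Units B" "t \<in> Units B"
  using z_Units s_Units t_Units by (simp_all add: s_def t_def z_def)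

lemma inv_closed [simp, intro]:
  "inv z \<in> carrier B" "inv s \<in> carrier B" "inv t \<in> carrier B"
  by auto

lemma relation_xy: "x \<otimes> y = p \<odot> (y \<otimes> x) \<oplus> \<one>"
proof -
  have "x \<otimes> y \<ominus> p \<odot> (y \<otimes> x) \<ominus> \<one> = \<zero>"
    using relators[of "free_gen X \<otimes>\<^bsub>free_algebra\<^esub> free_gen Y \<ominus>\<^bsub>free_algebra\<^esub>
      p \<odot>\<^bsub>free_algebra\<^esub> (free_gen Y \<otimes>\<^bsub>free_algebra\<^esub> free_gen X) \<ominus>\<^bsub>free_algebra\<^esub> \<one>\<^bsub>free_algebra\<^esub>"]
    by (simp add: weyl_relators_def Let_def x_def y_def)
  then show ?thesis by (simp add: B.diff_eq_iff)
qed

lemma relation_sub: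
  "f \<otimes>\<^bsub>free_algebra\<^esub> g \<ominus>\<^bsub>free_algebra\<^esub> k \<in> weyl_relators p q \<Longrightarrow> f \<in> carrier free_algebra \<Longrightarrow>
    g \<in> carrier free_algebra \<Longrightarrow> k \<in> carrier free_algebra \<Longrightarrow> h f \<otimes> h g = h k"
  using relators[of "f \<otimes>\<^bsub>free_algebra\<^esub> g \<ominus>\<^bsub>free_algebra\<^esub> k"]
  by (simp add: B.diff_eq_zero)

lemma relations:
  "s \<otimes> t = q \<odot> (t \<otimes> s)" "s \<otimes> x = x \<otimes> s" "s \<otimes> y = y \<otimes> s" "t \<otimes> x = x \<otimes> t" "t \<otimes> y = y \<otimes> t"
  using relation_sub[of "free_gen S" "free_gen T"
      "q \<odot>\<^bsub>free_algebra\<^esub> (free_gen T \<otimes>\<^bsub>free_algebra\<^esub> free_gen S)"]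
    relation_sub[of "free_gen S" "free_gen X" "free_gen X \<otimes>\<^bsub>free_algebra\<^esub> free_gen S"]
    relation_sub[of "free_gen S" "free_gen Y" "free_gen Y \<otimes>\<^bsub>free_algebra\<^esub> free_gen S"]
    relation_sub[of "free_gen T" "free_gen X" "free_gen X \<otimes>\<^bsub>free_algebra\<^esub> free_gen T"]
    relation_sub[of "free_gen T" "free_gen Y" "free_gen Y \<otimes>\<^bsub>free_algebra\<^esub> free_gen T"]
  by (simp_all add: weyl_relators_def Let_def s_def t_def x_def y_def)

text \<open>From here on \<open>yx\<close> and \<open>xy\<close> are polynomials of degree one in \<open>z\<close>. This is what
makes \<open>y\<close> a multiple of a formal inverse of \<open>x\<close>.\<close>

lemma z_eq: "z = (p - 1) \<odot> (y \<otimes> x) \<oplus> \<one>"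
proof -
  have "z = x \<otimes> y \<ominus> y \<otimes> x" by (simp add: z_def x_def y_def)
  also have "\<dots> = p \<odot> (y \<otimes> x) \<ominus> y \<otimes> x \<oplus> \<one>"
    by (simp add: relation_xy B.minus_eq B.a_ac)
  also have "\<dots> = (p - 1) \<odot> (y \<otimes> x) \<oplus> \<one>"
    by (simp add: B.scale_diff_left)
  finally show ?thesis .
qed

lemma yx: "y \<otimes> x = inverse (p - 1) \<odot> (z \<ominus> \<one>)"
proof -
  have "z \<ominus> \<one> = (p - 1) \<odot> (y \<otimes> x)"
    by (simp add: z_eq B.minus_eq B.a_assoc B.r_neg)
  then show ?thesis using p1 by simp
qed

lemma xy: "x \<otimes> y = inverse (p - 1) \<odot> (p \<odot> z \<ominus> \<one>)"
proof -
  have "p \<odot> z \<ominus> \<one> = (p * (p - 1)) \<odot> (y \<otimes> x) \<oplus> (p \<odot> \<one> \<ominus> \<one>)"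
    by (simp add: z_eq B.minus_eq B.a_assoc B.scale_add_right)
  also have "p \<odot> \<one> \<ominus> \<one> = (p - 1) \<odot> \<one>" by (simp add: B.scale_diff_left)
  also have "(p * (p - 1)) \<odot> (y \<otimes> x) \<oplus> (p - 1) \<odot> \<one> = (p - 1) \<odot> (x \<otimes> y)"
    by (simp add: relation_xy B.scale_add_right mult.commute)
  finally show ?thesis using p1 by simp
qed

lemma xz: "x \<otimes> z = p \<odot> (z \<otimes> x)"
proof -
  have "x \<otimes> z = (p - 1) \<odot> (x \<otimes> y \<otimes> x) \<oplus> x"
    by (simp add: z_eq B.r_distr B.smult_mult_right B.m_assoc)
  also have "\<dots> = (p * (p - 1)) \<odot> (y \<otimes> x \<otimes> x) \<oplus> ((p - 1) \<odot> x \<oplus> x)"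
    by (simp add: relation_xy B.l_distr B.smult_mult_left B.scale_add_right B.a_assoc mult.commute)
  also have "(p - 1) \<odot> x \<oplus> x = p \<odot> x"
    using B.scale_add_left[of x "p - 1" 1] by simp
  also have "(p * (p - 1)) \<odot> (y \<otimes> x \<otimes> x) \<oplus> p \<odot> x = p \<odot> (z \<otimes> x)"
    by (simp add: z_eq B.l_distr B.smult_mult_left B.scale_add_right)
  finally show ?thesis .
qed

lemma zy: "z \<otimes> y = p \<odot> (y \<otimes> z)"
proof -
  have "z \<otimes> y = (p - 1) \<odot> (y \<otimes> (x \<otimes> y)) \<oplus> y"
    by (simp add: z_eq B.l_distr B.smult_mult_left B.m_assoc)
  also have "\<dots> = (p * (p - 1)) \<odot> (y \<otimes> (y \<otimes> x)) \<oplus> ((p - 1) \<odot> y \<oplus> y)"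
    by (simp add: relation_xy B.r_distr B.smult_mult_right B.scale_add_right B.a_assoc mult.commute)
  also have "(p - 1) \<odot> y \<oplus> y = p \<odot> y"
    using B.scale_add_left[of y "p - 1" 1] by simp
  also have "(p * (p - 1)) \<odot> (y \<otimes> (y \<otimes> x)) \<oplus> p \<odot> y = p \<odot> (y \<otimes> z)"
    by (simp add: z_eq B.r_distr B.smult_mult_right B.scale_add_right)
  finally show ?thesis .
qed

lemma yz: "y \<otimes> z = inverse p \<odot> (z \<otimes> y)"
  using p0 by (simp add: zy)

lemma sz: "s \<otimes> z = z \<otimes> s" and tz: "t \<otimes> z = z \<otimes> t"
proof -
  have "a \<otimes> z = z \<otimes> a" if a: "a \<in> carrier B" "a \<otimes> x = x \<otimes> a" "a \<otimes> y = y \<otimes> a" for a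
  proof -
    have "a \<otimes> (y \<otimes> x) = (y \<otimes> x) \<otimes> a"
      using a B.m_assoc[of a y x] B.m_assoc[of y a x] B.m_assoc[of y x a] by simp
    then show ?thesis
      using a by (simp add: z_eq B.l_distr B.r_distr B.smult_mult_left B.smult_mult_right)
  qed
  then show "s \<otimes> z = z \<otimes> s" "t \<otimes> z = z \<otimes> t" using relations by simp_all
qed

lemma ts: "t \<otimes> s = inverse q \<odot> (s \<otimes> t)"
  using q0 by (simp add: relations(1))

fun letter :: "letter \<Rightarrow> 'b" where
  "letter LX = x" | "letter LY = y" | "letter LZ = z" | "letter LZi = inv z"
| "letter LS = s" | "letter LSi = inv s" | "letter LT = t" | "letter LTi = inv t"

lemma letter_closed [simp, intro]: "letter a \<in> carrier B"
  by (cases a) auto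

text \<open>A common denominator: a power of \<open>w\<close> clears all negative powers of \<open>z\<close>, \<open>s\<close>,
\<open>t\<close>, and \<open>w\<close> commutes with every letter up to a scalar.\<close>

definition w where "w = z \<otimes> s \<otimes> t"

end

text \<open>The scalar \<open>c\<close> with \<open>w a = c a w\<close> for a letter \<open>a\<close>.\<close>

fun letter_scalar :: "'k::field \<Rightarrow> 'k \<Rightarrow> letter \<Rightarrow> 'k" where
  "letter_scalar p q LX = inverse p" | "letter_scalar p q LY = p"
| "letter_scalar p q LZ = 1" | "letter_scalar p q LZi = 1"
| "letter_scalar p q LS = inverse q" | "letter_scalar p q LSi = q"
| "letter_scalar p q LT = q" | "letter_scalar p q LTi = inverse q"

definition free_w :: "gen list \<Rightarrow> 'k::field" where
  "free_w = free_z \<otimes>\<^bsub>free_algebra\<^esub> free_gen S \<otimes>\<^bsub>free_algebra\<^esub> free_gen T"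

text \<open>An element of the free algebra representing \<open>w a\<close>; the factor \<open>q\<close> for \<open>s\<^sup>-\<^sup>1\<close> comes from
moving \<open>t\<close> across \<open>s\<close>.\<close>

fun free_letter :: "'k::field \<Rightarrow> letter \<Rightarrow> gen list \<Rightarrow> 'k" where
  "free_letter q LX = free_w \<otimes>\<^bsub>free_algebra\<^esub> free_gen X"
| "free_letter q LY = free_w \<otimes>\<^bsub>free_algebra\<^esub> free_gen Y"
| "free_letter q LZ = free_w \<otimes>\<^bsub>free_algebra\<^esub> free_z"
| "free_letter q LS = free_w \<otimes>\<^bsub>free_algebra\<^esub> free_gen S"
| "free_letter q LT = free_w \<otimes>\<^bsub>free_algebra\<^esub> free_gen T"
| "free_letter q LZi = free_gen S \<otimes>\<^bsub>free_algebra\<^esub> free_gen T"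
| "free_letter q LSi = q \<odot>\<^bsub>free_algebra\<^esub> (free_z \<otimes>\<^bsub>free_algebra\<^esub> free_gen T)"
| "free_letter q LTi = free_z \<otimes>\<^bsub>free_algebra\<^esub> free_gen S"

context weyl_rep
begin

lemma free_letter_closed [simp, intro]: "free_letter q a \<in> carrier free_algebra"
  by (cases a) (auto simp: free_w_def)

lemma w_closed [simp, intro]: "w \<in> carrier B" and w_Units: "w \<in> Units B"
  by (auto simp: w_def)

lemma w_eq: "w = h free_w" and free_w_closed [simp, intro]: "free_w \<in> carrier free_algebra"
  by (simp_all add: w_def free_w_def s_def t_def z_def)

lemma scalar_commute_mult:
  assumes "a \<in> carrier B" "b \<in> carrier B" "g \<in> carrier B"
    and "a \<otimes> g = c \<odot> (g \<otimes> a)" "b \<otimes> g = d \<odot> (g \<otimes> b)"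
  shows "(a \<otimes> b) \<otimes> g = (c * d) \<odot> (g \<otimes> (a \<otimes> b))"
proof -
  have "(a \<otimes> b) \<otimes> g = d \<odot> ((a \<otimes> g) \<otimes> b)"
    using assms B.m_assoc[of a b g] B.m_assoc[of a g b] B.smult_mult_right[of a "g \<otimes> b" d] by simp
  then show ?thesis using assms by (simp add: B.smult_mult_left B.m_assoc mult.commute)
qed

lemma w_commute_positive:
  "w \<otimes> x = inverse p \<odot> (x \<otimes> w)" "w \<otimes> y = p \<odot> (y \<otimes> w)" "w \<otimes> z = z \<otimes> w"
  "w \<otimes> s = inverse q \<odot> (s \<otimes> w)" "w \<otimes> t = q \<odot> (t \<otimes> w)"
proof -
  have zx: "z \<otimes> x = inverse p \<odot> (x \<otimes> z)" using p0 by (simp add: xz)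
  have *: "w \<otimes> g = (c * d * e) \<odot> (g \<otimes> w)"
    if "g \<in> carrier B" "z \<otimes> g = c \<odot> (g \<otimes> z)" "s \<otimes> g = d \<odot> (g \<otimes> s)" "t \<otimes> g = e \<odot> (g \<otimes> t)" for g c d e
    unfolding w_def using that by (intro scalar_commute_mult) auto
  show "w \<otimes> x = inverse p \<odot> (x \<otimes> w)" using *[of x "inverse p" 1 1] zx relations by simp
  show "w \<otimes> y = p \<odot> (y \<otimes> w)" using *[of y p 1 1] zy relations by simp
  show "w \<otimes> z = z \<otimes> w" using *[of z 1 1 1] sz tz by simp
  show "w \<otimes> s = inverse q \<odot> (s \<otimes> w)" using *[of s 1 1 "inverse q"] sz ts by simp
  show "w \<otimes> t = q \<odot> (t \<otimes> w)" using *[of t 1 q 1] tz relations by simp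
qed

lemma w_commute: "w \<otimes> letter a = letter_scalar p q a \<odot> (letter a \<otimes> w)"
  using w_commute_positive p0 q0 B.commute_inv[of _ w 1] B.commute_inv[of _ w q]
    B.commute_inv[of _ w "inverse q"]
  by (cases a) auto

lemma w_letter: "w \<otimes> letter a = h (free_letter q a)"
proof (cases a)
  case LZi
  have "w \<otimes> inv z = inv z \<otimes> w" using w_commute[of LZi] by simp
  also have "\<dots> = s \<otimes> t" by (simp add: w_def B.m_assoc[symmetric])
  finally show ?thesis by (simp add: LZi s_def t_def)
next
  case LSi
  have "w \<otimes> inv s = q \<odot> (inv s \<otimes> w)" using w_commute[of LSi] by simp
  also have "inv s \<otimes> w = inv s \<otimes> (s \<otimes> z) \<otimes> t" by (simp add: w_def sz B.m_assoc)
  also have "\<dots> = z \<otimes> t" by (simp add: B.m_assoc[symmetric])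
  finally show ?thesis by (simp add: LSi z_def t_def)
next
  case LTi
  have "w \<otimes> inv t = z \<otimes> s" by (simp add: w_def B.m_assoc)
  then show ?thesis by (simp add: LTi z_def s_def)
qed (simp_all add: w_eq x_def y_def z_def s_def t_def)

end

section \<open>A spanning set of ordered monomials\<close>

text \<open>The exponent \<open>(a, j, k, i)\<close> belongs to \<open>z\<^sup>i s\<^sup>j t\<^sup>k x\<^sup>a\<close>. In the lexicographic order the
exponent of \<open>z\<close> counts least, so \<open>(0, 0, 0, 1)\<close> is the smallest positive exponent; the
analysis of the factors of \<open>yx\<close> rests on this choice.\<close>

type_synonym exponent = "int \<times> int \<times> int \<times> int"

instance prod :: (ordered_ab_group_add, ordered_ab_group_add) ordered_ab_group_add
  by standard (auto simp: less_eq_prod_def)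

instance prod :: (linordered_ab_group_add, linordered_ab_group_add) linordered_ab_group_add
  by standard

context weyl_rep
begin

definition torus_part :: "int \<Rightarrow> int \<Rightarrow> int \<Rightarrow> 'b" where
  "torus_part i j k = B.upow z i \<otimes> B.upow s j \<otimes> B.upow t k"

text \<open>For negative exponents a power of \<open>y\<close> takes the place of the missing inverse of \<open>x\<close>.\<close>

definition xy_part :: "int \<Rightarrow> 'b" where
  "xy_part a = (if a \<ge> 0 then x [^] nat a else y [^] nat (- a))"

fun basis :: "exponent \<Rightarrow> 'b" where
  "basis (a, j, k, i) = torus_part i j k \<otimes> xy_part a"

lemma torus_part_Units [simp, intro]: "torus_part i j k \<in> Units B"
  by (auto simp: torus_part_def)

lemma torus_part_closed [simp, intro]: "torus_part i j k \<in> carrier B"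
  using torus_part_Units by (rule B.Units_closed)

lemma xy_part_closed [simp, intro]: "xy_part a \<in> carrier B"
  by (simp add: xy_part_def del: pow_nat)

lemma basis_closed [simp, intro]: "basis n \<in> carrier B"
  by (cases n) auto

lemma commute_mult:
  assumes "a \<in> carrier B" "b \<in> carrier B" "g \<in> carrier B"
    and "g \<otimes> a = c \<odot> (a \<otimes> g)" "g \<otimes> b = d \<odot> (b \<otimes> g)"
  shows "g \<otimes> (a \<otimes> b) = (c * d) \<odot> (a \<otimes> b \<otimes> g)"
proof -
  have "g \<otimes> (a \<otimes> b) = c \<odot> (a \<otimes> (g \<otimes> b))"
    using assms B.m_assoc[of g a b] B.m_assoc[of a g b] by (simp add: B.smult_mult_left)
  then show ?thesis using assms by (simp add: B.smult_mult_right B.m_assoc)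
qed

lemma commute_torus_part:
  assumes g: "g \<in> carrier B" and c: "c \<noteq> 0" "g \<otimes> z = c \<odot> (z \<otimes> g)"
    and d: "d \<noteq> 0" "g \<otimes> s = d \<odot> (s \<otimes> g)" and e: "e \<noteq> 0" "g \<otimes> t = e \<odot> (t \<otimes> g)"
  shows "g \<otimes> torus_part i j k = (c powi i * d powi j * e powi k) \<odot> (torus_part i j k \<otimes> g)"
  unfolding torus_part_def
  by (intro commute_mult B.commute_upow) (use assms in auto)

lemma x_torus_part: "x \<otimes> torus_part i j k = (p powi i) \<odot> (torus_part i j k \<otimes> x)"
  using commute_torus_part[of x p 1 1 i j k] p0 xz relations by simp

lemma y_torus_part: "y \<otimes> torus_part i j k = (inverse p powi i) \<odot> (torus_part i j k \<otimes> y)"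
  using commute_torus_part[of y "inverse p" 1 1 i j k] p0 yz relations by simp

lemma torus_part_z: "torus_part i j k \<otimes> z = torus_part (i + 1) j k"
proof -
  have "z \<otimes> torus_part i j k = torus_part i j k \<otimes> z"
    using commute_torus_part[of z 1 1 1 i j k] sz tz by simp
  then show ?thesis by (simp add: torus_part_def B.upow_Suc B.m_assoc)
qed

lemma unit_torus_part:
  "z \<otimes> torus_part i j k = torus_part (i + 1) j k"
  "inv z \<otimes> torus_part i j k = torus_part (i - 1) j k"
  "s \<otimes> torus_part i j k = torus_part i (j + 1) k"
  "inv s \<otimes> torus_part i j k = torus_part i (j - 1) k"
  "t \<otimes> torus_part i j k = (inverse q powi j) \<odot> torus_part i j (k + 1)"
  "inv t \<otimes> torus_part i j k = (q powi j) \<odot> torus_part i j (k - 1)"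
proof -
  have u: "s \<otimes> B.upow z i = B.upow z i \<otimes> s" "inv s \<otimes> B.upow z i = B.upow z i \<otimes> inv s"
    "t \<otimes> B.upow z i = B.upow z i \<otimes> t" "inv t \<otimes> B.upow z i = B.upow z i \<otimes> inv t"
    "t \<otimes> B.upow s j = (inverse q powi j) \<odot> (B.upow s j \<otimes> t)"
    "inv t \<otimes> B.upow s j = (q powi j) \<odot> (B.upow s j \<otimes> inv t)"
  proof -
    have iv: "inv s \<otimes> z = z \<otimes> inv s" "inv t \<otimes> z = z \<otimes> inv t" "inv t \<otimes> s = q \<odot> (s \<otimes> inv t)"
      using B.commute_inv[of s z 1] B.commute_inv[of t z 1] B.commute_inv[of t s q] sz tz
        relations(1) q0 by simp_all
    show "s \<otimes> B.upow z i = B.upow z i \<otimes> s" "inv s \<otimes> B.upow z i = B.upow z i \<otimes> inv s"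
      "t \<otimes> B.upow z i = B.upow z i \<otimes> t" "inv t \<otimes> B.upow z i = B.upow z i \<otimes> inv t"
      "t \<otimes> B.upow s j = (inverse q powi j) \<odot> (B.upow s j \<otimes> t)"
      "inv t \<otimes> B.upow s j = (q powi j) \<odot> (B.upow s j \<otimes> inv t)"
      using B.commute_upow[of z s 1 i] B.commute_upow[of z "inv s" 1 i] B.commute_upow[of z t 1 i]
        B.commute_upow[of z "inv t" 1 i] B.commute_upow[of s t "inverse q" j]
        B.commute_upow[of s "inv t" q j] iv sz tz ts q0 by simp_all
  qed
  show "z \<otimes> torus_part i j k = torus_part (i + 1) j k"
    "inv z \<otimes> torus_part i j k = torus_part (i - 1) j k"
    by (simp_all add: torus_part_def B.upow_Suc B.upow_pred B.m_assoc)
  show "s \<otimes> torus_part i j k = torus_part i (j + 1) k"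
    "inv s \<otimes> torus_part i j k = torus_part i (j - 1) k"
    using u B.m_assoc[of "s" "B.upow z i"] B.m_assoc[of "inv s" "B.upow z i"]
    by (simp_all add: torus_part_def B.upow_Suc B.upow_pred B.m_assoc)
  show "t \<otimes> torus_part i j k = (inverse q powi j) \<odot> torus_part i j (k + 1)"
    "inv t \<otimes> torus_part i j k = (q powi j) \<odot> torus_part i j (k - 1)"
    using commute_mult[of "B.upow z i" "B.upow s j" t 1] commute_mult[of "B.upow z i" "B.upow s j" "inv t" 1]
      B.m_assoc[of "B.upow z i \<otimes> B.upow s j" t "B.upow t k"]
      B.m_assoc[of "B.upow z i \<otimes> B.upow s j" "inv t" "B.upow t k"]
      B.m_assoc[of t "B.upow z i \<otimes> B.upow s j" "B.upow t k"]
      B.m_assoc[of "inv t" "B.upow z i \<otimes> B.upow s j" "B.upow t k"] u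
    by (simp_all add: torus_part_def B.upow_Suc B.upow_pred B.smult_mult_left)
qed

definition span :: "'b set" where
  "span = {B.lincomb basis c | c. finite {n. c n \<noteq> 0}}"

lemma basis_in_span: "basis n \<in> span"
  unfolding span_def
  by (rule CollectI, rule exI[of _ "\<lambda>i. if i = n then 1 else 0"])
    (simp add: B.lincomb_single)

lemma span_add: "a \<in> span \<Longrightarrow> b \<in> span \<Longrightarrow> a \<oplus> b \<in> span"
proof -
  assume "a \<in> span" "b \<in> span"
  then obtain c d where c: "a = B.lincomb basis c" "finite {n. c n \<noteq> 0}"
    and d: "b = B.lincomb basis d" "finite {n. d n \<noteq> 0}" by (auto simp: span_def)
  have "finite {n. c n + d n \<noteq> 0}"
    by (rule finite_subset[OF _ finite_UnI[OF c(2) d(2)]]) auto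
  then show ?thesis
    unfolding span_def using B.lincomb_add[OF _ c(2) d(2), of basis] c d
    by (intro CollectI exI[of _ "\<lambda>n. c n + d n"]) simp
qed

lemma span_scale: "a \<in> span \<Longrightarrow> e \<odot> a \<in> span"
proof -
  assume "a \<in> span"
  then obtain c where c: "a = B.lincomb basis c" "finite {n. c n \<noteq> 0}" by (auto simp: span_def)
  have "finite {n. e * c n \<noteq> 0}" by (rule finite_subset[OF _ c(2)]) auto
  then show ?thesis
    unfolding span_def using B.lincomb_scale[OF _ c(2), of basis e] c
    by (intro CollectI exI[of _ "\<lambda>n. e * c n"]) simp
qed

lemma span_closed: "a \<in> span \<Longrightarrow> a \<in> carrier B"
  by (auto simp: span_def)

lemma span_diff:
  assumes "a \<in> span" "b \<in> span"
  shows "a \<ominus> b \<in> span"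
proof -
  have "a \<ominus> b = a \<oplus> (-1) \<odot> b"
    using assms by (simp add: span_closed B.minus_eq B.scale_minus_one)
  then show ?thesis using assms span_add span_scale by simp
qed

lemma x_xy_part:
  "x \<otimes> xy_part a = (if a \<ge> 0 then xy_part (a + 1)
     else inverse (p - 1) \<odot> (p \<odot> (z \<otimes> xy_part (a + 1)) \<ominus> xy_part (a + 1)))"
proof (cases "a \<ge> 0")
  case True
  then have "nat (a + 1) = Suc (nat a)" by simp
  then show ?thesis using True B.nat_pow_Suc2[of x "nat a"]
    by (simp add: xy_part_def del: pow_nat)
next
  case False
  then have "nat (- a) = Suc (nat (- (a + 1)))" by simp
  then have "xy_part a = y \<otimes> xy_part (a + 1)"
    using False B.nat_pow_Suc2[of y "nat (- (a + 1))"]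
    by (auto simp: xy_part_def simp del: pow_nat)
  then have "x \<otimes> xy_part a = (x \<otimes> y) \<otimes> xy_part (a + 1)" by (simp add: B.m_assoc)
  then show ?thesis
    using False by (simp add: xy B.smult_mult_left B.minus_eq B.l_distr B.l_minus)
qed

lemma y_xy_part:
  "y \<otimes> xy_part a = (if a \<le> 0 then xy_part (a - 1)
     else inverse (p - 1) \<odot> (z \<otimes> xy_part (a - 1) \<ominus> xy_part (a - 1)))"
proof (cases "a \<le> 0")
  case True
  then have "nat (- (a - 1)) = Suc (nat (- a))" by simp
  then show ?thesis using True B.nat_pow_Suc2[of y "nat (- a)"]
    by (auto simp: xy_part_def simp del: pow_nat)
next
  case False
  then have "nat a = Suc (nat (a - 1))" by simp
  then have "xy_part a = x \<otimes> xy_part (a - 1)"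
    using False B.nat_pow_Suc2[of x "nat (a - 1)"]
    by (auto simp: xy_part_def simp del: pow_nat)
  then have "y \<otimes> xy_part a = (y \<otimes> x) \<otimes> xy_part (a - 1)" by (simp add: B.m_assoc)
  then show ?thesis
    using False by (simp add: yx B.smult_mult_left B.minus_eq B.l_distr B.l_minus)
qed

text \<open>A letter moves across \<open>z\<^sup>i s\<^sup>j t\<^sup>k\<close> at the cost of a scalar; \<open>x\<close> meeting a power of
\<open>y\<close>, or \<open>y\<close> meeting a power of \<open>x\<close>, contributes \<open>xy\<close> or \<open>yx\<close>, which is linear in
\<open>z\<close>.\<close>

lemma letter_basis_in_span: "letter l \<otimes> basis n \<in> span"
proof -
  obtain a j k i where n: "n = (a, j, k, i)" by (cases n)
  let ?T = "torus_part i j k"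
  have in_span: "torus_part i j k \<otimes> xy_part a \<in> span" for i j k a
    using basis_in_span[of "(a, j, k, i)"] by simp
  have in_span_z: "torus_part i j k \<otimes> (z \<otimes> xy_part a) \<in> span" for i j k a
    using in_span[of "i + 1" j k a] by (simp add: B.m_assoc[symmetric] torus_part_z)
  have assoc: "g \<otimes> basis n = (g \<otimes> ?T) \<otimes> xy_part a" if "g \<in> carrier B" for g
    using that by (simp add: n B.m_assoc)
  have "x \<otimes> basis n = (p powi i) \<odot> (?T \<otimes> (x \<otimes> xy_part a))"
    by (simp add: assoc x_torus_part B.smult_mult_left B.m_assoc)
  moreover have "?T \<otimes> (x \<otimes> xy_part a) \<in> span"
    using in_span in_span_z
    by (simp add: x_xy_part B.smult_mult_right B.minus_eq B.r_distr B.r_minus)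
      (simp add: span_scale span_diff flip: B.minus_eq)
  ultimately have x: "x \<otimes> basis n \<in> span" by (simp add: span_scale)
  have "y \<otimes> basis n = (inverse p powi i) \<odot> (?T \<otimes> (y \<otimes> xy_part a))"
    by (simp add: assoc y_torus_part B.smult_mult_left B.m_assoc)
  moreover have "?T \<otimes> (y \<otimes> xy_part a) \<in> span"
    using in_span in_span_z
    by (simp add: y_xy_part B.smult_mult_right B.minus_eq B.r_distr B.r_minus)
      (simp add: span_scale span_diff flip: B.minus_eq)
  ultimately have y: "y \<otimes> basis n \<in> span" by (simp add: span_scale)
  show ?thesis
    using x y in_span by (cases l) (auto simp: assoc unit_torus_part B.smult_mult_left span_scale)
qed

lemma letter_span:
  assumes "a \<in> span"
  shows "letter l \<otimes> a \<in> span"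
proof -
  obtain c where c: "a = B.lincomb basis c" "finite {n. c n \<noteq> 0}" using assms by (auto simp: span_def)
  have "letter l \<otimes> B.lincomb basis c \<in> span"
    using c(2)
  proof (induction rule: finite_support_induct)
    case zero
    have "(0 :: 'k) \<odot> basis n \<in> span" for n by (rule span_scale[OF basis_in_span])
    then show ?case by simp
  next
    case (add d n c)
    have "B.lincomb basis (\<lambda>i. (if i = n then d else 0) + c i) = d \<odot> basis n \<oplus> B.lincomb basis c"
      by (subst B.lincomb_add) (use add in \<open>auto simp: B.lincomb_single\<close>)
    then show ?case
      using add by (simp add: B.r_distr B.smult_mult_right span_add span_scale letter_basis_in_span)
  qed
  then show ?thesis using c by simp
qed

lemma one_in_span: "\<one> \<in> span"
  using basis_in_span[of "(0, 0, 0, 0)"] by (simp add: torus_part_def xy_part_def)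

end

lemma weyl_rep_comp:
  assumes "weyl_rep B h p q" "algebra_hom B C g"
  shows "weyl_rep C (\<lambda>f. g (h f)) p q"
proof -
  interpret h: weyl_rep B h p q by fact
  interpret g: algebra_hom B C g by fact
  interpret gh: algebra_hom free_algebra C "\<lambda>f. g (h f)"
    by (rule algebra_hom_comp[OF h.algebra_hom_axioms g.algebra_hom_axioms])
  have "g (h r) = \<zero>\<^bsub>C\<^esub>" if "r \<in> weyl_relators p q" for r
    using h.relators[OF that] by simp
  then show ?thesis
    by (intro weyl_rep.intro weyl_rep_axioms.intro gh.algebra_hom_axioms h.p0 h.q0 h.p1
      g.hom_Units h.z_Units h.s_Units h.t_Units)
qed

lemma weyl_rep_comp_basis:
  assumes "weyl_rep B h p q" "algebra_hom B C g"
  shows "g (weyl_rep.basis B h n) = weyl_rep.basis C (\<lambda>f. g (h f)) n"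
proof -
  interpret h: weyl_rep B h p q by fact
  interpret g: algebra_hom B C g by fact
  interpret gh: weyl_rep C "\<lambda>f. g (h f)" p q by (rule weyl_rep_comp[OF assms])
  have eq: "g h.x = gh.x" "g h.y = gh.y" "g h.z = gh.z" "g h.s = gh.s" "g h.t = gh.t"
    by (simp_all only: h.x_def h.y_def h.z_def h.s_def h.t_def gh.x_def gh.y_def gh.z_def gh.s_def gh.t_def)
  show ?thesis
    by (cases n) (simp add: h.torus_part_def h.xy_part_def gh.torus_part_def gh.xy_part_def
      g.hom_upow g.hom_nat_pow eq del: pow_nat)
qed

section \<open>The quantum torus\<close>

text \<open>The scalar that puts \<open>(z\<^sup>i s\<^sup>j t\<^sup>k x\<^sup>a) (z\<^bsup>i'\<^esup> s\<^bsup>j'\<^esup> t\<^bsup>k'\<^esup> x\<^bsup>a'\<^esup>)\<close> into normal form, by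
\<open>x z = p z x\<close> and \<open>t s = q\<^sup>-\<^sup>1 s t\<close>.\<close>

fun torus_twist :: "'k::field \<Rightarrow> 'k \<Rightarrow> exponent \<Rightarrow> exponent \<Rightarrow> 'k" where
  "torus_twist p q (a, j, k, i) (a', j', k', i') = p powi (a * i') * q powi (- (k * j'))"

lemma powi_eq_iff:
  fixes c :: "'k::field"
  assumes "c \<noteq> 0" "\<not> root_of_unity c"
  shows "c powi m = c powi n \<longleftrightarrow> m = n"
proof -
  have one: "n = 0" if "c powi n = 1" for n
  proof (rule ccontr)
    assume "n \<noteq> 0"
    have "c ^ nat \<bar>n\<bar> = 1"
      using that by (cases "n \<ge> 0") (auto simp: power_int_def power_inverse)
    moreover have "nat \<bar>n\<bar> \<ge> 1" using \<open>n \<noteq> 0\<close> by simp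
    ultimately show False using assms(2) by (auto simp: root_of_unity_def)
  qed
  have "c powi m = c powi n \<Longrightarrow> c powi (m - n) = 1"
    using assms(1) by (simp add: power_int_diff)
  then show ?thesis using one[of "m - n"] by auto
qed

locale quantum_torus =
  fixes p q :: "'k::field"
  assumes p0: "p \<noteq> 0" and q0: "q \<noteq> 0"
    and p_root: "\<not> root_of_unity p" and q_root: "\<not> root_of_unity q"
begin

lemma p1: "p \<noteq> 1"
  using p_root by (auto simp: root_of_unity_def)

sublocale twisting "torus_twist p q"
proof
  fix a b c :: exponent
  show "torus_twist p q a b * torus_twist p q (a + b) c = torus_twist p q b c * torus_twist p q a (b + c)"
  proof -
    have collect: "(p powi a * q powi b) * (p powi c * q powi d) = p powi (a + c) * q powi (b + d)" for a b c d
      using p0 q0 by (simp add: power_int_add)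
    show ?thesis
      by (cases a; cases b; cases c)
        (simp only: torus_twist.simps add_Pair collect, simp add: algebra_simps)
  qed
  show "torus_twist p q a b \<noteq> 0" by (cases a; cases b) (use p0 q0 in simp)
  show "torus_twist p q 0 a = 1" "torus_twist p q a 0 = 1"
    by (cases a; simp add: zero_prod_def)+
qed

text \<open>The model of the algebra in the torus: since \<open>yx = (z - 1) / (p - 1)\<close> and \<open>x\<close> becomes invertible,
\<open>y\<close> has to be \<open>(z - 1) x\<^sup>-\<^sup>1 / (p - 1)\<close>.\<close>

fun torus_gen :: "gen \<Rightarrow> exponent \<Rightarrow> 'k" where
  "torus_gen X = monomial 1 (1, 0, 0, 0)"
| "torus_gen Y = monomial (inverse (p - 1)) (-1, 0, 0, 1) \<oplus>\<^bsub>P\<^esub> monomial (- inverse (p - 1)) (-1, 0, 0, 0)"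
| "torus_gen S = monomial 1 (0, 1, 0, 0)"
| "torus_gen T = monomial 1 (0, 0, 1, 0)"

definition \<theta> :: "(gen list \<Rightarrow> 'k) \<Rightarrow> exponent \<Rightarrow> 'k" where
  "\<theta> = (SOME h. h \<in> alg_hom free_algebra P \<and> (\<forall>g. h (free_gen g) = torus_gen g))"

lemma torus_gen_closed: "torus_gen g \<in> carrier P"
  by (cases g) auto

lemma \<theta>: "\<theta> \<in> alg_hom free_algebra P" "\<theta> (free_gen g) = torus_gen g"
proof -
  obtain h where "h \<in> alg_hom free_algebra P" "\<And>g. h (free_gen g) = torus_gen g"
    using P.free_algebra_hom[of torus_gen, OF torus_gen_closed] by blast
  then have "\<exists>h. h \<in> alg_hom free_algebra P \<and> (\<forall>g. h (free_gen g) = torus_gen g)" by blast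
  from someI_ex[OF this] show "\<theta> \<in> alg_hom free_algebra P" "\<theta> (free_gen g) = torus_gen g"
    by (auto simp: \<theta>_def)
qed

sublocale \<theta>: algebra_hom "free_algebra :: ('k, gen list \<Rightarrow> 'k) module" P \<theta>
  by (intro algebra_hom.intro algebra_hom_axioms.intro \<theta> P.assoc_algebra_axioms
      free_algebra_assoc_algebra)

lemma minus_apply: "f \<in> carrier P \<Longrightarrow> g \<in> carrier P \<Longrightarrow> (f \<ominus>\<^bsub>P\<^esub> g) n = f n - g n"
  using P.scale_minus_one[of g] by (simp add: P.minus_eq P_simps(1,4,5)) (simp add: P_simps flip: P.scale_minus_one)

lemma mono_Units: "c \<noteq> 0 \<Longrightarrow> monomial c m \<in> Units P"
proof -
  assume c: "c \<noteq> 0"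
  let ?v = "monomial (inverse (c * torus_twist p q m (- m))) (- m)"
  let ?v' = "monomial (inverse (c * torus_twist p q (- m) m)) (- m)"
  have 1: "monomial c m \<otimes>\<^bsub>P\<^esub> ?v = \<one>\<^bsub>P\<^esub>" "?v' \<otimes>\<^bsub>P\<^esub> monomial c m = \<one>\<^bsub>P\<^esub>"
    using c by (simp_all add: mono_mult_mono one_eq_mono field_simps)
  then have "?v' = ?v" using P.inv_unique[of ?v' "monomial c m" ?v] by simp
  then show ?thesis using 1 by (auto simp: Units_def)
qed

lemma neg_mono: "\<ominus>\<^bsub>P\<^esub> monomial c m = monomial (- c) m"
  using P.scale_minus_one[of "monomial c m"] by (simp add: scale_mono)

lemma p_inverse: "p * inverse (p - 1) = 1 + inverse (p - 1)"
  using p1 by (simp add: field_simps)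

lemma \<theta>_z: "\<theta> free_z = monomial 1 (0, 0, 0, 1)"
proof -
  have "\<theta> free_z = torus_gen X \<otimes>\<^bsub>P\<^esub> torus_gen Y \<ominus>\<^bsub>P\<^esub> torus_gen Y \<otimes>\<^bsub>P\<^esub> torus_gen X"
    by (simp add: \<theta> del: torus_gen.simps)
  also have "\<dots> = monomial 1 (0, 0, 0, 1)"
    using p_inverse
    by (simp add: P.r_distr P.l_distr mono_mult_mono P.minus_eq P.add.inv_mult_group neg_mono)
     (auto simp: P_simps mono_apply algebra_simps fun_eq_iff)
  finally show ?thesis .
qed

lemma weyl_rep_\<theta>: "weyl_rep P \<theta> p q"
proof -
  have X: "torus_gen X \<otimes>\<^bsub>P\<^esub> torus_gen Y \<ominus>\<^bsub>P\<^esub> p \<odot>\<^bsub>P\<^esub> (torus_gen Y \<otimes>\<^bsub>P\<^esub> torus_gen X) \<ominus>\<^bsub>P\<^esub> \<one>\<^bsub>P\<^esub> = \<zero>\<^bsub>P\<^esub>"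
    using p_inverse
    by (simp add: P.r_distr P.l_distr mono_mult_mono P.minus_eq P.add.inv_mult_group neg_mono
        P.scale_add_right scale_mono one_eq_mono)
      (auto simp: P_simps mono_apply algebra_simps fun_eq_iff zero_prod_def)
  have ST: "torus_gen S \<otimes>\<^bsub>P\<^esub> torus_gen T = q \<odot>\<^bsub>P\<^esub> (torus_gen T \<otimes>\<^bsub>P\<^esub> torus_gen S)"
    using q0 by (simp add: mono_mult_mono scale_mono power_int_minus)
  have SX: "torus_gen S \<otimes>\<^bsub>P\<^esub> torus_gen X = torus_gen X \<otimes>\<^bsub>P\<^esub> torus_gen S"
    "torus_gen S \<otimes>\<^bsub>P\<^esub> torus_gen Y = torus_gen Y \<otimes>\<^bsub>P\<^esub> torus_gen S"
    "torus_gen T \<otimes>\<^bsub>P\<^esub> torus_gen X = torus_gen X \<otimes>\<^bsub>P\<^esub> torus_gen T"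
    "torus_gen T \<otimes>\<^bsub>P\<^esub> torus_gen Y = torus_gen Y \<otimes>\<^bsub>P\<^esub> torus_gen T"
    by (simp_all add: P.r_distr P.l_distr mono_mult_mono)
  have "\<theta> r = \<zero>\<^bsub>P\<^esub>" if "r \<in> weyl_relators p q" for r
    using that unfolding weyl_relators_def Let_def
    by (elim insertE emptyE)
      (use X ST SX in \<open>simp_all add: \<theta>(2) P.diff_eq_zero torus_gen_closed del: torus_gen.simps\<close>)
  then show ?thesis
    by (intro weyl_rep.intro weyl_rep_axioms.intro \<theta>.algebra_hom_axioms p0 q0 p1)
      (simp_all add: \<theta>_z \<theta>(2) mono_Units del: \<theta>.hom_mult \<theta>.hom_diff)
qed

sublocale \<theta>: weyl_rep P \<theta> p q by (rule weyl_rep_\<theta>)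

end

lemma exponent_sum_atom:
  fixes d d' :: exponent
  assumes "d + d' = (0, 0, 0, 1)" "0 \<le> d" "0 \<le> d'"
  shows "d = 0 \<and> d' = (0, 0, 0, 1) \<or> d' = 0 \<and> d = (0, 0, 0, 1)"
proof -
  obtain a b c e where d: "d = (a, b, c, e)" by (cases d)
  obtain a' b' c' e' where d': "d' = (a', b', c', e')" by (cases d')
  have le: "(0, 0, 0, 0) \<le> d" "(0, 0, 0, 0) \<le> d'" using assms(2,3) by (simp_all add: zero_prod_def)
  have sum: "a + a' = 0" "b + b' = 0" "c + c' = 0" "e + e' = 1" using assms(1) by (simp_all add: d d')
  have "0 \<le> a" "0 \<le> a'" using le by (auto simp: d d')
  then have a: "a = 0" "a' = 0" using sum(1) by linarith+
  have "0 \<le> b" "0 \<le> b'" using le by (auto simp: d d' a)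
  then have b: "b = 0" "b' = 0" using sum(2) by linarith+
  have "0 \<le> c" "0 \<le> c'" using le by (auto simp: d d' a b)
  then have c: "c = 0" "c' = 0" using sum(3) by linarith+
  have "0 \<le> e" "0 \<le> e'" using le by (auto simp: d d' a b c)
  then have "e = 0 \<and> e' = 1 \<or> e' = 0 \<and> e = 1" using sum(4) by linarith
  then show ?thesis by (auto simp: d d' a b c zero_prod_def)
qed

section \<open>Representations in the quantum torus\<close>

text \<open>For the composite of the model with an endomorphism, the extra assumption is satisfied because units
of the localization have degree zero in \<open>x\<close>.\<close>

locale torus_rep = quantum_torus p q + weyl_rep "twisted_group_algebra (torus_twist p q)" h p q
  for p q :: "'k::field" and h +
  assumes X_degree: "fst (deg z) = 0" "fst (deg s) = 0" "fst (deg t) = 0"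
begin

lemma unit_form: "u \<in> Units P \<Longrightarrow> u (deg u) \<noteq> 0 \<and> u = monomial (u (deg u)) (deg u)"
  by (erule unit_is_mono) (metis deg_mono mono_apply)

text \<open>Units are monomials, so a commutation relation between them is an equation between powers of
\<open>p\<close> and \<open>q\<close>.\<close>

lemma commuting_units:
  assumes u: "u \<in> Units P" "v \<in> Units P" and c: "u \<otimes>\<^bsub>P\<^esub> v = c \<odot>\<^bsub>P\<^esub> (v \<otimes>\<^bsub>P\<^esub> u)"
  shows "torus_twist p q (deg u) (deg v) = c * torus_twist p q (deg v) (deg u)"
proof -
  obtain a m where a: "u = monomial a m" "a \<noteq> 0" using unit_form[OF u(1)] by blast
  obtain b n where b: "v = monomial b n" "b \<noteq> 0" using unit_form[OF u(2)] by blast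
  have "monomial (a * b * torus_twist p q m n) (m + n) = monomial (c * (b * a * torus_twist p q n m)) (n + m)"
    using c by (simp add: a b mono_mult_mono scale_mono)
  then have "a * b * torus_twist p q m n = c * (b * a * torus_twist p q n m)"
    by (metis add.commute mono_apply)
  then show ?thesis using a b by simp
qed

text \<open>Comparing powers of \<open>q\<close>, the relation \<open>st = qts\<close> says that the exponents of \<open>s\<close> and
\<open>t\<close> have determinant one, and centrality of \<open>z\<close> for \<open>s\<close> and \<open>t\<close> then forces \<open>z\<close>
to be a multiple of a power of the torus variable \<open>z\<close>.\<close>

lemma unit_degrees:
  obtains e j1 k1 i1 j2 k2 i2 where "deg z = (0, 0, 0, e)" "deg s = (0, j1, k1, i1)"
    "deg t = (0, j2, k2, i2)" "j1 * k2 - k1 * j2 = 1"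
proof -
  obtain jz kz e where z: "deg z = (0, jz, kz, e)" using X_degree by (cases "deg z") auto
  obtain j1 k1 i1 where s: "deg s = (0, j1, k1, i1)" using X_degree by (cases "deg s") auto
  obtain j2 k2 i2 where t: "deg t = (0, j2, k2, i2)" using X_degree by (cases "deg t") auto
  note powi = powi_eq_iff[OF q0 q_root]
  have "q powi (- (k1 * j2)) = q powi (1 - k2 * j1)"
    using commuting_units[of s t q] relations(1) q0 by (simp add: s t power_int_diff power_int_minus field_simps)
  then have det: "j1 * k2 - k1 * j2 = 1" by (simp add: powi algebra_simps)
  have "q powi (- (k1 * jz)) = q powi (- (kz * j1))"
    using commuting_units[of s z 1] sz by (simp add: s z)
  then have 1: "k1 * jz = kz * j1" by (simp add: powi)
  have "q powi (- (k2 * jz)) = q powi (- (kz * j2))"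
    using commuting_units[of t z 1] tz by (simp add: t z)
  then have 2: "k2 * jz = kz * j2" by (simp add: powi)
  have "jz = jz * (j1 * k2 - k1 * j2)" "kz = kz * (j1 * k2 - k1 * j2)" using det by simp_all
  moreover have "jz * (j1 * k2 - k1 * j2) = j1 * (k2 * jz) - j2 * (k1 * jz)"
    by (simp add: algebra_simps)
  then have "jz * (j1 * k2 - k1 * j2) = 0" unfolding 1 2 by simp
  moreover have "kz * (j1 * k2 - k1 * j2) = k2 * (kz * j1) - k1 * (kz * j2)"
    by (simp add: algebra_simps)
  then have "kz * (j1 * k2 - k1 * j2) = 0" unfolding 1[symmetric] 2[symmetric] by simp
  ultimately have "jz = 0" "kz = 0" by simp_all
  then show ?thesis using that z s t det by simp
qed

lemma xy_nonzero: "x \<noteq> \<zero>\<^bsub>P\<^esub>" "y \<noteq> \<zero>\<^bsub>P\<^esub>"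
  using relation_xy one_nonzero by auto

text \<open>Comparing coefficients in \<open>xz = pzx\<close> and \<open>zy = pyz\<close>: the exponent of \<open>z\<close> is \<open>1\<close> or
\<open>-1\<close>, and \<open>x\<close> and \<open>y\<close> are homogeneous in the first coordinate, of opposite
degrees.\<close>

lemma xy_degrees:
  assumes z: "deg z = (0, 0, 0, e)"
  shows "x n \<noteq> 0 \<Longrightarrow> fst n * e = 1" and "y n \<noteq> 0 \<Longrightarrow> fst n * e = -1"
proof -
  obtain c where c: "z = monomial c (0, 0, 0, e)" "c \<noteq> 0"
    using unit_form[OF Units(1)] z by metis
  note powi = powi_eq_iff[OF p0 p_root]
  have 1: "(x \<otimes>\<^bsub>P\<^esub> z) (n + deg z) = (p \<odot>\<^bsub>P\<^esub> (z \<otimes>\<^bsub>P\<^esub> x)) (n + deg z)" by (simp add: xz)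
  show "fst n * e = 1" if "x n \<noteq> 0"
  proof -
    have "p powi (fst n * e) = p powi 1"
      using 1 c that by (cases n) (simp add: z mult_mono_apply mono_mult_apply P_simps(5))
    then show ?thesis by (simp only: powi)
  qed
  have 2: "(z \<otimes>\<^bsub>P\<^esub> y) (n + deg z) = (p \<odot>\<^bsub>P\<^esub> (y \<otimes>\<^bsub>P\<^esub> z)) (n + deg z)" by (simp add: zy)
  show "fst n * e = -1" if "y n \<noteq> 0"
  proof -
    have "p powi 0 = p powi (1 + fst n * e)"
      using 2 c that p0 by (cases n) (simp add: z mult_mono_apply mono_mult_apply P_simps(5) power_int_add)
    then show ?thesis by (simp only: powi)
  qed
qed

lemma deg_upow:
  assumes e: "\<And>m n. e (m + n) = (e m + e n :: int)" and u: "u \<in> Units P"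
  shows "e (deg (P.upow u i)) = i * e (deg u)"
proof -
  have ne: "v \<noteq> \<zero>\<^bsub>P\<^esub>" if "v \<in> Units P" for v using unit_form[OF that] mono_eq_zero_iff by metis
  have mult: "e (deg (v \<otimes>\<^bsub>P\<^esub> w)) = e (deg v) + e (deg w)" if "v \<in> Units P" "w \<in> Units P" for v w
    using that by (simp add: deg_mult ne e P.Units_closed)
  have e0: "e 0 = 0" using e[of 0 0] by simp
  have "e (deg (inv\<^bsub>P\<^esub> u)) = - e (deg u)"
    using mult[of u "inv\<^bsub>P\<^esub> u"] u e0 by (simp add: one_eq_mono)
  then show ?thesis
    by (induction i rule: int_induct[where k = 0])
      (use u e0 in \<open>simp_all add: one_eq_mono P.upow_Suc P.upow_pred mult algebra_simps\<close>)
qed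

lemma nat_pow_nonzero: "f \<in> carrier P \<Longrightarrow> f \<noteq> \<zero>\<^bsub>P\<^esub> \<Longrightarrow> f [^]\<^bsub>P\<^esub> (n::nat) \<noteq> \<zero>\<^bsub>P\<^esub>"
  by (induction n) (simp_all add: one_nonzero mult_nonzero)

lemma deg_nat_pow:
  assumes e: "\<And>m n. e (m + n) = (e m + e n :: int)" and f: "f \<in> carrier P" "f \<noteq> \<zero>\<^bsub>P\<^esub>"
  shows "e (deg (f [^]\<^bsub>P\<^esub> (n::nat))) = int n * e (deg f)"
proof -
  have e0: "e 0 = 0" using e[of 0 0] by simp
  show ?thesis
    by (induction n) (use f e0 in \<open>simp_all add: one_eq_mono deg_mult nat_pow_nonzero e algebra_simps\<close>)
qed

lemma xy_part_nonzero: "xy_part a \<noteq> \<zero>\<^bsub>P\<^esub>"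
  by (simp add: xy_part_def nat_pow_nonzero xy_nonzero del: pow_nat)

lemma deg_xy_part:
  assumes "\<And>m n. e (m + n) = (e m + e n :: int)"
  shows "e (deg (xy_part a)) = (if a \<ge> 0 then a * e (deg x) else - a * e (deg y))"
  using deg_nat_pow[OF assms, of x] deg_nat_pow[OF assms, of y] xy_nonzero
  by (simp add: xy_part_def del: pow_nat)

lemma Units_nonzero: "u \<in> Units P \<Longrightarrow> u \<noteq> \<zero>\<^bsub>P\<^esub>"
  using unit_form mono_eq_zero_iff by metis

lemma basis_nonzero: "basis n \<noteq> \<zero>\<^bsub>P\<^esub>"
  by (cases n) (simp add: mult_nonzero Units_nonzero xy_part_nonzero)

lemma deg_torus_part:
  assumes e: "\<And>m n. e (m + n) = (e m + e n :: int)"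
  shows "e (deg (torus_part i j k)) = i * e (deg z) + j * e (deg s) + k * e (deg t)"
proof -
  have "deg (torus_part i j k) = deg (P.upow z i) + deg (P.upow s j) + deg (P.upow t k)"
    by (simp add: torus_part_def deg_mult mult_nonzero Units_nonzero)
  then show ?thesis by (simp add: e deg_upow[OF e])
qed

lemma deg_basis:
  assumes e: "\<And>m n. e (m + n) = (e m + e n :: int)"
  shows "e (deg (basis (a, j, k, i)))
    = i * e (deg z) + j * e (deg s) + k * e (deg t) + e (deg (xy_part a))"
  by (simp add: deg_mult Units_nonzero xy_part_nonzero e deg_torus_part[OF e])

text \<open>The degree of a monomial determines its exponents: the first coordinate gives the power of
\<open>x\<close> or \<open>y\<close>, then the determinant one gives the powers of \<open>s\<close> and \<open>t\<close>, and what
remains gives the power of \<open>z\<close>.\<close>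

lemma deg_basis_inj: "inj (\<lambda>n. deg (basis n))"
proof (rule injI)
  fix n n' :: exponent
  obtain a j k i where n: "n = (a, j, k, i)" by (cases n)
  obtain a' j' k' i' where n': "n' = (a', j', k', i')" by (cases n')
  obtain e j1 k1 i1 j2 k2 i2 where d: "deg z = (0, 0, 0, e)" "deg s = (0, j1, k1, i1)"
    "deg t = (0, j2, k2, i2)" "j1 * k2 - k1 * j2 = 1"
    by (rule unit_degrees)
  have x: "fst (deg x) * e = 1" and y: "fst (deg y) * e = -1"
    using xy_degrees[OF d(1)] deg_works(1) xy_nonzero by simp_all
  then have "e \<noteq> 0" by auto
  assume eq: "deg (basis n) = deg (basis n')"
  have pr: "i * f (deg z) + j * f (deg s) + k * f (deg t) + f (deg (xy_part a))
    = i' * f (deg z) + j' * f (deg s) + k' * f (deg t) + f (deg (xy_part a'))"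
    if f: "\<And>m n. f (m + n) = (f m + f n :: int)" for f
    using arg_cong[OF eq, of f] unfolding n n' deg_basis[OF f] .
  have fst_xy: "fst (deg (xy_part a)) * e = a" for a
    using x y by (simp add: deg_xy_part[of fst] mult.assoc)
  have "fst (deg (xy_part a)) = fst (deg (xy_part a'))" using pr[of fst] d by simp
  then have a: "a = a'" using fst_xy by metis
  have 1: "j * j1 + k * j2 = j' * j1 + k' * j2" using pr[of "\<lambda>m. fst (snd m)"] d a by simp
  have 2: "j * k1 + k * k2 = j' * k1 + k' * k2" using pr[of "\<lambda>m. fst (snd (snd m))"] d a by simp
  have "(j - j') * (j1 * k2 - k1 * j2)
      = k2 * ((j * j1 + k * j2) - (j' * j1 + k' * j2)) - j2 * ((j * k1 + k * k2) - (j' * k1 + k' * k2))"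
    "(k - k') * (j1 * k2 - k1 * j2)
      = j1 * ((j * k1 + k * k2) - (j' * k1 + k' * k2)) - k1 * ((j * j1 + k * j2) - (j' * j1 + k' * j2))"
    by (simp_all add: algebra_simps)
  then have "(j - j') * (j1 * k2 - k1 * j2) = 0" "(k - k') * (j1 * k2 - k1 * j2) = 0"
    unfolding 1 2 by simp_all
  then have jk: "j = j'" "k = k'" using d(4) by simp_all
  have "i * e = i' * e" using pr[of "\<lambda>m. snd (snd (snd m))"] d a jk by simp
  then show "n = n'" using \<open>e \<noteq> 0\<close> a jk n n' by simp
qed

text \<open>The product \<open>yx\<close> is a multiple of \<open>c z\<^sup>\<plusminus>\<^sup>1 - 1\<close>, whose highest and lowest exponents are adjacent.
Widths add, so one factor is a monomial and the other one has two adjacent exponents.\<close>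

lemma width:
  shows "(ldeg x = deg x \<and> deg y = ldeg y + (0, 0, 0, 1)) \<or> (ldeg y = deg y \<and> deg x = ldeg x + (0, 0, 0, 1))"
proof -
  obtain e where z: "deg z = (0, 0, 0, e)"
    by (rule unit_degrees) (rule that)
  obtain c where c: "z = monomial c (0, 0, 0, e)" "c \<noteq> 0"
    using unit_form[OF Units(1)] z by metis
  have x: "fst (deg x) * e = 1"
    using xy_degrees[OF z] deg_works(1) xy_nonzero by simp
  then have e: "e = 1 \<or> e = -1" by (auto simp: zmult_eq_1_iff)
  have val: "(y \<otimes>\<^bsub>P\<^esub> x) n = inverse (p - 1) * ((if n = (0, 0, 0, e) then c else 0) - (if n = 0 then 1 else 0))" for n
    by (simp add: yx c P_simps(5) minus_apply mono_apply one_eq_mono)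
  have val_z: "(y \<otimes>\<^bsub>P\<^esub> x) (0, 0, 0, e) \<noteq> 0" and val_0: "(y \<otimes>\<^bsub>P\<^esub> x) 0 \<noteq> 0"
    using e c(2) p1 by (auto simp: val zero_prod_def)
  have supp: "n = (0, 0, 0, e) \<or> n = 0" if "(y \<otimes>\<^bsub>P\<^esub> x) n \<noteq> 0" for n
    using that by (auto simp: val split: if_splits)
  have car: "y \<otimes>\<^bsub>P\<^esub> x \<in> carrier P" by simp
  have "deg (y \<otimes>\<^bsub>P\<^esub> x) = ldeg (y \<otimes>\<^bsub>P\<^esub> x) + (0, 0, 0, 1)"
    using e
  proof
    assume e: "e = 1"
    have "deg (y \<otimes>\<^bsub>P\<^esub> x) = (0, 0, 0, e)"
      by (rule deg_eqI[OF car val_z]) (use supp e in \<open>force simp: zero_prod_def\<close>)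
    moreover have "ldeg (y \<otimes>\<^bsub>P\<^esub> x) = 0"
      by (rule ldeg_eqI[OF car val_0]) (use supp e in \<open>force simp: zero_prod_def\<close>)
    ultimately show ?thesis using e by simp
  next
    assume e: "e = -1"
    have "deg (y \<otimes>\<^bsub>P\<^esub> x) = 0"
      by (rule deg_eqI[OF car val_0]) (use supp e in \<open>force simp: zero_prod_def\<close>)
    moreover have "ldeg (y \<otimes>\<^bsub>P\<^esub> x) = (0, 0, 0, e)"
      by (rule ldeg_eqI[OF car val_z]) (use supp e in \<open>force simp: zero_prod_def\<close>)
    ultimately show ?thesis using e by (simp add: zero_prod_def)
  qed
  then have "deg y + deg x = ldeg y + ldeg x + (0, 0, 0, 1)"
    by (simp add: deg_mult ldeg_mult xy_nonzero)
  then have "(deg x - ldeg x) + (deg y - ldeg y) = (0, 0, 0, 1)"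
    by (simp add: algebra_simps)
  moreover have "0 \<le> deg x - ldeg x" "0 \<le> deg y - ldeg y"
    using ldeg_le_deg xy_nonzero by (simp_all add: diff_ge_0_iff_ge)
  ultimately have "deg x - ldeg x = 0 \<and> deg y - ldeg y = (0, 0, 0, 1) \<or>
      deg y - ldeg y = 0 \<and> deg x - ldeg x = (0, 0, 0, 1)"
    by (intro exponent_sum_atom)
  then show ?thesis by (auto simp: diff_eq_eq add.commute)
qed

end

lemma (in quantum_torus) binomial_form:
  assumes f: "f \<in> carrier P" "f \<noteq> \<zero>\<^bsub>P\<^esub>" and d: "deg f = ldeg f + (0, 0, 0, 1)"
  shows "f = monomial (f (ldeg f)) (ldeg f) \<oplus>\<^bsub>P\<^esub> monomial (f (deg f)) (deg f)"
proof
  fix n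
  have "f n \<noteq> 0 \<Longrightarrow> n = ldeg f \<or> n = deg f"
    using deg_works(2,4)[OF f, of n] d by (cases n; cases "ldeg f") auto
  moreover have "ldeg f \<noteq> deg f" using d by (cases "ldeg f") auto
  ultimately show "f n = (monomial (f (ldeg f)) (ldeg f) \<oplus>\<^bsub>P\<^esub> monomial (f (deg f)) (deg f)) n"
    by (auto simp: P_simps mono_apply)
qed

section \<open>The localization embeds into the quantum torus\<close>

abbreviation weyl_ideal :: "'k::field \<Rightarrow> 'k \<Rightarrow> (gen list \<Rightarrow> 'k) set" where
  "weyl_ideal p q \<equiv> Idl\<^bsub>free_algebra\<^esub> (weyl_relators p q)"

definition weyl_coset :: "'k::field \<Rightarrow> 'k \<Rightarrow> (gen list \<Rightarrow> 'k) \<Rightarrow> (gen list \<Rightarrow> 'k) set" where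
  "weyl_coset p q f = weyl_ideal p q +>\<^bsub>free_algebra\<^esub> f"

definition free_monomial :: "nat \<Rightarrow> nat \<Rightarrow> nat \<Rightarrow> gen list \<Rightarrow> 'k::field" where
  "free_monomial i j k = free_z [^]\<^bsub>free_algebra\<^esub> i \<otimes>\<^bsub>free_algebra\<^esub> free_gen S [^]\<^bsub>free_algebra\<^esub> j
     \<otimes>\<^bsub>free_algebra\<^esub> free_gen T [^]\<^bsub>free_algebra\<^esub> k"

lemma free_monomial_closed [simp, intro]: "free_monomial i j k \<in> carrier free_algebra"
  by (simp add: free_monomial_def)

lemma weyl_relators_closed: "weyl_relators p q \<subseteq> carrier free_algebra"
  by (simp add: weyl_relators_def Let_def)

lemma ideal_weyl_ideal: "ideal (weyl_ideal p q) free_algebra"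
  by (rule free.genideal_ideal[OF weyl_relators_closed])

lemma weyl_algebra_eq: "weyl_algebra p q = quot_algebra free_algebra (weyl_ideal p q)"
  by (simp add: weyl_algebra_def)

lemma weyl_coset_hom: "weyl_coset p q \<in> alg_hom free_algebra (weyl_algebra p q)"
  using free.quot_algebra_hom(1)[OF ideal_weyl_ideal[of p q]]
  unfolding weyl_algebra_eq weyl_coset_def[abs_def] .

lemma ring_weyl_algebra: "ring (weyl_algebra p q)"
  using free.quot_algebra_hom(2)[OF ideal_weyl_ideal[of p q]] by (simp add: weyl_algebra_eq)

lemma ring_hom_weyl_coset: "ring_hom_ring free_algebra (weyl_algebra p q) (weyl_coset p q)"
  using weyl_coset_hom ring_weyl_algebra free.ring_axioms
  by (intro ring_hom_ringI2) (auto simp: alg_hom_def)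

lemma weyl_coset_zero_iff:
  assumes "f \<in> carrier free_algebra"
  shows "weyl_coset p q f = \<zero>\<^bsub>weyl_algebra p q\<^esub> \<longleftrightarrow> f \<in> weyl_ideal p q"
proof -
  interpret I: ideal "weyl_ideal p q" free_algebra by (rule ideal_weyl_ideal)
  have "\<zero>\<^bsub>weyl_algebra p q\<^esub> = weyl_ideal p q"
    by (simp add: weyl_algebra_eq quot_algebra_def FactRing_def)
  then show ?thesis
    using I.a_rcos_self[OF assms] free.a_rcos_zero[OF ideal_weyl_ideal, of f p q]
    by (auto simp: weyl_coset_def)
qed

lemma weyl_coset_surj:
  "a \<in> carrier (weyl_algebra p q) \<Longrightarrow> \<exists>f\<in>carrier free_algebra. a = weyl_coset p q f"
  by (auto simp: weyl_algebra_eq quot_algebra_def FactRing_def A_RCOSETS_def' weyl_coset_def)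

lemma weyl_ore_set_eq:
  "weyl_ore_set p q = {weyl_coset p q (c \<odot>\<^bsub>free_algebra\<^esub> free_monomial i j k) | c i j k. c \<noteq> 0}"
proof -
  interpret \<kappa>: ring_hom_ring free_algebra "weyl_algebra p q" "weyl_coset p q"
    by (rule ring_hom_weyl_coset)
  have gen: "weyl_gen p q g = weyl_coset p q (free_gen g)" for g
    by (simp add: weyl_gen_def weyl_coset_def)
  have z: "weyl_z p q = weyl_coset p q free_z"
    by (simp add: weyl_z_def gen free.minus_eq \<kappa>.S.minus_eq)
  have scale: "weyl_coset p q (c \<odot>\<^bsub>free_algebra\<^esub> f) = c \<odot>\<^bsub>weyl_algebra p q\<^esub> weyl_coset p q f"
    if "f \<in> carrier free_algebra" for c f
    using weyl_coset_hom[of p q] that unfolding alg_hom_def by blast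
  have "c \<odot>\<^bsub>weyl_algebra p q\<^esub> (weyl_z p q [^]\<^bsub>weyl_algebra p q\<^esub> i \<otimes>\<^bsub>weyl_algebra p q\<^esub>
      weyl_gen p q S [^]\<^bsub>weyl_algebra p q\<^esub> j \<otimes>\<^bsub>weyl_algebra p q\<^esub> weyl_gen p q T [^]\<^bsub>weyl_algebra p q\<^esub> k)
      = weyl_coset p q (c \<odot>\<^bsub>free_algebra\<^esub> free_monomial i j k)" for c i j k
    by (simp add: scale free_monomial_def gen z \<kappa>.hom_nat_pow)
  then show ?thesis by (simp add: weyl_ore_set_def Let_def)
qed

locale weyl_localization = quantum_torus p q for p q :: "'k::field" +
  fixes L :: "('k, 'b) module" and \<iota>
  assumes ore: "ore_localization (weyl_algebra p q) (weyl_ore_set p q) L \<iota>"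
begin

sublocale L: assoc_algebra L
  using ore by (simp add: ore_localization_def)

definition \<pi> where "\<pi> f = \<iota> (weyl_coset p q f)"

lemma \<iota>_hom: "\<iota> \<in> alg_hom (weyl_algebra p q) L"
  using ore by (simp add: ore_localization_def)

sublocale \<pi>: algebra_hom "free_algebra :: ('k, gen list \<Rightarrow> 'k) module" L \<pi>
proof (intro algebra_hom.intro algebra_hom_axioms.intro free_algebra_assoc_algebra L.assoc_algebra_axioms)
  show "\<pi> \<in> alg_hom free_algebra L"
    using \<iota>_hom weyl_coset_hom[of p q]
    by (auto simp: alg_hom_def ring_hom_def \<pi>_def[abs_def] Pi_def)
qed

lemma \<iota>_zero: "\<iota> \<zero>\<^bsub>weyl_algebra p q\<^esub> = \<zero>\<^bsub>L\<^esub>"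
proof -
  interpret \<iota>: ring_hom_ring "weyl_algebra p q" L \<iota>
    using \<iota>_hom ring_weyl_algebra L.ring_axioms by (intro ring_hom_ringI2) (auto simp: alg_hom_def)
  show ?thesis by simp
qed

lemma \<pi>_ideal: "f \<in> weyl_ideal p q \<Longrightarrow> \<pi> f = \<zero>\<^bsub>L\<^esub>"
proof -
  assume f: "f \<in> weyl_ideal p q"
  interpret I: ideal "weyl_ideal p q" free_algebra by (rule ideal_weyl_ideal)
  show ?thesis using weyl_coset_zero_iff[of f p q] f \<iota>_zero by (simp add: \<pi>_def I.a_Hcarr)
qed

lemma \<pi>_monomial_Units: "c \<noteq> 0 \<Longrightarrow> \<pi> (c \<odot>\<^bsub>free_algebra\<^esub> free_monomial i j k) \<in> Units L"
  using ore unfolding ore_localization_def weyl_ore_set_eq \<pi>_def by blast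

lemma weyl_rep_\<pi>: "weyl_rep L \<pi> p q"
proof -
  have "\<pi> r = \<zero>\<^bsub>L\<^esub>" if "r \<in> weyl_relators p q" for r
    using that free.genideal_self[OF weyl_relators_closed] \<pi>_ideal by blast
  moreover have "\<pi> free_z \<in> Units L" "\<pi> (free_gen S) \<in> Units L" "\<pi> (free_gen T) \<in> Units L"
    using \<pi>_monomial_Units[of 1 1 0 0] \<pi>_monomial_Units[of 1 0 1 0] \<pi>_monomial_Units[of 1 0 0 1]
    by (simp_all add: free_monomial_def)
  ultimately show ?thesis
    by (intro weyl_rep.intro weyl_rep_axioms.intro \<pi>.algebra_hom_axioms p0 q0 p1)
qed

sublocale \<pi>: weyl_rep L \<pi> p q by (rule weyl_rep_\<pi>)

lemma \<theta>_ideal: "f \<in> weyl_ideal p q \<Longrightarrow> \<theta> f = \<zero>\<^bsub>P\<^esub>"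
proof -
  assume f: "f \<in> weyl_ideal p q"
  have "weyl_relators p q \<subseteq> a_kernel free_algebra P \<theta>"
  proof
    fix r assume r: "r \<in> weyl_relators p q"
    then have "r \<in> carrier free_algebra" using weyl_relators_closed by blast
    then show "r \<in> a_kernel free_algebra P \<theta>"
      unfolding a_kernel_def' using \<theta>.relators[OF r] by simp
  qed
  then have "weyl_ideal p q \<subseteq> a_kernel free_algebra P \<theta>"
    by (rule free.genideal_minimal[OF \<theta>.kernel_is_ideal])
  then have "f \<in> a_kernel free_algebra P \<theta>" using f by (rule subsetD)
  then show ?thesis by (rule \<theta>.kernel_zero)
qed

text \<open>What dies in the localization is torsion, and torsion dies in the torus, where the elements of the
Ore set are units.\<close>

lemma \<pi>_kernel:
  assumes f: "f \<in> carrier free_algebra" and 0: "\<pi> f = \<zero>\<^bsub>L\<^esub>"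
  shows "\<theta> f = \<zero>\<^bsub>P\<^esub>"
proof -
  interpret \<kappa>: ring_hom_ring free_algebra "weyl_algebra p q" "weyl_coset p q"
    by (rule ring_hom_weyl_coset)
  obtain u where u: "u \<in> weyl_ore_set p q"
    "u \<otimes>\<^bsub>weyl_algebra p q\<^esub> weyl_coset p q f = \<zero>\<^bsub>weyl_algebra p q\<^esub>"
    using ore 0 f \<kappa>.hom_closed[OF f] unfolding ore_localization_def \<pi>_def by blast
  obtain c i j k where c: "c \<noteq> 0" "u = weyl_coset p q (c \<odot>\<^bsub>free_algebra\<^esub> free_monomial i j k)"
    using u by (auto simp: weyl_ore_set_eq)
  define g where "g = c \<odot>\<^bsub>free_algebra\<^esub> free_monomial i j k"
  have g: "g \<in> carrier free_algebra" by (simp add: g_def)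
  have "weyl_coset p q (g \<otimes>\<^bsub>free_algebra\<^esub> f) = \<zero>\<^bsub>weyl_algebra p q\<^esub>"
    using u f g by (simp add: c g_def)
  then have "\<theta> g \<otimes>\<^bsub>P\<^esub> \<theta> f = \<zero>\<^bsub>P\<^esub>"
    using \<theta>_ideal[of "g \<otimes>\<^bsub>free_algebra\<^esub> f"] f g weyl_coset_zero_iff[of "g \<otimes>\<^bsub>free_algebra\<^esub> f" p q] by simp
  moreover have "\<theta> (free_monomial i j k) \<noteq> \<zero>\<^bsub>P\<^esub>"
  proof -
    have "\<theta> (free_monomial i j k) = \<theta>.z [^]\<^bsub>P\<^esub> i \<otimes>\<^bsub>P\<^esub> \<theta>.s [^]\<^bsub>P\<^esub> j \<otimes>\<^bsub>P\<^esub> \<theta>.t [^]\<^bsub>P\<^esub> k"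
      by (simp add: free_monomial_def \<theta>.z_def \<theta>.s_def \<theta>.t_def \<theta>.hom_nat_pow del: \<theta>.hom_diff)
    moreover have "u [^]\<^bsub>P\<^esub> (n::nat) \<in> Units P" if "u \<in> Units P" for u n
      using that by (induction n) auto
    ultimately have "\<theta> (free_monomial i j k) \<in> Units P" by auto
    then show ?thesis using unit_is_mono mono_eq_zero_iff by metis
  qed
  then have "\<theta> g \<noteq> \<zero>\<^bsub>P\<^esub>"
    using c(1) P.scale_cancel[of c "\<theta> (free_monomial i j k)" "\<zero>\<^bsub>P\<^esub>"] by (auto simp: g_def)
  ultimately show ?thesis using mult_nonzero[of "\<theta> g" "\<theta> f"] f g by auto
qed

lemma fraction:
  assumes "l \<in> carrier L"
  obtains c i j k f where "c \<noteq> 0" "f \<in> carrier free_algebra"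
    "\<pi> (c \<odot>\<^bsub>free_algebra\<^esub> free_monomial i j k) \<otimes>\<^bsub>L\<^esub> l = \<pi> f"
proof -
  obtain u a where u: "u \<in> weyl_ore_set p q" "a \<in> carrier (weyl_algebra p q)"
    "l = inv\<^bsub>L\<^esub> (\<iota> u) \<otimes>\<^bsub>L\<^esub> \<iota> a"
    using ore assms unfolding ore_localization_def by blast
  obtain f where f: "f \<in> carrier free_algebra" "a = weyl_coset p q f"
    using weyl_coset_surj[OF u(2)] by blast
  obtain c i j k where c: "c \<noteq> 0" "u = weyl_coset p q (c \<odot>\<^bsub>free_algebra\<^esub> free_monomial i j k)"
    using u by (auto simp: weyl_ore_set_eq)
  let ?g = "c \<odot>\<^bsub>free_algebra\<^esub> free_monomial i j k"
  have l: "l = inv\<^bsub>L\<^esub> (\<pi> ?g) \<otimes>\<^bsub>L\<^esub> \<pi> f" using u f c by (simp add: \<pi>_def)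
  have U: "\<pi> ?g \<in> Units L" by (rule \<pi>_monomial_Units[OF c(1)])
  have "\<pi> ?g \<otimes>\<^bsub>L\<^esub> l = (\<pi> ?g \<otimes>\<^bsub>L\<^esub> inv\<^bsub>L\<^esub> (\<pi> ?g)) \<otimes>\<^bsub>L\<^esub> \<pi> f"
    unfolding l using U f by (intro L.m_assoc[symmetric]) auto
  also have "\<dots> = \<pi> f" using L.Units_r_inv[OF U] f by simp
  finally show ?thesis using that c f by blast
qed

end

context weyl_rep
begin

text \<open>Clearing denominators by powers of \<open>w\<close> survives left multiplication by letters and, in the next
lemma, addition.\<close>

lemma w_pow_letter:
  assumes l: "l \<in> carrier B" and f: "f \<in> carrier free_algebra" and eq: "w [^] (N::nat) \<otimes> l = h f"
  shows "w [^] Suc N \<otimes> (letter a \<otimes> l)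
    = h (letter_scalar p q a ^ N \<odot>\<^bsub>free_algebra\<^esub> (free_letter q a \<otimes>\<^bsub>free_algebra\<^esub> f))"
proof -
  have comm: "w [^] N \<otimes> letter a = letter_scalar p q a ^ N \<odot> (letter a \<otimes> w [^] N)" for N :: nat
  proof (induction N)
    case (Suc N)
    have "w [^] Suc N \<otimes> letter a = w [^] N \<otimes> (w \<otimes> letter a)" by (simp add: B.m_assoc)
    also have "\<dots> = letter_scalar p q a \<odot> ((w [^] N \<otimes> letter a) \<otimes> w)"
      by (simp add: w_commute B.smult_mult_right B.m_assoc)
    also have "\<dots> = letter_scalar p q a ^ Suc N \<odot> (letter a \<otimes> w [^] Suc N)"
      by (simp add: Suc B.smult_mult_left B.m_assoc)
    finally show ?case .
  qed simp
  have "w [^] Suc N = w \<otimes> w [^] N" by (rule B.nat_pow_Suc2) simp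
  then have "w [^] Suc N \<otimes> (letter a \<otimes> l) = w \<otimes> ((w [^] N \<otimes> letter a) \<otimes> l)"
    using l by (simp add: B.m_assoc del: nat_pow_Suc B.nat_pow_Suc)
  also have "\<dots> = letter_scalar p q a ^ N \<odot> ((w \<otimes> letter a) \<otimes> (w [^] N \<otimes> l))"
    using l by (simp add: comm B.smult_mult_left B.smult_mult_right B.m_assoc)
  finally show ?thesis using f by (simp add: eq w_letter)
qed

lemma w_pow_add:
  assumes l: "l \<in> carrier B" "l' \<in> carrier B" and f: "f \<in> carrier free_algebra" "f' \<in> carrier free_algebra"
    and eq: "w [^] (N::nat) \<otimes> l = h f" "w [^] (M::nat) \<otimes> l' = h f'"
  shows "w [^] (N + M) \<otimes> (l \<oplus> l') = h (free_w [^]\<^bsub>free_algebra\<^esub> M \<otimes>\<^bsub>free_algebra\<^esub> f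
    \<oplus>\<^bsub>free_algebra\<^esub> free_w [^]\<^bsub>free_algebra\<^esub> N \<otimes>\<^bsub>free_algebra\<^esub> f')"
proof -
  have "w [^] (N + M) \<otimes> l = w [^] M \<otimes> (w [^] N \<otimes> l)"
    using l by (simp add: B.nat_pow_mult[symmetric] B.m_assoc add.commute[of N])
  moreover have "w [^] (N + M) \<otimes> l' = w [^] N \<otimes> (w [^] M \<otimes> l')"
    using l by (simp add: B.nat_pow_mult[symmetric] B.m_assoc)
  ultimately show ?thesis using l f by (simp add: B.r_distr eq hom_nat_pow flip: w_eq)
qed

end

fun gen_letter :: "gen \<Rightarrow> letter" where
  "gen_letter X = LX" | "gen_letter Y = LY" | "gen_letter S = LS" | "gen_letter T = LT"

lemma (in weyl_rep) letter_gen: "letter (gen_letter g) = h (free_gen g)"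
  by (cases g) (simp_all add: x_def y_def s_def t_def)

context weyl_localization
begin

text \<open>The graph of the embedding, defined as the part of the product of the two algebras generated by
the pairs of equal letters. Compatibility with the operations is then built in; what remains is
that the relation is a function (clear denominators and use \<open>\<pi>_kernel\<close>) and total (every
element is a fraction).\<close>

inductive corresponds :: "'b \<Rightarrow> (exponent \<Rightarrow> 'k) \<Rightarrow> bool" where
  one: "corresponds \<one>\<^bsub>L\<^esub> \<one>\<^bsub>P\<^esub>"
| letter: "corresponds l g \<Longrightarrow> corresponds (\<pi>.letter a \<otimes>\<^bsub>L\<^esub> l) (\<theta>.letter a \<otimes>\<^bsub>P\<^esub> g)"
| add: "corresponds l g \<Longrightarrow> corresponds l' g' \<Longrightarrow> corresponds (l \<oplus>\<^bsub>L\<^esub> l') (g \<oplus>\<^bsub>P\<^esub> g')"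
| scale: "corresponds l g \<Longrightarrow> corresponds (c \<odot>\<^bsub>L\<^esub> l) (c \<odot>\<^bsub>P\<^esub> g)"

lemma corresponds_closed: "corresponds l g \<Longrightarrow> l \<in> carrier L \<and> g \<in> carrier P"
  by (induction rule: corresponds.induct) (auto simp del: \<pi>.letter.simps \<theta>.letter.simps)

lemma corresponds_numerator:
  assumes "corresponds l g"
  shows "\<exists>(N::nat) f. f \<in> carrier free_algebra \<and> \<pi>.w [^]\<^bsub>L\<^esub> N \<otimes>\<^bsub>L\<^esub> l = \<pi> f \<and> \<theta>.w [^]\<^bsub>P\<^esub> N \<otimes>\<^bsub>P\<^esub> g = \<theta> f"
  using assms
proof induction
  case one
  show ?case by (rule exI[of _ 0], rule exI[of _ "\<one>\<^bsub>free_algebra\<^esub>"]) simp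
next
  case (letter l g a)
  then obtain N :: nat and f where f: "f \<in> carrier free_algebra"
    "\<pi>.w [^]\<^bsub>L\<^esub> N \<otimes>\<^bsub>L\<^esub> l = \<pi> f" "\<theta>.w [^]\<^bsub>P\<^esub> N \<otimes>\<^bsub>P\<^esub> g = \<theta> f" by blast
  have "free_letter q a \<otimes>\<^bsub>free_algebra\<^esub> f \<in> carrier free_algebra" using f by simp
  then show ?case
    using \<pi>.w_pow_letter[OF _ f(1,2), of a] \<theta>.w_pow_letter[OF _ f(1,3), of a] corresponds_closed[OF letter(1)]
    by (intro exI[of _ "Suc N"] exI[of _ "letter_scalar p q a ^ N \<odot>\<^bsub>free_algebra\<^esub>
      (free_letter q a \<otimes>\<^bsub>free_algebra\<^esub> f)"] conjI free.scale_closed) blast+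
next
  case (add l g l' g')
  then obtain N M :: nat and f f' where f: "f \<in> carrier free_algebra" "f' \<in> carrier free_algebra"
    "\<pi>.w [^]\<^bsub>L\<^esub> N \<otimes>\<^bsub>L\<^esub> l = \<pi> f" "\<theta>.w [^]\<^bsub>P\<^esub> N \<otimes>\<^bsub>P\<^esub> g = \<theta> f"
    "\<pi>.w [^]\<^bsub>L\<^esub> M \<otimes>\<^bsub>L\<^esub> l' = \<pi> f'" "\<theta>.w [^]\<^bsub>P\<^esub> M \<otimes>\<^bsub>P\<^esub> g' = \<theta> f'"
    by blast
  have "free_w [^]\<^bsub>free_algebra\<^esub> M \<otimes>\<^bsub>free_algebra\<^esub> f
    \<oplus>\<^bsub>free_algebra\<^esub> free_w [^]\<^bsub>free_algebra\<^esub> N \<otimes>\<^bsub>free_algebra\<^esub> f' \<in> carrier free_algebra"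
    using f by simp
  then show ?case
    using \<pi>.w_pow_add[OF _ _ f(1,2,3,5)] \<theta>.w_pow_add[OF _ _ f(1,2,4,6)] corresponds_closed[OF add(1)] corresponds_closed[OF add(2)]
    by (intro exI[of _ "N + M"] exI[of _ "free_w [^]\<^bsub>free_algebra\<^esub> M \<otimes>\<^bsub>free_algebra\<^esub> f
    \<oplus>\<^bsub>free_algebra\<^esub> free_w [^]\<^bsub>free_algebra\<^esub> N \<otimes>\<^bsub>free_algebra\<^esub> f'"] conjI) blast+
next
  case (scale l g c)
  then obtain N :: nat and f where f: "f \<in> carrier free_algebra"
    "\<pi>.w [^]\<^bsub>L\<^esub> N \<otimes>\<^bsub>L\<^esub> l = \<pi> f" "\<theta>.w [^]\<^bsub>P\<^esub> N \<otimes>\<^bsub>P\<^esub> g = \<theta> f" by blast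
  then show ?case
    using corresponds_closed[OF scale(1)]
    by (intro exI[of _ N] exI[of _ "c \<odot>\<^bsub>free_algebra\<^esub> f"]) (simp add: L.smult_mult_right P.smult_mult_right)
qed

lemma corresponds_zero: "corresponds \<zero>\<^bsub>L\<^esub> g \<Longrightarrow> g = \<zero>\<^bsub>P\<^esub>"
proof -
  assume corresponds: "corresponds \<zero>\<^bsub>L\<^esub> g"
  then have g: "g \<in> carrier P" using corresponds_closed by blast
  obtain N :: nat and f where f: "f \<in> carrier free_algebra"
    "\<pi>.w [^]\<^bsub>L\<^esub> N \<otimes>\<^bsub>L\<^esub> \<zero>\<^bsub>L\<^esub> = \<pi> f" "\<theta>.w [^]\<^bsub>P\<^esub> N \<otimes>\<^bsub>P\<^esub> g = \<theta> f"
    using corresponds_numerator[OF corresponds] by blast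
  have "\<theta>.w [^]\<^bsub>P\<^esub> N \<otimes>\<^bsub>P\<^esub> g = \<zero>\<^bsub>P\<^esub>" using \<pi>_kernel[OF f(1)] f by simp
  moreover have "\<theta>.w [^]\<^bsub>P\<^esub> N \<in> Units P" using \<theta>.w_Units by (induction N) auto
  then have "\<theta>.w [^]\<^bsub>P\<^esub> N \<noteq> \<zero>\<^bsub>P\<^esub>" using unit_is_mono mono_eq_zero_iff by metis
  ultimately show "g = \<zero>\<^bsub>P\<^esub>" using mult_nonzero[of "\<theta>.w [^]\<^bsub>P\<^esub> N" g] g by auto
qed

lemma corresponds_unique: "corresponds l g \<Longrightarrow> corresponds l g' \<Longrightarrow> g = g'"
proof -
  assume corresponds: "corresponds l g" "corresponds l g'"
  then have c: "l \<in> carrier L" "g \<in> carrier P" "g' \<in> carrier P" using corresponds_closed by blast+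
  have "corresponds (l \<oplus>\<^bsub>L\<^esub> (-1) \<odot>\<^bsub>L\<^esub> l) (g \<oplus>\<^bsub>P\<^esub> (-1) \<odot>\<^bsub>P\<^esub> g')" by (intro corresponds.add corresponds.scale corresponds)
  then have "g \<ominus>\<^bsub>P\<^esub> g' = \<zero>\<^bsub>P\<^esub>"
    using c corresponds_zero by (simp add: L.scale_minus_one L.r_neg P.scale_minus_one P.minus_eq)
  then show ?thesis using c by (simp add: P.diff_eq_zero)
qed

lemma corresponds_mult:
  assumes "corresponds l g" and corresponds': "corresponds l' g'"
  shows "corresponds (l \<otimes>\<^bsub>L\<^esub> l') (g \<otimes>\<^bsub>P\<^esub> g')"
  using assms(1)
proof induction
  case one
  then show ?case using corresponds' corresponds_closed[OF corresponds'] by simp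
next
  case (letter l g a)
  then show ?case
    using corresponds.letter[OF letter(2), of a] corresponds_closed[OF letter(1)] corresponds_closed[OF corresponds']
    by (simp add: L.m_assoc P.m_assoc)
next
  case (add l1 g1 l2 g2)
  then show ?case
    using corresponds.add[OF add(3,4)] corresponds_closed[OF add(1)] corresponds_closed[OF add(2)] corresponds_closed[OF corresponds']
    by (simp add: L.l_distr P.l_distr)
next
  case (scale l g c)
  then show ?case
    using corresponds.scale[OF scale(2), of c] corresponds_closed[OF scale(1)] corresponds_closed[OF corresponds']
    by (simp add: L.smult_mult_left P.smult_mult_left)
qed

lemma corresponds_free: "f \<in> carrier free_algebra \<Longrightarrow> corresponds (\<pi> f) (\<theta> f)"
proof (induction rule: free_algebra_induct)
  case one
  then show ?case using corresponds.one by simp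
next
  case (gen x f)
  then show ?case using corresponds.letter[OF gen(2), of "gen_letter x"] by (simp add: \<pi>.letter_gen \<theta>.letter_gen)
next
  case (add f g)
  then show ?case using corresponds.add[OF add(3,4)] by simp
next
  case (scale c f)
  then show ?case using corresponds.scale[OF scale(2), of c] by simp
qed

text \<open>A left factor \<open>z\<close>, \<open>s\<close> or \<open>t\<close> can be removed by multiplying with the inverse letter, so the
denominator of a fraction can be stripped off one letter at a time.\<close>

lemma corresponds_total: "l \<in> carrier L \<Longrightarrow> \<exists>g. corresponds l g"
proof -
  assume l: "l \<in> carrier L"
  have step: "\<exists>g. corresponds l g" if l: "l \<in> carrier L" and corresponds: "\<exists>g. corresponds (\<pi>.letter a \<otimes>\<^bsub>L\<^esub> l) g"
    and inv: "\<pi>.letter b \<otimes>\<^bsub>L\<^esub> \<pi>.letter a = \<one>\<^bsub>L\<^esub>" for l a b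
  proof -
    obtain g where "corresponds (\<pi>.letter a \<otimes>\<^bsub>L\<^esub> l) g" using corresponds by blast
    from corresponds.letter[OF this, of b] have "corresponds ((\<pi>.letter b \<otimes>\<^bsub>L\<^esub> \<pi>.letter a) \<otimes>\<^bsub>L\<^esub> l) (\<theta>.letter b \<otimes>\<^bsub>P\<^esub> g)"
      using l L.m_assoc[of "\<pi>.letter b" "\<pi>.letter a" l] by simp
    then show ?thesis using l unfolding inv by auto
  qed
  have pow: "\<exists>g. corresponds l g"
    if inv: "\<pi>.letter b \<otimes>\<^bsub>L\<^esub> \<pi>.letter a = \<one>\<^bsub>L\<^esub>"
      and "l \<in> carrier L" "\<exists>g. corresponds (\<pi>.letter a [^]\<^bsub>L\<^esub> (n::nat) \<otimes>\<^bsub>L\<^esub> l) g" for l a b n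
    using that(2,3)
  proof (induction n arbitrary: l)
    case 0
    then show ?case by simp
  next
    case (Suc n)
    have "\<pi>.letter a [^]\<^bsub>L\<^esub> Suc n \<otimes>\<^bsub>L\<^esub> l = \<pi>.letter a [^]\<^bsub>L\<^esub> n \<otimes>\<^bsub>L\<^esub> (\<pi>.letter a \<otimes>\<^bsub>L\<^esub> l)"
      using Suc.prems(1) by (simp add: L.m_assoc)
    then have "\<exists>g. corresponds (\<pi>.letter a [^]\<^bsub>L\<^esub> n \<otimes>\<^bsub>L\<^esub> (\<pi>.letter a \<otimes>\<^bsub>L\<^esub> l)) g"
      using Suc.prems(2) by simp
    then have "\<exists>g. corresponds (\<pi>.letter a \<otimes>\<^bsub>L\<^esub> l) g"
      by (rule Suc.IH[OF L.m_closed[OF \<pi>.letter_closed Suc.prems(1)]])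
    then show ?case by (rule step[OF Suc.prems(1) _ inv])
  qed
  obtain c i j k f where f: "c \<noteq> 0" "f \<in> carrier free_algebra"
    "\<pi> (c \<odot>\<^bsub>free_algebra\<^esub> free_monomial i j k) \<otimes>\<^bsub>L\<^esub> l = \<pi> f" by (rule fraction[OF l])
  have "\<pi>.letter LZ [^]\<^bsub>L\<^esub> i \<otimes>\<^bsub>L\<^esub> (\<pi>.letter LS [^]\<^bsub>L\<^esub> j \<otimes>\<^bsub>L\<^esub>
      (\<pi>.letter LT [^]\<^bsub>L\<^esub> k \<otimes>\<^bsub>L\<^esub> (c \<odot>\<^bsub>L\<^esub> l))) = \<pi> f"
    using f(3) l by (simp add: free_monomial_def \<pi>.hom_nat_pow L.m_assoc L.smult_mult_left L.smult_mult_right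
        \<pi>.z_def \<pi>.s_def \<pi>.t_def del: \<pi>.hom_diff)
  then have "\<exists>g. corresponds (\<pi>.letter LZ [^]\<^bsub>L\<^esub> i \<otimes>\<^bsub>L\<^esub> (\<pi>.letter LS [^]\<^bsub>L\<^esub> j \<otimes>\<^bsub>L\<^esub>
      (\<pi>.letter LT [^]\<^bsub>L\<^esub> k \<otimes>\<^bsub>L\<^esub> (c \<odot>\<^bsub>L\<^esub> l)))) g"
    using corresponds_free[OF f(2)] by auto
  then have "\<exists>g. corresponds (\<pi>.letter LS [^]\<^bsub>L\<^esub> j \<otimes>\<^bsub>L\<^esub> (\<pi>.letter LT [^]\<^bsub>L\<^esub> k \<otimes>\<^bsub>L\<^esub> (c \<odot>\<^bsub>L\<^esub> l))) g"
    by (rule pow[of LZi LZ, rotated 2]) (use l in simp_all)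
  then have "\<exists>g. corresponds (\<pi>.letter LT [^]\<^bsub>L\<^esub> k \<otimes>\<^bsub>L\<^esub> (c \<odot>\<^bsub>L\<^esub> l)) g"
    by (rule pow[of LSi LS, rotated 2]) (use l in simp_all)
  then have "\<exists>g. corresponds (c \<odot>\<^bsub>L\<^esub> l) g"
    by (rule pow[of LTi LT, rotated 2]) (use l in simp_all)
  then obtain g where "corresponds (c \<odot>\<^bsub>L\<^esub> l) g" by blast
  from corresponds.scale[OF this, of "inverse c"] show "\<exists>g. corresponds l g" using l f(1) by auto
qed

lemma localization_induct [consumes 1, case_names one letter add scale]:
  assumes l: "l \<in> carrier L"
    and one: "Q \<one>\<^bsub>L\<^esub>"
    and letter: "\<And>l a. l \<in> carrier L \<Longrightarrow> Q l \<Longrightarrow> Q (\<pi>.letter a \<otimes>\<^bsub>L\<^esub> l)"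
    and add: "\<And>l l'. l \<in> carrier L \<Longrightarrow> l' \<in> carrier L \<Longrightarrow> Q l \<Longrightarrow> Q l' \<Longrightarrow> Q (l \<oplus>\<^bsub>L\<^esub> l')"
    and scale: "\<And>c l. l \<in> carrier L \<Longrightarrow> Q l \<Longrightarrow> Q (c \<odot>\<^bsub>L\<^esub> l)"
  shows "Q l"
proof -
  obtain g where "corresponds l g" using corresponds_total[OF l] by blast
  then show ?thesis
    by (induction rule: corresponds.induct) (auto intro!: one letter add scale dest: corresponds_closed simp del: \<pi>.letter.simps)
qed

definition \<Psi> where "\<Psi> l = (THE g. corresponds l g)"

lemma corresponds_\<Psi>: "l \<in> carrier L \<Longrightarrow> corresponds l (\<Psi> l)"
proof -
  assume "l \<in> carrier L"
  then obtain g where g: "corresponds l g" using corresponds_total by blast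
  show ?thesis
    unfolding \<Psi>_def by (rule theI[of "corresponds l", OF g]) (rule corresponds_unique[OF _ g])
qed

lemma \<Psi>_eq:
  assumes "corresponds l g"
  shows "\<Psi> l = g"
  using corresponds_closed[OF assms] by (intro corresponds_unique[OF corresponds_\<Psi> assms]) simp

sublocale \<Psi>: algebra_hom L P \<Psi>
proof (intro algebra_hom.intro algebra_hom_axioms.intro L.assoc_algebra_axioms P.assoc_algebra_axioms)
  have "\<Psi> l \<in> carrier P" if "l \<in> carrier L" for l using corresponds_\<Psi>[OF that] corresponds_closed by blast
  then show "\<Psi> \<in> alg_hom L P"
    unfolding alg_hom_def ring_hom_def
    by (auto intro!: \<Psi>_eq corresponds_mult corresponds.add corresponds.scale corresponds_\<Psi> corresponds.one)
qed

lemma \<Psi>_letter: "\<Psi> (\<pi>.letter a) = \<theta>.letter a"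
  using \<Psi>_eq[OF corresponds.letter[OF corresponds.one, of a]] by (simp del: \<pi>.letter.simps \<theta>.letter.simps)

lemma span_eq: "carrier L = \<pi>.span"
proof
  show "carrier L \<subseteq> \<pi>.span"
  proof
    fix l assume "l \<in> carrier L"
    then show "l \<in> \<pi>.span"
      by (induction rule: localization_induct)
        (simp_all add: \<pi>.one_in_span \<pi>.letter_span \<pi>.span_add \<pi>.span_scale del: \<pi>.letter.simps)
  qed
qed (use \<pi>.span_closed in blast)

text \<open>The criterion is applied twice: to the embedding itself and to its composite with an endomorphism.\<close>

lemma inj_if_degrees_inj:
  assumes g: "algebra_hom L P g" and inj: "inj (\<lambda>n. deg (g (\<pi>.basis n)))"
    and ne: "\<And>n. g (\<pi>.basis n) \<noteq> \<zero>\<^bsub>P\<^esub>"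
  shows "inj_on g (carrier L)"
proof (rule algebra_hom_eq_inj[OF g])
  interpret g: algebra_hom L P g by fact
  fix l assume l: "l \<in> carrier L" and 0: "g l = \<zero>\<^bsub>P\<^esub>"
  obtain c where c: "l = L.lincomb \<pi>.basis c" "finite {n. c n \<noteq> 0}"
    using l by (auto simp: span_eq \<pi>.span_def)
  have sum: "P.lincomb b d k = (\<Sum>n | d n \<noteq> 0. d n * b n k)" if "\<And>n. b n \<in> carrier P" "finite {n. d n \<noteq> 0}"
    for b :: "exponent \<Rightarrow> exponent \<Rightarrow> 'k" and d k
  proof -
    have "(\<Oplus>\<^bsub>P\<^esub>n\<in>F. d n \<odot>\<^bsub>P\<^esub> b n) k = (\<Sum>n\<in>F. d n * b n k)" if "finite F" for F
      using that
    proof (induction F)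
      case empty
      then show ?case by (simp add: P_simps(3))
    next
      case (insert m F)
      have "(\<Oplus>\<^bsub>P\<^esub>n\<in>insert m F. d n \<odot>\<^bsub>P\<^esub> b n)
          = d m \<odot>\<^bsub>P\<^esub> b m \<oplus>\<^bsub>P\<^esub> (\<Oplus>\<^bsub>P\<^esub>n\<in>F. d n \<odot>\<^bsub>P\<^esub> b n)"
        by (rule P.finsum_insert) (use insert \<open>\<And>n. b n \<in> carrier P\<close> in auto)
      then have "(\<Oplus>\<^bsub>P\<^esub>n\<in>insert m F. d n \<odot>\<^bsub>P\<^esub> b n) k
          = d m * b m k + (\<Oplus>\<^bsub>P\<^esub>n\<in>F. d n \<odot>\<^bsub>P\<^esub> b n) k"
        by (simp add: P_simps(4,5))
      then show ?case using insert by simp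
    qed
    then show ?thesis using that by (simp add: P.lincomb_def)
  qed
  have "g l = P.lincomb (\<lambda>n. g (\<pi>.basis n)) c"
    unfolding c(1) by (rule g.hom_lincomb) (use c in auto)
  then have "(\<lambda>k. \<Sum>n | c n \<noteq> 0. c n * g (\<pi>.basis n) k) = \<zero>\<^bsub>P\<^esub>"
    using 0 c(2) sum[of "\<lambda>n. g (\<pi>.basis n)" c] by auto
  then have "c n = 0" if "c n \<noteq> 0" for n
    using that c(2) inj ne
    by (intro independent_if_deg_inj[of "{n. c n \<noteq> 0}" "\<lambda>n. g (\<pi>.basis n)" c n])
      (auto intro: inj_on_subset)
  then have "c n = 0" for n by blast
  then have "c = (\<lambda>n. 0)" by (intro ext)
  then show "l = \<zero>\<^bsub>L\<^esub>" using c by simp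
qed

end

section \<open>Units of the localization have degree zero\<close>

context quantum_torus
begin

text \<open>The value at \<open>z = p\<^sup>r\<close> of the coefficient of \<open>s\<^sup>j t\<^sup>k x\<^sup>n\<close>, a Laurent polynomial in
\<open>z\<close>.\<close>

definition eval_row :: "int \<Rightarrow> int \<Rightarrow> int \<Rightarrow> int \<Rightarrow> (exponent \<Rightarrow> 'k) \<Rightarrow> 'k" where
  "eval_row r n j k f = (\<Sum>i | f (n, j, k, i) \<noteq> 0. p powi (r * i) * f (n, j, k, i))"

lemma eval_row_superset:
  assumes "finite A" "{i. f (n, j, k, i) \<noteq> 0} \<subseteq> A"
  shows "eval_row r n j k f = (\<Sum>i\<in>A. p powi (r * i) * f (n, j, k, i))"
  unfolding eval_row_def using assms by (intro sum.mono_neutral_left) auto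

lemma finite_row:
  assumes "f \<in> carrier P"
  shows "finite {i. f (n, j, k, i) \<noteq> 0}"
proof -
  have "finite {m. f m \<noteq> 0}" using assms by (simp add: P_simps(1))
  then have "finite ((\<lambda>i. (n, j, k, i)) -` {m. f m \<noteq> 0})"
    by (rule finite_vimageI) (simp add: inj_on_def)
  then show ?thesis by (simp add: vimage_def)
qed

lemma eval_row_add:
  assumes "f \<in> carrier P" "g \<in> carrier P"
  shows "eval_row r n j k (f \<oplus>\<^bsub>P\<^esub> g) = eval_row r n j k f + eval_row r n j k g"
proof -
  let ?A = "{i. f (n, j, k, i) \<noteq> 0} \<union> {i. g (n, j, k, i) \<noteq> 0}"
  have fin: "finite ?A" using finite_row assms by simp
  have "eval_row r n j k (f \<oplus>\<^bsub>P\<^esub> g) = (\<Sum>i\<in>?A. p powi (r * i) * (f \<oplus>\<^bsub>P\<^esub> g) (n, j, k, i))"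
    by (rule eval_row_superset[OF fin]) (auto simp: P_simps(4))
  also have "\<dots> = (\<Sum>i\<in>?A. p powi (r * i) * f (n, j, k, i)) + (\<Sum>i\<in>?A. p powi (r * i) * g (n, j, k, i))"
    by (simp add: P_simps(4) algebra_simps sum.distrib)
  also have "\<dots> = eval_row r n j k f + eval_row r n j k g"
    by (simp add: eval_row_superset[OF fin, symmetric])
  finally show ?thesis .
qed

lemma eval_row_scale:
  assumes "f \<in> carrier P"
  shows "eval_row r n j k (c \<odot>\<^bsub>P\<^esub> f) = c * eval_row r n j k f"
  by (subst eval_row_superset[OF finite_row[OF assms]])
    (auto simp: P_simps(5) eval_row_def sum_distrib_left algebra_simps)

lemma eval_row_mono: "eval_row r n j k (monomial c (n', j', k', i)) = (if n = n' \<and> j = j' \<and> k = k' then p powi (r * i) * c else 0)"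
  by (subst eval_row_superset[of "{i}"]) (auto simp: mono_apply)

lemma eval_row_mono_mult:
  assumes "g \<in> carrier P"
  shows "eval_row r n j k (monomial c (a, b, d, e) \<otimes>\<^bsub>P\<^esub> g)
    = c * p powi (r * e) * q powi (- (d * (j - b))) * eval_row (r + a) (n - a) (j - b) (k - d) g"
proof -
  let ?B = "{i. g (n - a, j - b, k - d, i) \<noteq> 0}"
  have "eval_row r n j k (monomial c (a, b, d, e) \<otimes>\<^bsub>P\<^esub> g)
      = (\<Sum>i\<in>(\<lambda>i. i + e) ` ?B. p powi (r * i) * (monomial c (a, b, d, e) \<otimes>\<^bsub>P\<^esub> g) (n, j, k, i))"
  proof (rule eval_row_superset)
    show "{i. (monomial c (a, b, d, e) \<otimes>\<^bsub>P\<^esub> g) (n, j, k, i) \<noteq> 0} \<subseteq> (\<lambda>i. i + e) ` ?B"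
    proof
      fix i assume "i \<in> {i. (monomial c (a, b, d, e) \<otimes>\<^bsub>P\<^esub> g) (n, j, k, i) \<noteq> 0}"
      then show "i \<in> (\<lambda>i. i + e) ` ?B"
        by (intro image_eqI[of _ _ "i - e"]) (auto simp: mono_mult_apply)
    qed
  qed (use finite_row[OF assms] in simp)
  also have "\<dots> = (\<Sum>i\<in>?B. p powi (r * (i + e)) * (monomial c (a, b, d, e) \<otimes>\<^bsub>P\<^esub> g) (n, j, k, i + e))"
    by (subst sum.reindex) (auto simp: inj_on_def)
  also have "\<dots> = (\<Sum>i\<in>?B. c * p powi (r * e) * q powi (- (d * (j - b)))
      * (p powi ((r + a) * i) * g (n - a, j - b, k - d, i)))"
    using p0 by (intro sum.cong refl) (simp add: mono_mult_apply distrib_left distrib_right power_int_add)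
  finally show ?thesis by (simp add: eval_row_def sum_distrib_left)
qed

text \<open>For \<open>m > 0\<close> the element \<open>y\<^sup>m\<close> is a multiple of
\<open>(z - 1) (p\<^sup>-\<^sup>1 z - 1) \<dots> (p\<^bsup>-(m-1)\<^esup> z - 1) x\<^bsup>-m\<^esup>\<close>, so in the image of the localization the coefficient
of \<open>x\<^bsup>-m\<^esup>\<close> vanishes at \<open>z = p\<^sup>r\<close> for \<open>0 \<le> r < m\<close>. Left multiplication by
\<open>x\<close> and \<open>y\<close> shifts \<open>r\<close>, so the induction has to carry all these zeros along.\<close>

definition vanishing :: "(exponent \<Rightarrow> 'k) \<Rightarrow> bool" where
  "vanishing f \<longleftrightarrow> (\<forall>n r j k. 0 \<le> r \<and> r < - n \<longrightarrow> eval_row r n j k f = 0)"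

lemma vanishing_unit:
  assumes "vanishing g" "g \<in> carrier P" "u \<in> Units P" "fst (deg u) = 0"
  shows "vanishing (u \<otimes>\<^bsub>P\<^esub> g)"
proof -
  obtain c where c: "c \<noteq> 0" "u = monomial c (deg u)" by (rule unit_is_mono[OF assms(3)])
  obtain b d e where d: "deg u = (0, b, d, e)" using assms(4) by (cases "deg u") auto
  show ?thesis
    unfolding vanishing_def c(2)[unfolded d] using assms(1,2)
    by (simp add: eval_row_mono_mult vanishing_def)
qed

lemma \<theta>_gens:
  "\<theta>.x = monomial 1 (1, 0, 0, 0)"
  "\<theta>.y = monomial (inverse (p - 1)) (-1, 0, 0, 1) \<oplus>\<^bsub>P\<^esub> monomial (- inverse (p - 1)) (-1, 0, 0, 0)"
  "\<theta>.z = monomial 1 (0, 0, 0, 1)" "\<theta>.s = monomial 1 (0, 1, 0, 0)" "\<theta>.t = monomial 1 (0, 0, 1, 0)"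
  using \<theta>_z by (simp_all only: \<theta>.x_def \<theta>.y_def \<theta>.z_def \<theta>.s_def \<theta>.t_def \<theta>(2) torus_gen.simps)

lemma deg_inv: "u \<in> Units P \<Longrightarrow> deg (inv\<^bsub>P\<^esub> u) = - deg u"
proof -
  assume u: "u \<in> Units P"
  then have "inv\<^bsub>P\<^esub> u \<in> Units P" by simp
  then have "u \<noteq> \<zero>\<^bsub>P\<^esub>" "inv\<^bsub>P\<^esub> u \<noteq> \<zero>\<^bsub>P\<^esub>" using u unit_is_mono mono_eq_zero_iff by metis+
  then have "deg u + deg (inv\<^bsub>P\<^esub> u) = 0"
    using u deg_mult[of u "inv\<^bsub>P\<^esub> u"] by (simp add: P.Units_closed one_eq_mono)
  then show ?thesis by (simp add: eq_neg_iff_add_eq_0 add.commute)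
qed

lemma vanishing_x: "vanishing g \<Longrightarrow> g \<in> carrier P \<Longrightarrow> vanishing (\<theta>.x \<otimes>\<^bsub>P\<^esub> g)"
  by (auto simp: vanishing_def \<theta>_gens eval_row_mono_mult)

lemma vanishing_y:
  assumes "vanishing g" and g: "g \<in> carrier P"
  shows "vanishing (\<theta>.y \<otimes>\<^bsub>P\<^esub> g)"
  unfolding vanishing_def
proof (intro allI impI)
  fix n r j k assume r: "0 \<le> r \<and> r < - (n::int)"
  have "eval_row r n j k (\<theta>.y \<otimes>\<^bsub>P\<^esub> g) = (p powi r - 1) * inverse (p - 1) * eval_row (r - 1) (n + 1) j k g"
    using g by (simp add: \<theta>_gens P.l_distr eval_row_add eval_row_mono_mult algebra_simps)
  also have "\<dots> = 0"
  proof (cases "r = 0")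
    case False
    then have "0 \<le> r - 1 \<and> r - 1 < - (n + 1)" using r by auto
    then show ?thesis using assms(1) by (auto simp: vanishing_def)
  qed simp
  finally show "eval_row r n j k (\<theta>.y \<otimes>\<^bsub>P\<^esub> g) = 0" .
qed

lemma vanishing_letter:
  assumes "vanishing g" "g \<in> carrier P"
  shows "vanishing (\<theta>.letter a \<otimes>\<^bsub>P\<^esub> g)"
proof -
  have unit: "vanishing (u \<otimes>\<^bsub>P\<^esub> g)" "vanishing (inv\<^bsub>P\<^esub> u \<otimes>\<^bsub>P\<^esub> g)"
    if "u \<in> Units P" "fst (deg u) = 0" for u
    using that assms by (auto intro!: vanishing_unit simp: deg_inv)
  show ?thesis
  proof (cases a)
    case LX then show ?thesis using vanishing_x[OF assms] by simp
  next
    case LY then show ?thesis using vanishing_y[OF assms] by simp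
  next
    case LZ then show ?thesis using unit(1)[OF \<theta>.Units(1)] by (simp add: \<theta>_gens)
  next
    case LZi then show ?thesis using unit(2)[OF \<theta>.Units(1)] by (simp add: \<theta>_gens)
  next
    case LS then show ?thesis using unit(1)[OF \<theta>.Units(2)] by (simp add: \<theta>_gens)
  next
    case LSi then show ?thesis using unit(2)[OF \<theta>.Units(2)] by (simp add: \<theta>_gens)
  next
    case LT then show ?thesis using unit(1)[OF \<theta>.Units(3)] by (simp add: \<theta>_gens)
  next
    case LTi then show ?thesis using unit(2)[OF \<theta>.Units(3)] by (simp add: \<theta>_gens)
  qed
qed

end

context weyl_localization
begin

lemma vanishing_\<Psi>: "l \<in> carrier L \<Longrightarrow> vanishing (\<Psi> l)"
proof (induction rule: localization_induct)
  case one
  then show ?case by (auto simp: vanishing_def one_eq_mono zero_prod_def eval_row_mono)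
next
  case (letter l a)
  then show ?case
    by (simp add: \<Psi>_letter vanishing_letter del: \<pi>.letter.simps \<theta>.letter.simps)
next
  case (add l l')
  then show ?case by (simp add: vanishing_def eval_row_add)
next
  case (scale c l)
  then show ?case by (simp add: vanishing_def eval_row_scale)
qed

text \<open>A monomial in \<open>z\<close> does not vanish at \<open>z = 1\<close>.\<close>

lemma monomial_X_degree:
  assumes "l \<in> carrier L" "\<Psi> l = monomial c n" "c \<noteq> 0"
  shows "0 \<le> fst n"
proof (rule ccontr)
  assume neg: "\<not> 0 \<le> fst n"
  obtain a j k i where n: "n = (a, j, k, i)" by (cases n)
  have "eval_row 0 a j k (\<Psi> l) = 0" using vanishing_\<Psi>[OF assms(1)] neg by (simp add: vanishing_def n)
  then show False using assms(2,3) by (simp add: n eval_row_mono)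
qed

lemma unit_X_degree:
  assumes u: "u \<in> Units L"
  shows "fst (deg (\<Psi> u)) = 0"
proof -
  have nonneg: "0 \<le> fst (deg (\<Psi> v))" if v: "v \<in> Units L" for v
  proof -
    obtain c where c: "c \<noteq> 0" "\<Psi> v = monomial c (deg (\<Psi> v))"
      by (rule unit_is_mono[OF \<Psi>.hom_Units[OF v]])
    show ?thesis by (rule monomial_X_degree[OF L.Units_closed[OF v] c(2,1)])
  qed
  have iu: "inv\<^bsub>L\<^esub> u \<in> Units L" using u by simp
  have "\<Psi> (inv\<^bsub>L\<^esub> u) = inv\<^bsub>P\<^esub> (\<Psi> u)"
    using \<Psi>.hom_upow[OF u, of "-1"] u \<Psi>.hom_Units[OF u] by (simp add: L.upow_minus_1 P.upow_minus_1)
  then have "fst (deg (\<Psi> (inv\<^bsub>L\<^esub> u))) = - fst (deg (\<Psi> u))"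
    using deg_inv[OF \<Psi>.hom_Units[OF u]] by simp
  then show ?thesis using nonneg[OF u] nonneg[OF iu] by simp
qed

section \<open>Endomorphisms\<close>

lemma torus_rep_endo:
  assumes "algebra_hom L L \<phi>"
  shows "torus_rep p q (\<lambda>f. \<Psi> (\<phi> (\<pi> f)))"
proof -
  interpret \<phi>: algebra_hom L L \<phi> by fact
  have comp: "algebra_hom L P (\<lambda>l. \<Psi> (\<phi> l))"
    by (rule algebra_hom_comp[OF \<phi>.algebra_hom_axioms \<Psi>.algebra_hom_axioms])
  interpret \<tau>: weyl_rep P "\<lambda>f. \<Psi> (\<phi> (\<pi> f))" p q
    by (rule weyl_rep_comp[OF weyl_rep_\<pi> comp])
  have "fst (deg \<tau>.z) = 0" "fst (deg \<tau>.s) = 0" "fst (deg \<tau>.t) = 0"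
    unfolding \<tau>.z_def \<tau>.s_def \<tau>.t_def
    by (intro unit_X_degree \<phi>.hom_Units \<pi>.z_Units \<pi>.s_Units \<pi>.t_Units)+
  then show ?thesis
    by (intro torus_rep.intro torus_rep_axioms.intro quantum_torus_axioms \<tau>.weyl_rep_axioms)
qed

lemma endo_inj:
  assumes "algebra_hom L L \<phi>"
  shows "inj_on (\<lambda>l. \<Psi> (\<phi> l)) (carrier L)"
proof -
  interpret \<phi>: algebra_hom L L \<phi> by fact
  have comp: "algebra_hom L P (\<lambda>l. \<Psi> (\<phi> l))"
    by (rule algebra_hom_comp[OF \<phi>.algebra_hom_axioms \<Psi>.algebra_hom_axioms])
  interpret \<tau>: torus_rep p q "\<lambda>f. \<Psi> (\<phi> (\<pi> f))" by (rule torus_rep_endo[OF assms])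
  have "\<Psi> (\<phi> (\<pi>.basis n)) = \<tau>.basis n" for n
    by (rule weyl_rep_comp_basis[OF weyl_rep_\<pi> comp])
  then show ?thesis
    using \<tau>.deg_basis_inj \<tau>.basis_nonzero by (intro inj_if_degrees_inj[OF comp]) simp_all
qed

lemma \<Psi>_inj: "inj_on \<Psi> (carrier L)"
proof -
  have "algebra_hom L L (\<lambda>l. l)"
    by unfold_locales (auto simp: alg_hom_def ring_hom_def)
  from endo_inj[OF this] show ?thesis .
qed

lemma proportional:
  assumes l: "l \<in> carrier L" "l' \<in> carrier L" and eq: "\<Psi> l' = c \<odot>\<^bsub>P\<^esub> \<Psi> l"
  shows "l' = c \<odot>\<^bsub>L\<^esub> l"
  using inj_onD[OF \<Psi>_inj, of l' "c \<odot>\<^bsub>L\<^esub> l"] l eq by simp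

lemma monomials_proportional:
  assumes "l \<in> carrier L" "l' \<in> carrier L" and "\<Psi> l = monomial a n" "\<Psi> l' = monomial b n" "a \<noteq> 0"
  shows "l' = (b / a) \<odot>\<^bsub>L\<^esub> l"
  by (rule proportional) (use assms in \<open>simp_all add: scale_mono\<close>)

lemma \<Psi>_torus_part:
  obtains c where "c \<noteq> 0" "\<Psi> (\<pi>.torus_part i j k) = monomial c (0, j, k, i)"
proof -
  have U: "\<Psi> \<pi>.z = monomial 1 (0, 0, 0, 1)" "\<Psi> \<pi>.s = monomial 1 (0, 1, 0, 0)" "\<Psi> \<pi>.t = monomial 1 (0, 0, 1, 0)"
    using \<Psi>_letter[of LZ] \<Psi>_letter[of LS] \<Psi>_letter[of LT] by (simp_all add: \<theta>_gens)
  have idh: "algebra_hom L L (\<lambda>l. l)"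
    by unfold_locales (auto simp: alg_hom_def ring_hom_def)
  interpret \<tau>: torus_rep p q "\<lambda>f. \<Psi> (\<pi> f)" using torus_rep_endo[OF idh] .
  have eq: "\<Psi> (\<pi>.torus_part i j k) = \<tau>.torus_part i j k"
    using weyl_rep_comp_basis[OF weyl_rep_\<pi> \<Psi>.algebra_hom_axioms, of "(0, j, k, i)"]
    by (simp add: \<pi>.xy_part_def \<tau>.xy_part_def)
  have gens: "\<tau>.z = \<Psi> \<pi>.z" "\<tau>.s = \<Psi> \<pi>.s" "\<tau>.t = \<Psi> \<pi>.t"
    by (simp_all only: \<tau>.z_def \<tau>.s_def \<tau>.t_def \<pi>.z_def \<pi>.s_def \<pi>.t_def)
  have d: "e (deg (\<tau>.torus_part i j k)) = i * e (0, 0, 0, 1) + j * e (0, 1, 0, 0) + k * e (0, 0, 1, 0)"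
    if e: "\<And>m n. e (m + n) = (e m + e n :: int)" for e
    using \<tau>.deg_torus_part[OF e, of i j k] by (simp add: gens U)
  have "deg (\<tau>.torus_part i j k) = (0, j, k, i)"
    using d[of fst] d[of "\<lambda>m. fst (snd m)"] d[of "\<lambda>m. fst (snd (snd m))"] d[of "\<lambda>m. snd (snd (snd m))"]
    by (simp add: prod_eq_iff)
  then show ?thesis
    using that eq \<tau>.unit_form[OF \<tau>.torus_part_Units[of i j k]] by metis
qed

lemma x_from_monomial:
  assumes l: "l \<in> carrier L" and c: "\<Psi> l = monomial c n" "c \<noteq> 0" and n: "fst n = 1"
  shows "\<exists>u\<in>Units L. \<pi>.x = u \<otimes>\<^bsub>L\<^esub> l"
proof -
  obtain j k i where n: "n = (1, j, k, i)" using n by (cases n) auto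
  obtain d where d: "d \<noteq> 0" "\<Psi> (\<pi>.torus_part i j k) = monomial d (0, j, k, i)" by (rule \<Psi>_torus_part)
  have "\<Psi> (\<pi>.torus_part i j k \<otimes>\<^bsub>L\<^esub> \<pi>.x) = monomial d n"
    using d \<Psi>_letter[of LX] by (simp add: \<theta>_gens mono_mult_mono n)
  then have eq: "\<pi>.torus_part i j k \<otimes>\<^bsub>L\<^esub> \<pi>.x = (d / c) \<odot>\<^bsub>L\<^esub> l"
    by (intro monomials_proportional[OF l]) (use c in auto)
  let ?v = "\<pi>.torus_part i j k"
  have v: "?v \<in> Units L" "inv\<^bsub>L\<^esub> ?v \<in> Units L" "inv\<^bsub>L\<^esub> ?v \<in> carrier L" by auto
  have "\<pi>.x = inv\<^bsub>L\<^esub> ?v \<otimes>\<^bsub>L\<^esub> (?v \<otimes>\<^bsub>L\<^esub> \<pi>.x)" using v by (simp add: L.m_assoc[symmetric])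
  also have "\<dots> = ((d / c) \<odot>\<^bsub>L\<^esub> inv\<^bsub>L\<^esub> ?v) \<otimes>\<^bsub>L\<^esub> l"
    using v l by (simp add: eq L.smult_mult_left L.smult_mult_right)
  finally show ?thesis using v c(2) d(1) L.scale_Units[of "d / c"] by auto
qed

text \<open>Vanishing at \<open>z = 1\<close> makes the two coefficients of the binomial opposite, which is the shape of
\<open>z\<^sup>i s\<^sup>j t\<^sup>k y\<close>.\<close>

lemma y_from_binomial:
  assumes l: "l \<in> carrier L" and ne: "\<Psi> l \<noteq> \<zero>\<^bsub>P\<^esub>" and w: "deg (\<Psi> l) = ldeg (\<Psi> l) + (0, 0, 0, 1)"
    and n: "fst (deg (\<Psi> l)) = -1"
  shows "\<exists>u\<in>Units L. \<pi>.y = u \<otimes>\<^bsub>L\<^esub> l"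
proof -
  have fc: "\<Psi> l \<in> carrier P" using l by simp
  obtain j k i where m: "ldeg (\<Psi> l) = (-1, j, k, i)" using n w by (cases "ldeg (\<Psi> l)") auto
  then have m': "deg (\<Psi> l) = (-1, j, k, i + 1)" using w by simp
  define a b where "a = \<Psi> l (-1, j, k, i)" and "b = \<Psi> l (-1, j, k, i + 1)"
  have f: "\<Psi> l = monomial a (-1, j, k, i) \<oplus>\<^bsub>P\<^esub> monomial b (-1, j, k, i + 1)"
    using binomial_form[OF fc ne w] by (simp add: m m' a_def b_def)
  have "b \<noteq> 0" using deg_works(1)[OF fc ne] by (simp add: m' b_def)
  have "eval_row 0 (-1) j k (\<Psi> l) = 0" using vanishing_\<Psi>[OF l] by (simp add: vanishing_def)
  then have "a + b = 0" unfolding f by (simp add: eval_row_add eval_row_mono)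
  then have a: "a = - b" by (simp add: eq_neg_iff_add_eq_0)
  obtain d where d: "d \<noteq> 0" "\<Psi> (\<pi>.torus_part i j k) = monomial d (0, j, k, i)" by (rule \<Psi>_torus_part)
  let ?v = "\<pi>.torus_part i j k" and ?e = "d * inverse (p - 1)"
  have "\<Psi> (?v \<otimes>\<^bsub>L\<^esub> \<pi>.y) = monomial ?e (-1, j, k, i + 1) \<oplus>\<^bsub>P\<^esub> monomial (- ?e) (-1, j, k, i)"
    using d \<Psi>_letter[of LY] by (simp add: \<theta>_gens mono_mult_mono P.r_distr)
  also have "\<dots> = (?e / b) \<odot>\<^bsub>P\<^esub> \<Psi> l"
    unfolding f using \<open>b \<noteq> 0\<close> by (simp add: P.scale_add_right scale_mono a P.a_comm)
  finally have eq: "?v \<otimes>\<^bsub>L\<^esub> \<pi>.y = (?e / b) \<odot>\<^bsub>L\<^esub> l"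
    by (intro proportional[OF l]) auto
  have v: "?v \<in> Units L" "inv\<^bsub>L\<^esub> ?v \<in> Units L" "inv\<^bsub>L\<^esub> ?v \<in> carrier L" by auto
  have "\<pi>.y = inv\<^bsub>L\<^esub> ?v \<otimes>\<^bsub>L\<^esub> (?v \<otimes>\<^bsub>L\<^esub> \<pi>.y)" using v by (simp add: L.m_assoc[symmetric])
  also have "\<dots> = ((?e / b) \<odot>\<^bsub>L\<^esub> inv\<^bsub>L\<^esub> ?v) \<otimes>\<^bsub>L\<^esub> l"
    using v l by (simp add: eq L.smult_mult_left L.smult_mult_right)
  finally show ?thesis using v d(1) \<open>b \<noteq> 0\<close> p1 L.scale_Units[of "?e / b"] by auto
qed

text \<open>The factor of degree \<open>-1\<close> in \<open>x\<close> cannot be the monomial one, since monomials of negative degree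
are outside the image of the embedding.\<close>

lemma x_y_from_pair:
  assumes l: "l \<in> carrier L" "l' \<in> carrier L" and ne: "\<Psi> l \<noteq> \<zero>\<^bsub>P\<^esub>" "\<Psi> l' \<noteq> \<zero>\<^bsub>P\<^esub>"
    and n: "fst (deg (\<Psi> l)) = 1" "fst (deg (\<Psi> l')) = -1"
    and w: "ldeg (\<Psi> l) = deg (\<Psi> l) \<and> deg (\<Psi> l') = ldeg (\<Psi> l') + (0, 0, 0, 1) \<or>
      ldeg (\<Psi> l') = deg (\<Psi> l') \<and> deg (\<Psi> l) = ldeg (\<Psi> l) + (0, 0, 0, 1)"
  shows "(\<exists>u\<in>Units L. \<pi>.x = u \<otimes>\<^bsub>L\<^esub> l) \<and> (\<exists>u\<in>Units L. \<pi>.y = u \<otimes>\<^bsub>L\<^esub> l')"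
proof -
  have c: "\<Psi> l \<in> carrier P" "\<Psi> l' \<in> carrier P" using l by auto
  have "ldeg (\<Psi> l') \<noteq> deg (\<Psi> l')"
    using monomial_X_degree[OF l(2) eq_mono_if_deg_eq[OF c(2) ne(2)]] deg_works(1)[OF c(2) ne(2)] n(2)
    by auto
  then have "deg (\<Psi> l) = ldeg (\<Psi> l)" "deg (\<Psi> l') = ldeg (\<Psi> l') + (0, 0, 0, 1)" using w by auto
  then show ?thesis
    using x_from_monomial[OF l(1) eq_mono_if_deg_eq[OF c(1) ne(1)] deg_works(1)[OF c(1) ne(1)] n(1)]
      y_from_binomial[OF l(2) ne(2) _ n(2)] by blast
qed

text \<open>By the determinant one, the images of \<open>z\<close>, \<open>s\<close>, \<open>t\<close> generate units of every degree, so the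
image of the endomorphism contains all units; it also contains \<open>x\<close> and \<open>y\<close> because these are
unit multiples of the images of \<open>x\<close> and \<open>y\<close>, in one order or the other.\<close>

lemma endo_surj:
  assumes "algebra_hom L L \<phi>"
  shows "\<phi> ` carrier L = carrier L"
proof -
  interpret \<phi>: algebra_hom L L \<phi> by fact
  have comp: "algebra_hom L P (\<lambda>l. \<Psi> (\<phi> l))"
    by (rule algebra_hom_comp[OF \<phi>.algebra_hom_axioms \<Psi>.algebra_hom_axioms])
  interpret \<tau>: torus_rep p q "\<lambda>f. \<Psi> (\<phi> (\<pi> f))" by (rule torus_rep_endo[OF assms])
  let ?J = "\<phi> ` carrier L"
  have closed: "\<one>\<^bsub>L\<^esub> \<in> ?J" "\<And>a b. a \<in> ?J \<Longrightarrow> b \<in> ?J \<Longrightarrow> a \<otimes>\<^bsub>L\<^esub> b \<in> ?J"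
    "\<And>a b. a \<in> ?J \<Longrightarrow> b \<in> ?J \<Longrightarrow> a \<oplus>\<^bsub>L\<^esub> b \<in> ?J" "\<And>c a. a \<in> ?J \<Longrightarrow> c \<odot>\<^bsub>L\<^esub> a \<in> ?J"
  proof -
    show "\<one>\<^bsub>L\<^esub> \<in> ?J" by (rule image_eqI[of _ _ "\<one>\<^bsub>L\<^esub>"]) simp_all
    show "a \<otimes>\<^bsub>L\<^esub> b \<in> ?J" "a \<oplus>\<^bsub>L\<^esub> b \<in> ?J" if ab: "a \<in> ?J" "b \<in> ?J" for a b
    proof -
      obtain l l' where l: "l \<in> carrier L" "a = \<phi> l" "l' \<in> carrier L" "b = \<phi> l'" using ab by blast
      show "a \<otimes>\<^bsub>L\<^esub> b \<in> ?J" by (rule image_eqI[of _ _ "l \<otimes>\<^bsub>L\<^esub> l'"]) (simp_all add: l)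
      show "a \<oplus>\<^bsub>L\<^esub> b \<in> ?J" by (rule image_eqI[of _ _ "l \<oplus>\<^bsub>L\<^esub> l'"]) (simp_all add: l)
    qed
    show "c \<odot>\<^bsub>L\<^esub> a \<in> ?J" if a: "a \<in> ?J" for c a
    proof -
      obtain l where l: "l \<in> carrier L" "a = \<phi> l" using a by blast
      show ?thesis by (rule image_eqI[of _ _ "c \<odot>\<^bsub>L\<^esub> l"]) (simp_all add: l)
    qed
  qed
  obtain e j1 k1 i1 j2 k2 i2 where d: "deg \<tau>.z = (0, 0, 0, e)" "deg \<tau>.s = (0, j1, k1, i1)"
    "deg \<tau>.t = (0, j2, k2, i2)" "j1 * k2 - k1 * j2 = 1"
    by (rule \<tau>.unit_degrees)
  have x_deg: "fst (deg \<tau>.x) * e = 1" and y_deg: "fst (deg \<tau>.y) * e = -1"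
    using \<tau>.xy_degrees[OF d(1)] deg_works(1) \<tau>.xy_nonzero by simp_all
  then have e: "e = 1 \<or> e = -1" by (auto simp: zmult_eq_1_iff)
  have Units: "v \<in> ?J" if v: "v \<in> Units L" for v
  proof -
    obtain j k i where dv: "deg (\<Psi> v) = (0, j, k, i)"
      using unit_X_degree[OF v] by (cases "deg (\<Psi> v)") auto
    \<comment> \<open>Cramer's rule for the exponents of \<open>s\<close> and \<open>t\<close>; then \<open>e\<^sup>2 = 1\<close> corrects that of \<open>z\<close>.\<close>
    define m2 m3 where "m2 = j * k2 - k * j2" and "m3 = k * j1 - j * k1"
    define m1 where "m1 = e * (i - m2 * i1 - m3 * i2)"
    have "m2 * j1 + m3 * j2 = j * (j1 * k2 - k1 * j2)" "m2 * k1 + m3 * k2 = k * (j1 * k2 - k1 * j2)"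
      by (simp_all add: m2_def m3_def algebra_simps)
    then have jk: "m2 * j1 + m3 * j2 = j" "m2 * k1 + m3 * k2 = k" using d(4) by simp_all
    have i: "m1 * e + m2 * i1 + m3 * i2 = i" using e by (auto simp: m1_def)
    let ?u = "\<pi>.torus_part m1 m2 m3"
    have eq: "\<Psi> (\<phi> ?u) = \<tau>.torus_part m1 m2 m3"
      using weyl_rep_comp_basis[OF weyl_rep_\<pi> comp, of "(0, m2, m3, m1)"]
      by (simp add: \<pi>.xy_part_def \<tau>.xy_part_def)
    have pr: "f (deg (\<tau>.torus_part m1 m2 m3)) = m1 * f (0, 0, 0, e) + m2 * f (0, j1, k1, i1) + m3 * f (0, j2, k2, i2)"
      if f: "\<And>m n. f (m + n) = (f m + f n :: int)" for f
      using \<tau>.deg_torus_part[OF f, of m1 m2 m3] by (simp add: d)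
    have "deg (\<tau>.torus_part m1 m2 m3) = (0, j, k, i)"
      using pr[of fst] pr[of "\<lambda>m. fst (snd m)"] pr[of "\<lambda>m. fst (snd (snd m))"] pr[of "\<lambda>m. snd (snd (snd m))"] jk i
      by (simp add: prod_eq_iff)
    then have "deg (\<Psi> (\<phi> ?u)) = deg (\<Psi> v)" by (simp add: eq dv)
    moreover obtain a where "a \<noteq> 0" "\<Psi> (\<phi> ?u) = monomial a (deg (\<Psi> (\<phi> ?u)))"
      by (rule unit_is_mono[OF \<Psi>.hom_Units[OF \<phi>.hom_Units[OF \<pi>.torus_part_Units]]])
    moreover obtain b where "b \<noteq> 0" "\<Psi> v = monomial b (deg (\<Psi> v))"
      by (rule unit_is_mono[OF \<Psi>.hom_Units[OF v]])
    ultimately have "v = (b / a) \<odot>\<^bsub>L\<^esub> \<phi> ?u"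
      using v by (intro monomials_proportional[of _ _ a "deg (\<Psi> v)"]) (auto simp: L.Units_closed)
    then show ?thesis using closed(4) by blast
  qed
  have \<tau>_gens: "\<tau>.x = \<Psi> (\<phi> \<pi>.x)" "\<tau>.y = \<Psi> (\<phi> \<pi>.y)"
    by (simp_all only: \<tau>.x_def \<tau>.y_def \<pi>.x_def \<pi>.y_def)
  have c: "\<phi> \<pi>.x \<in> carrier L" "\<phi> \<pi>.y \<in> carrier L" by auto
  note facts = \<tau>.xy_nonzero[unfolded \<tau>_gens] x_deg[unfolded \<tau>_gens] y_deg[unfolded \<tau>_gens]
    \<tau>.width[unfolded \<tau>_gens]
  have "\<exists>l\<in>?J. \<exists>u\<in>Units L. \<pi>.x = u \<otimes>\<^bsub>L\<^esub> l" "\<exists>l\<in>?J. \<exists>u\<in>Units L. \<pi>.y = u \<otimes>\<^bsub>L\<^esub> l"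
  proof -
    have "(\<exists>u\<in>Units L. \<pi>.x = u \<otimes>\<^bsub>L\<^esub> \<phi> \<pi>.x) \<and> (\<exists>u\<in>Units L. \<pi>.y = u \<otimes>\<^bsub>L\<^esub> \<phi> \<pi>.y) \<or>
      (\<exists>u\<in>Units L. \<pi>.x = u \<otimes>\<^bsub>L\<^esub> \<phi> \<pi>.y) \<and> (\<exists>u\<in>Units L. \<pi>.y = u \<otimes>\<^bsub>L\<^esub> \<phi> \<pi>.x)"
      using e
    proof
      assume "e = 1"
      then have "fst (deg (\<Psi> (\<phi> \<pi>.x))) = 1" "fst (deg (\<Psi> (\<phi> \<pi>.y))) = -1"
        using facts(3,4) by simp_all
      then show ?thesis by (intro disjI1 x_y_from_pair[OF c facts(1,2) _ _ facts(5)])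
    next
      assume "e = -1"
      then have "fst (deg (\<Psi> (\<phi> \<pi>.y))) = 1" "fst (deg (\<Psi> (\<phi> \<pi>.x))) = -1"
        using facts(3,4) by simp_all
      then show ?thesis
        by (intro disjI2 x_y_from_pair[OF c(2,1) facts(2,1) _ _ disj_commute[THEN iffD1, OF facts(5)]])
    qed
    then show "\<exists>l\<in>?J. \<exists>u\<in>Units L. \<pi>.x = u \<otimes>\<^bsub>L\<^esub> l" "\<exists>l\<in>?J. \<exists>u\<in>Units L. \<pi>.y = u \<otimes>\<^bsub>L\<^esub> l"
      using \<pi>.gens_closed by blast+
  qed
  then have xy: "\<pi>.x \<in> ?J" "\<pi>.y \<in> ?J" using closed(2) Units by metis+
  have letters: "\<pi>.letter a \<in> ?J" for a
    using xy Units by (cases a) simp_all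
  have "l \<in> ?J" if "l \<in> carrier L" for l
    using that
    by (induction rule: localization_induct) (intro closed letters | assumption)+
  then show ?thesis by auto
qed

end

theorem mainTheorem9:
  fixes p q :: "'k::field"
    and L :: "('k, 'b) module"
    and \<iota> :: "(gen list \<Rightarrow> 'k) set \<Rightarrow> 'b"
    and \<phi> :: "'b \<Rightarrow> 'b"
  assumes "p \<noteq> 0" and "q \<noteq> 0"
    and "\<not> root_of_unity p" and "\<not> root_of_unity q"
    and "ore_localization (weyl_algebra p q) (weyl_ore_set p q) L \<iota>"
    and "\<phi> \<in> alg_hom L L"
  shows "\<phi> \<in> alg_iso L L"
proof -
  interpret weyl_localization p q L \<iota>
    by unfold_locales (use assms in auto)
  have hom: "algebra_hom L L \<phi>"
    by (intro algebra_hom.intro algebra_hom_axioms.intro L.assoc_algebra_axioms assms)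
  have "inj_on \<phi> (carrier L)"
    using endo_inj[OF hom] by (auto simp: inj_on_def)
  then show ?thesis
    using endo_surj[OF hom] assms(6) by (simp add: alg_iso_def bij_betw_def)
qed

end
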